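(* Let $u_h$ be a solution of the semi-discrete ALE-DG method for the conservation law $\partial_t u+\nabla\cdot\boldsymbol f(u)=0$ in $\Omega\times(0,T)$, considered with periodic boundary conditions, with a numerical flux $\widehat g$ satisfying the properties (P1)–(P4) listed in the context. Then for every $t\in[0,T]$ $$\|u_h(t)\|_{L^2(\Omega)}\le\|u_h(0)\|_{L^2(\Omega)}.$$
   Context: **Moving mesh.** $\Omega\subseteq\mathbb R^d$ is an open convex polyhedron and $0=t_0<t_1<\dots<t_{\mathcal N}=T$. For each $n$, $\mathcal T_{(t_n)}$ is a regular (conforming) mesh of simplices exactly covering $\overline\Omega$; consecutive meshes have the same topology (same number of cells, with corresponding cells, vertices and neighbours, all cells positively oriented with respect to the reference simplex $K_{\rm ref}=\{\boldsymbol\xi\in\mathbb R^d:\xi_\nu\ge0,\ \sum_\nu\xi_\nu\le1\}$). If $\mathbf v_1^n,\dots,\mathbf v_{d+1}^n$ are the vertices of a cell at $t_n$ and $\mathbf v_\ell^{n+1}$ the corresponding ones at $t_{n+1}$, put for $t\in[t_n,t_{n+1}]$, with $\Delta t=t_{n+1}-t_n$, $$\mathbf v_\ell(t)=\mathbf v_\ell^n+\tfrac{t-t_n}{\Delta t}(\mathbf v_\ell^{n+1}-\mathbf v_\ell^n),\qquad K(t)=\operatorname{int}\operatorname{conv}\{\mathbf v_1(t),\dots,\mathbf v_{d+1}(t)\}.$$ $\mathcal T_{(t)}$ is the set of all cells $K(t)$. Let $\mathbf A_{K(t)}=(\mathbf v_2(t)-\mathbf v_1(t),\dots,\mathbf v_{d+1}(t)-\mathbf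 v_1(t))$, $J_{K(t)}=\det\mathbf A_{K(t)}$ and $\boldsymbol\chi_{K(t)}(\boldsymbol\xi,t)=\mathbf A_{K(t)}\boldsymbol\xi+\mathbf v_1(t)$, mapping $K_{\rm ref}$ onto $\overline{K(t)}$. Standing assumptions, with $h_{K(t)}$ the diameter of $K(t)$, $\rho_{K(t)}$ the radius of the largest ball contained in $K(t)$ and $h=\max_{t\in[0,T]}\max_{K(t)\in\mathcal T_{(t)}}h_{K(t)}$: (A1) $\overline\Omega=\bigcup_{K(t)\in\mathcal T_{(t)}}\overline{K(t)}$ for all $t\in[0,T]$; (A2) $J_{K(t)}>0$ for all $t$ and all cells; (A3) there are constants $\kappa,\tau>0$ independent of $h$ with $h_{K(t)}\le\kappa\rho_{K(t)}$ and $h\le\tau h_{K(t)}$ for all $t$ and all cells. The grid velocity is $\boldsymbol\omega(\mathbf x,t)=\frac{d}{dt}\boldsymbol\chi_{K(t)}(\boldsymbol\xi,t)$ at $\mathbf x=\boldsymbol\chi_{K(t)}(\boldsymbol\xi,t)$. **Flux.** $\boldsymbol f:\mathbb R\to\mathbb R^d$ is continuous, and $\boldsymbol g(\boldsymbol\omega,u)=\boldsymbol f(u)-\boldsymbol\omega u$. The scalar numerical flux $\widehat g(\boldsymbol\omega,u_1,u_2,\mathbf n)$ satisfies: (P1) $\widehat g(\boldsymbol\omega,u,u,\mathbf n)=\boldsymbol g(\boldsymbol\omega,u)\cdot\mathbf n$; (P2) $u\mapsto\widehat g(\boldsymbol\omega,u,\cdot,\mathbf n)$ is increasing and Lipschitz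 continuous; (P3) $u\mapsto\widehat g(\boldsymbol\omega,\cdot,u,\mathbf n)$ is decreasing and Lipschitz continuous; (P4) $\widehat g(\boldsymbol\omega,u_1,u_2,\mathbf n)=-\widehat g(\boldsymbol\omega,u_2,u_1,-\mathbf n)$. **Method.** $\mathcal V_h(t)=\{v\in L^2(\Omega): v\circ\boldsymbol\chi_{K(t)}\in P^k(K_{\rm ref})\ \forall K(t)\in\mathcal T_{(t)}\}$, where $P^k$ denotes polynomials of total degree at most $k$. On $\partial K(t)$ with unit outward normal $\mathbf n_{K(t)}$, $v^{\mathrm{int}}$ and $v^{\mathrm{ext}}$ are the traces of $v$ from inside and outside $K(t)$. A solution of the semi-discrete ALE-DG method is a function $u_h(\cdot,t)\in\mathcal V_h(t)$, $t\in[0,T]$, such that the coefficients of $u_h\circ\boldsymbol\chi_{K(t)}$ with respect to a fixed basis of $P^k(K_{\rm ref})$ are continuous on $[0,T]$ and differentiable on each $[t_n,t_{n+1}]$, and on each $[t_n,t_{n+1}]$, for every cell and every $v(\cdot,t)\in\mathcal V_h(t)$ for which $v\circ\boldsymbol\chi_{K(t)}$ is independent of $t$, $$\frac{d}{dt}\int_{K(t)}u_hv\,d\mathbf x=\int_{K(t)}\boldsymbol g(\boldsymbol\omega,u_h)\cdot\nabla v\,d\mathbf x-\int_{\partial K(t)}\widehat g(\boldsymbol\omega,u_h^{\mathrm{int}},u_h^{\mathrm{ext}},\mathbf n_{K(t)})\,v^{\mathrm{int}}\,d\boldsymbol\Gamma .$$ Periodic boundary conditions mean that boundary faces of the mesh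 are identified in pairs compatibly with the mesh and its motion, the exterior trace on a boundary face being the interior trace from the identified face, so that every face is an interior face and $\boldsymbol\omega$ is single-valued on it. *)

theory Defs
  imports "HOL-Analysis.Analysis"
begin

section \<open>Simplices\<close>

text \<open>
  A simplex in \<open>real ^ 'd\<close> is given by its vertices \<open>w :: 'd option \<Rightarrow> real ^ 'd\<close>:
  \<open>w None\<close> is the first vertex, and \<open>w (Some i)\<close> is the image of the \<open>i\<close>-th unit vector
  under the reference mapping.  The facet with index \<open>l\<close> is the one opposite to the vertex \<open>w l\<close>.
\<close>

definition K_ref :: "(real ^ 'd) set" where
  "K_ref = {\<xi>. (\<forall>i. 0 \<le> \<xi> $ i) \<and> (\<Sum>i\<in>UNIV. \<xi> $ i) \<le> 1}"

definition cell_of :: "('d option \<Rightarrow> real ^ 'd) \<Rightarrow> (real ^ 'd) set" where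
  "cell_of w = interior (convex hull (range w))"

definition edge_matrix :: "('d option \<Rightarrow> real ^ 'd) \<Rightarrow> real ^ 'd ^ 'd" where
  "edge_matrix w = (\<chi> r i. (w (Some i) - w None) $ r)"

definition ref_map :: "('d option \<Rightarrow> real ^ 'd) \<Rightarrow> real ^ 'd \<Rightarrow> real ^ 'd" where
  "ref_map w \<xi> = edge_matrix w *v \<xi> + w None"

definition facet :: "('d option \<Rightarrow> real ^ 'd) \<Rightarrow> 'd option \<Rightarrow> (real ^ 'd) set" where
  "facet w l = convex hull (w ` (- {l}))"

definition outward_normal :: "('d option \<Rightarrow> real ^ 'd) \<Rightarrow> 'd option \<Rightarrow> real ^ 'd" where
  "outward_normal w l = (THE \<nu>. norm \<nu> = 1 \<and>
     (\<forall>i j. i \<noteq> l \<longrightarrow> j \<noteq> l \<longrightarrow> \<nu> \<bullet> (w i - w j) = 0) \<and>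
     (\<forall>i. i \<noteq> l \<longrightarrow> \<nu> \<bullet> (w l - w i) < 0))"

text \<open>
  Surface measure on the hyperplane through \<open>p\<close> with unit normal \<open>\<nu>\<close>, i.e. its
  \<open>(d - 1)\<close>-dimensional Lebesgue measure: a Borel subset \<open>S\<close> of the hyperplane gets the
  \<open>d\<close>-dimensional volume of the right prism of height one over \<open>S\<close>.
  (In orthonormal coordinates adapted to \<open>\<nu>\<close>, the \<open>d\<close>-dimensional Lebesgue measure is the
  product of the measure on the hyperplane with the one on the line spanned by \<open>\<nu>\<close>.)
  For \<open>d = 1\<close> this is the point mass at \<open>p\<close>.
\<close>

definition hyperplane_measure :: "real ^ 'd \<Rightarrow> real ^ 'd \<Rightarrow> (real ^ 'd) measure" where
  "hyperplane_measure p \<nu> =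
     distr (restrict_space lborel {x. 0 \<le> \<nu> \<bullet> (x - p) \<and> \<nu> \<bullet> (x - p) \<le> 1}) borel
       (\<lambda>x. x - (\<nu> \<bullet> (x - p)) *\<^sub>R \<nu>)"

definition facet_center :: "('d option \<Rightarrow> real ^ 'd) \<Rightarrow> 'd option \<Rightarrow> real ^ 'd" where
  "facet_center w l = (1 / real CARD('d)) *\<^sub>R (\<Sum>i\<in>- {l}. w i)"

definition facet_measure :: "('d option \<Rightarrow> real ^ 'd) \<Rightarrow> 'd option \<Rightarrow> (real ^ 'd) measure" where
  "facet_measure w l = hyperplane_measure (facet_center w l) (outward_normal w l)"

definition inradius :: "(real ^ 'd) set \<Rightarrow> real" where
  "inradius K = Sup {r. 0 \<le> r \<and> (\<exists>x. ball x r \<subseteq> K)}"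


section \<open>Polynomials, traces, gradients, square integrable functions\<close>

definition multi_indices :: "nat \<Rightarrow> ('d::finite \<Rightarrow> nat) set" where
  "multi_indices k = {\<alpha>. (\<Sum>i\<in>UNIV. \<alpha> i) \<le> k}"

definition monomial_at :: "('d::finite \<Rightarrow> nat) \<Rightarrow> real ^ 'd \<Rightarrow> real" where
  "monomial_at \<alpha> \<xi> = (\<Prod>i\<in>UNIV. (\<xi> $ i) ^ \<alpha> i)"

definition poly_space :: "nat \<Rightarrow> (real ^ 'd \<Rightarrow> real) set" where
  "poly_space k = {p. \<exists>a. p = (\<lambda>\<xi>. \<Sum>\<alpha>\<in>multi_indices k. a \<alpha> * monomial_at \<alpha> \<xi>)}"

definition trace_from :: "(real ^ 'd) set \<Rightarrow> (real ^ 'd \<Rightarrow> real) \<Rightarrow> real ^ 'd \<Rightarrow> real" where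
  "trace_from K v x = Lim (at x within K) v"

definition grad :: "(real ^ 'd \<Rightarrow> real) \<Rightarrow> real ^ 'd \<Rightarrow> real ^ 'd" where
  "grad v x = (THE D. GDERIV v x :> D)"

definition L2_functions :: "(real ^ 'd) set \<Rightarrow> (real ^ 'd \<Rightarrow> real) set" where
  "L2_functions S = {v. set_borel_measurable lebesgue S v \<and>
     set_integrable lebesgue S (\<lambda>x. (v x)\<^sup>2)}"

definition L2_norm_on :: "(real ^ 'd) set \<Rightarrow> (real ^ 'd \<Rightarrow> real) \<Rightarrow> real" where
  "L2_norm_on S v = sqrt (LINT x:S|lebesgue. (v x)\<^sup>2)"


section \<open>Moving meshes\<close>

text \<open>
  The combinatorics of the mesh (cells \<open>'c\<close>, nodes \<open>'v\<close>, and the numbered nodes of every cell)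
  are fixed once and for all, so that all meshes have the same topology; only the positions
  \<open>node_at n a\<close> of the nodes \<open>a\<close> at the time levels \<open>n\<close> vary.
\<close>

record ('d::finite, 'c, 'v) mesh =
  num_steps :: nat
  time_level :: "nat \<Rightarrow> real"
  cells :: "'c set"
  cell_node :: "'c \<Rightarrow> 'd option \<Rightarrow> 'v"
  node_at :: "nat \<Rightarrow> 'v \<Rightarrow> real ^ 'd"

definition final_time :: "('d::finite, 'c, 'v) mesh \<Rightarrow> real" where
  "final_time M = time_level M (num_steps M)"

definition time_slab :: "('d::finite, 'c, 'v) mesh \<Rightarrow> nat \<Rightarrow> real set" where
  "time_slab M n = {time_level M n..time_level M (Suc n)}"

text \<open>
  In what follows, the pair of arguments \<open>n t\<close> refers to a time \<open>t\<close> in the closed slab number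
  \<open>n\<close>.  At a common end point of two slabs both choices of \<open>n\<close> give the same mesh, but in
  general not the same grid velocity.
\<close>

definition node_pos :: "('d::finite, 'c, 'v) mesh \<Rightarrow> nat \<Rightarrow> real \<Rightarrow> 'v \<Rightarrow> real ^ 'd" where
  "node_pos M n t a = node_at M n a +
     ((t - time_level M n) / (time_level M (Suc n) - time_level M n)) *\<^sub>R
       (node_at M (Suc n) a - node_at M n a)"

definition vertices :: "('d::finite, 'c, 'v) mesh \<Rightarrow> nat \<Rightarrow> real \<Rightarrow> 'c \<Rightarrow> 'd option \<Rightarrow> real ^ 'd" where
  "vertices M n t c l = node_pos M n t (cell_node M c l)"

definition level_vertices :: "('d::finite, 'c, 'v) mesh \<Rightarrow> nat \<Rightarrow> 'c \<Rightarrow> 'd option \<Rightarrow> real ^ 'd" where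
  "level_vertices M n c l = node_at M n (cell_node M c l)"

definition cell :: "('d::finite, 'c, 'v) mesh \<Rightarrow> nat \<Rightarrow> real \<Rightarrow> 'c \<Rightarrow> (real ^ 'd) set" where
  "cell M n t c = cell_of (vertices M n t c)"

definition cell_map :: "('d::finite, 'c, 'v) mesh \<Rightarrow> nat \<Rightarrow> real \<Rightarrow> 'c \<Rightarrow> real ^ 'd \<Rightarrow> real ^ 'd" where
  "cell_map M n t c = ref_map (vertices M n t c)"

definition jacobian :: "('d::finite, 'c, 'v) mesh \<Rightarrow> nat \<Rightarrow> real \<Rightarrow> 'c \<Rightarrow> real" where
  "jacobian M n t c = det (edge_matrix (vertices M n t c))"

definition grid_velocity ::
    "('d::finite, 'c, 'v) mesh \<Rightarrow> nat \<Rightarrow> real \<Rightarrow> 'c \<Rightarrow> real ^ 'd \<Rightarrow> real ^ 'd" where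
  "grid_velocity M n t c x =
     vector_derivative (\<lambda>s. cell_map M n s c (inv (cell_map M n t c) x)) (at t within time_slab M n)"

definition conforming_mesh_at ::
    "(real ^ 'd) set \<Rightarrow> ('d::finite, 'c, 'v) mesh \<Rightarrow> nat \<Rightarrow> bool" where
  "conforming_mesh_at \<Omega> M n \<longleftrightarrow>
     inj_on (node_at M n) (\<Union>c\<in>cells M. range (cell_node M c)) \<and>
     inj_on (\<lambda>c. convex hull (range (level_vertices M n c))) (cells M) \<and>
     triangulation ((\<lambda>c. convex hull (range (level_vertices M n c))) ` cells M) \<and>
     (\<Union>c\<in>cells M. convex hull (range (level_vertices M n c))) = closure \<Omega> \<and>
     (\<forall>c\<in>cells M. 0 < det (edge_matrix (level_vertices M n c)))"

definition moving_mesh :: "(real ^ 'd) set \<Rightarrow> ('d::finite, 'c, 'v) mesh \<Rightarrow> bool" where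
  "moving_mesh \<Omega> M \<longleftrightarrow>
     0 < num_steps M \<and> time_level M 0 = 0 \<and>
     (\<forall>n<num_steps M. time_level M n < time_level M (Suc n)) \<and>
     finite (cells M) \<and> (\<forall>c\<in>cells M. inj (cell_node M c)) \<and>
     (\<forall>n\<le>num_steps M. conforming_mesh_at \<Omega> M n) \<and>
     (\<forall>n<num_steps M. \<forall>t\<in>time_slab M n.
        closure \<Omega> = (\<Union>c\<in>cells M. closure (cell M n t c))) \<and>
     (\<forall>n<num_steps M. \<forall>t\<in>time_slab M n. \<forall>c\<in>cells M. 0 < jacobian M n t c)"

definition mesh_size :: "('d::finite, 'c, 'v) mesh \<Rightarrow> real" where
  "mesh_size M = Sup {diameter (cell M n t c) |n t c.
     n < num_steps M \<and> t \<in> time_slab M n \<and> c \<in> cells M}"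

definition shape_regular :: "real \<Rightarrow> real \<Rightarrow> ('d::finite, 'c, 'v) mesh \<Rightarrow> bool" where
  "shape_regular \<kappa> \<tau> M \<longleftrightarrow> 0 < \<kappa> \<and> 0 < \<tau> \<and>
     (\<forall>n<num_steps M. \<forall>t\<in>time_slab M n. \<forall>c\<in>cells M.
        diameter (cell M n t c) \<le> \<kappa> * inradius (cell M n t c) \<and>
        mesh_size M \<le> \<tau> * diameter (cell M n t c))"


section \<open>Faces and periodic boundary conditions\<close>

text \<open>
  The pair \<open>(c, l)\<close> denotes the facet of the cell \<open>c\<close> opposite to its vertex number \<open>l\<close>, seen
  from \<open>c\<close>.  A geometric interior face thus occurs twice, once for each adjacent cell, and a
  boundary face occurs once.
\<close>

definition faces :: "('d::finite, 'c, 'v) mesh \<Rightarrow> ('c \<times> 'd option) set" where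
  "faces M = cells M \<times> UNIV"

definition face_nodes :: "('d::finite, 'c, 'v) mesh \<Rightarrow> 'c \<times> 'd option \<Rightarrow> 'v set" where
  "face_nodes M F = cell_node M (fst F) ` (- {snd F})"

definition boundary_faces :: "('d::finite, 'c, 'v) mesh \<Rightarrow> ('c \<times> 'd option) set" where
  "boundary_faces M = {F \<in> faces M. \<forall>G\<in>faces M. face_nodes M G = face_nodes M F \<longrightarrow> G = F}"

text \<open>
  The boundary faces are identified in pairs \<open>F, partner F\<close>.  The identification is a
  translation by the vector \<open>shift F\<close>, it matches nodes with nodes in a way which is independent
  of time (so that matching nodes move with the same velocity), and the cells at \<open>F\<close> and
  \<open>partner F\<close> end up on opposite sides of the identified face.
\<close>

definition periodic_identification ::
    "('d::finite, 'c, 'v) mesh \<Rightarrow> ('c \<times> 'd option \<Rightarrow> 'c \<times> 'd option) \<Rightarrow>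
     ('c \<times> 'd option \<Rightarrow> real ^ 'd) \<Rightarrow> bool" where
  "periodic_identification M partner shift \<longleftrightarrow>
     (\<forall>F\<in>boundary_faces M.
        partner F \<in> boundary_faces M \<and> partner (partner F) = F \<and>
        (\<exists>\<sigma>. bij_betw \<sigma> (face_nodes M F) (face_nodes M (partner F)) \<and>
           (\<forall>n\<le>num_steps M. \<forall>a\<in>face_nodes M F. node_at M n (\<sigma> a) = node_at M n a + shift F)) \<and>
        (\<forall>n\<le>num_steps M.
           outward_normal (level_vertices M n (fst (partner F))) (snd (partner F)) =
           - outward_normal (level_vertices M n (fst F)) (snd F)))"

definition neighbour ::
    "('d::finite, 'c, 'v) mesh \<Rightarrow> ('c \<times> 'd option \<Rightarrow> 'c \<times> 'd option) \<Rightarrow> 'c \<times> 'd option \<Rightarrow> 'c" where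
  "neighbour M partner F =
     fst (if F \<in> boundary_faces M then partner F
          else (THE G. G \<in> faces M \<and> G \<noteq> F \<and> face_nodes M G = face_nodes M F))"

definition interior_trace ::
    "('d::finite, 'c, 'v) mesh \<Rightarrow> nat \<Rightarrow> real \<Rightarrow> 'c \<Rightarrow> (real ^ 'd \<Rightarrow> real) \<Rightarrow> real ^ 'd \<Rightarrow> real" where
  "interior_trace M n t c v x = trace_from (cell M n t c) v x"

definition exterior_trace ::
    "('d::finite, 'c, 'v) mesh \<Rightarrow> ('c \<times> 'd option \<Rightarrow> 'c \<times> 'd option) \<Rightarrow> ('c \<times> 'd option \<Rightarrow> real ^ 'd) \<Rightarrow>
     nat \<Rightarrow> real \<Rightarrow> 'c \<times> 'd option \<Rightarrow> (real ^ 'd \<Rightarrow> real) \<Rightarrow> real ^ 'd \<Rightarrow> real" where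
  "exterior_trace M partner shift n t F v x =
     interior_trace M n t (neighbour M partner F) v
       (if F \<in> boundary_faces M then x + shift F else x)"


section \<open>Fluxes\<close>

definition ale_flux :: "(real \<Rightarrow> real ^ 'd) \<Rightarrow> real ^ 'd \<Rightarrow> real \<Rightarrow> real ^ 'd" where
  "ale_flux f \<omega> u = f u - u *\<^sub>R \<omega>"

text \<open>
  Only unit vectors \<open>\<nu>\<close> occur as normals.  ``Increasing'' and ``decreasing''
  are meant in the weak sense, and the Lipschitz constants may depend on the frozen arguments.
\<close>

definition numerical_flux ::
    "(real \<Rightarrow> real ^ 'd) \<Rightarrow> (real ^ 'd \<Rightarrow> real \<Rightarrow> real \<Rightarrow> real ^ 'd \<Rightarrow> real) \<Rightarrow> bool" where
  "numerical_flux f ghat \<longleftrightarrow>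
     (\<forall>\<omega> \<nu>. norm \<nu> = 1 \<longrightarrow>
        (\<forall>u. ghat \<omega> u u \<nu> = ale_flux f \<omega> u \<bullet> \<nu>) \<and>
        (\<forall>u2. mono (\<lambda>u. ghat \<omega> u u2 \<nu>) \<and> (\<exists>L. L-lipschitz_on UNIV (\<lambda>u. ghat \<omega> u u2 \<nu>))) \<and>
        (\<forall>u1. antimono (\<lambda>u. ghat \<omega> u1 u \<nu>) \<and> (\<exists>L. L-lipschitz_on UNIV (\<lambda>u. ghat \<omega> u1 u \<nu>))) \<and>
        (\<forall>u1 u2. ghat \<omega> u1 u2 \<nu> = - ghat \<omega> u2 u1 (- \<nu>)))"


section \<open>The semi-discrete ALE-DG method\<close>

text \<open>
  Elements of the discontinuous space are represented by functions which agree with a polynomial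
  everywhere on each open cell; their values on the null set of cell boundaries are irrelevant.
\<close>

definition dg_space ::
    "(real ^ 'd) set \<Rightarrow> ('d::finite, 'c, 'v) mesh \<Rightarrow> nat \<Rightarrow> nat \<Rightarrow> real \<Rightarrow> (real ^ 'd \<Rightarrow> real) set" where
  "dg_space \<Omega> M k n t = {v \<in> L2_functions \<Omega>.
     \<forall>c\<in>cells M. \<exists>p\<in>poly_space k. \<forall>\<xi>\<in>interior K_ref. v (cell_map M n t c \<xi>) = p \<xi>}"

definition test_function ::
    "(real ^ 'd) set \<Rightarrow> ('d::finite, 'c, 'v) mesh \<Rightarrow> nat \<Rightarrow> nat \<Rightarrow> (real \<Rightarrow> real ^ 'd \<Rightarrow> real) \<Rightarrow> bool" where
  "test_function \<Omega> M k n v \<longleftrightarrow>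
     (\<forall>t\<in>time_slab M n. v t \<in> dg_space \<Omega> M k n t) \<and>
     (\<forall>c\<in>cells M. \<forall>\<xi>\<in>interior K_ref. \<forall>s\<in>time_slab M n. \<forall>t\<in>time_slab M n.
        v s (cell_map M n s c \<xi>) = v t (cell_map M n t c \<xi>))"

definition regular_coefficients ::
    "('d::finite, 'c, 'v) mesh \<Rightarrow> nat \<Rightarrow> (real \<Rightarrow> real ^ 'd \<Rightarrow> real) \<Rightarrow> bool" where
  "regular_coefficients M k u \<longleftrightarrow>
     (\<forall>c\<in>cells M. \<exists>a.
        (\<forall>\<alpha>\<in>multi_indices k.
           continuous_on {0..final_time M} (a \<alpha>) \<and>
           (\<forall>n<num_steps M. a \<alpha> differentiable_on time_slab M n)) \<and>
        (\<forall>n<num_steps M. \<forall>t\<in>time_slab M n. \<forall>\<xi>\<in>interior K_ref.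
           u t (cell_map M n t c \<xi>) = (\<Sum>\<alpha>\<in>multi_indices k. a \<alpha> t * monomial_at \<alpha> \<xi>)))"

definition face_integrand ::
    "('d::finite, 'c, 'v) mesh \<Rightarrow> ('c \<times> 'd option \<Rightarrow> 'c \<times> 'd option) \<Rightarrow>
     ('c \<times> 'd option \<Rightarrow> real ^ 'd) \<Rightarrow> (real ^ 'd \<Rightarrow> real \<Rightarrow> real \<Rightarrow> real ^ 'd \<Rightarrow> real) \<Rightarrow>
     nat \<Rightarrow> real \<Rightarrow> 'c \<times> 'd option \<Rightarrow> (real ^ 'd \<Rightarrow> real) \<Rightarrow> (real ^ 'd \<Rightarrow> real) \<Rightarrow> real ^ 'd \<Rightarrow> real" where
  "face_integrand M partner shift ghat n t F u v x =
     ghat (grid_velocity M n t (fst F) x)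
          (interior_trace M n t (fst F) u x)
          (exterior_trace M partner shift n t F u x)
          (outward_normal (vertices M n t (fst F)) (snd F))
     * interior_trace M n t (fst F) v x"

definition volume_term ::
    "('d::finite, 'c, 'v) mesh \<Rightarrow> (real \<Rightarrow> real ^ 'd) \<Rightarrow> nat \<Rightarrow> real \<Rightarrow> 'c \<Rightarrow>
     (real ^ 'd \<Rightarrow> real) \<Rightarrow> (real ^ 'd \<Rightarrow> real) \<Rightarrow> real" where
  "volume_term M f n t c u v =
     (LINT x:cell M n t c|lebesgue. ale_flux f (grid_velocity M n t c x) (u x) \<bullet> grad v x)"

definition boundary_term ::
    "('d::finite, 'c, 'v) mesh \<Rightarrow> ('c \<times> 'd option \<Rightarrow> 'c \<times> 'd option) \<Rightarrow>
     ('c \<times> 'd option \<Rightarrow> real ^ 'd) \<Rightarrow> (real ^ 'd \<Rightarrow> real \<Rightarrow> real \<Rightarrow> real ^ 'd \<Rightarrow> real) \<Rightarrow>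
     nat \<Rightarrow> real \<Rightarrow> 'c \<Rightarrow> (real ^ 'd \<Rightarrow> real) \<Rightarrow> (real ^ 'd \<Rightarrow> real) \<Rightarrow> real" where
  "boundary_term M partner shift ghat n t c u v =
     (\<Sum>l\<in>UNIV. LINT x:facet (vertices M n t c) l|facet_measure (vertices M n t c) l.
        face_integrand M partner shift ghat n t (c, l) u v x)"

text \<open>
  No measurability in \<open>\<omega>\<close> is among the properties of the numerical flux, so the existence of the
  face integrals has to be stated as a part of the weak formulation (otherwise their value would be
  \<open>0\<close> by the convention of the library).  The volume integrals always exist.
\<close>

definition ale_dg_solution ::
    "(real ^ 'd) set \<Rightarrow> ('d::finite, 'c, 'v) mesh \<Rightarrow> ('c \<times> 'd option \<Rightarrow> 'c \<times> 'd option) \<Rightarrow>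
     ('c \<times> 'd option \<Rightarrow> real ^ 'd) \<Rightarrow> nat \<Rightarrow> (real \<Rightarrow> real ^ 'd) \<Rightarrow>
     (real ^ 'd \<Rightarrow> real \<Rightarrow> real \<Rightarrow> real ^ 'd \<Rightarrow> real) \<Rightarrow> (real \<Rightarrow> real ^ 'd \<Rightarrow> real) \<Rightarrow> bool" where
  "ale_dg_solution \<Omega> M partner shift k f ghat u \<longleftrightarrow>
     (\<forall>n<num_steps M. \<forall>t\<in>time_slab M n. u t \<in> dg_space \<Omega> M k n t) \<and>
     regular_coefficients M k u \<and>
     (\<forall>n<num_steps M. \<forall>c\<in>cells M. \<forall>v. test_function \<Omega> M k n v \<longrightarrow>
        (\<forall>t\<in>time_slab M n.
           (\<forall>l. set_integrable (facet_measure (vertices M n t c) l) (facet (vertices M n t c) l)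
                  (face_integrand M partner shift ghat n t (c, l) (u t) (v t))) \<and>
           ((\<lambda>s. LINT x:cell M n s c|lebesgue. u s x * v s x) has_real_derivative
              volume_term M f n t c (u t) (v t) -
              boundary_term M partner shift ghat n t c (u t) (v t))
             (at t within time_slab M n)))"

end

theory Submission
  imports Defs
begin

text \<open>
  On one cell, testing with the solution frozen along the mesh motion yields
  \<open>d/dt \<integral> u\<^sup>2 = 2 D - \<integral> u\<^sup>2 div \<omega>\<close>, where \<open>D\<close> is the right hand side of the method, because the Jacobian
  satisfies \<open>J' = J div \<omega>\<close>.  If \<open>F' = f\<close>, the divergence theorem turns the half of this into a sum over
  the facets of the integrals of \<open>(F(u) - u\<^sup>2 \<omega> / 2) \<bullet> n - ghat u\<close>, and the two contributions to
  a face with traces \<open>a\<close> and \<open>b\<close> add up to the integral from \<open>b\<close> to \<open>a\<close> of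
  \<open>ghat(\<omega>, y, y, n) - ghat(\<omega>, a, b, n)\<close>, which is nonpositive by monotonicity of the flux.

  The frozen solution is a legitimate test function only if the cells are disjoint at all times,
  and this is not assumed between the time levels.  There, however, the same pairing of the faces
  shows that the sum of the volumes of the cells is constant; as they cover the domain, they cannot
  overlap.  The neighbour across a face stays on the opposite side because its barycentric
  coordinate is continuous in time and never vanishes.

  It suffices to prove the divergence theorem in the direction of an edge joining the vertices \<open>l\<close>
  and \<open>m\<close>: this edge is parallel to all other facets, and Fubini's theorem along it, in a form
  adapted to the definition of the surface measure by slabs, leaves only the facets \<open>l\<close> and \<open>m\<close>.
\<close>

section \<open>Integration over slabs and hyperplanes\<close>

text \<open>Two obstacles shape the argument. The weak form differentiates the product of the
  solution with a test function of constant coefficients, so the energy identity is extracted by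
  comparing the quadratic form in the coefficients with the bilinear form having one argument
  frozen; symmetry of the reference mass matrix gives the factor 2. And disjointness of the cells at
  intermediate times cannot enter the pairing of the faces, being itself a consequence of it.
  Opposite sides are therefore read off from the triangulations and normals at the time levels and
  carried into each slab as a sign. The term with div \<omega> is exactly what makes the volume
  integral a divergence: div (F(u) - u^2 \<omega> / 2) = (f(u) - u \<omega>) . grad u - (u^2 / 2)
  div \<omega>. For constant u the same identity is the volume balance, so one divergence theorem
  serves both purposes. Each slab is treated separately, since the grid velocity may jump at the
  time levels while the mesh does not. The norm on the domain and the sum of the cell energies are
  compared by two inequalities, one at time t and the reverse one at time 0.\<close>

lemma nn_integral_lborel_shift:
  fixes f :: "'a::euclidean_space \<Rightarrow> ennreal"
  assumes [measurable]: "f \<in> borel_measurable borel"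
  shows "(\<integral>\<^sup>+x. f (x + a) \<partial>lborel) = (\<integral>\<^sup>+x. f x \<partial>lborel)"
proof -
  have "(\<integral>\<^sup>+x. f x \<partial>lborel) = (\<integral>\<^sup>+x. f x \<partial>(distr lborel borel ((+) a)))"
    by (simp add: lborel_distr_plus)
  also have "\<dots> = (\<integral>\<^sup>+x. f (a + x) \<partial>lborel)"
    by (subst nn_integral_distr) auto
  finally show ?thesis by (simp add: add.commute)
qed

text \<open>A weight of total mass one on a line: the points \<open>s\<close> with
  \<open>a + b * s\<close> in the unit interval form an interval of length
  \<open>1 / \<bar>b\<bar>\<close>.\<close>

lemma nn_integral_indicator_affine:
  fixes a b :: real
  assumes "b \<noteq> 0"
  shows "ennreal \<bar>b\<bar> * (\<integral>\<^sup>+s. indicator {0..1} (a + b * s) \<partial>lborel) = 1"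
  using nn_integral_real_affine[of "indicator {0..1::real}" b a] assms by simp

text \<open>Fubini along \<open>e\<close> without a choice of coordinates: the weight of the
  preceding lemma is inserted with slope \<open>- (c \<bullet> e)\<close>, the integrals are
  exchanged, and translating \<open>x\<close> by \<open>s *\<^sub>R e\<close> turns the moving slab
  into a fixed one.\<close>

lemma nn_integral_lborel_slab:
  fixes h :: "'a::euclidean_space \<Rightarrow> ennreal"
  assumes [measurable]: "h \<in> borel_measurable borel" and ce: "c \<bullet> e \<noteq> 0"
  shows "(\<integral>\<^sup>+x. h x \<partial>lborel) =
    ennreal \<bar>c \<bullet> e\<bar> * (\<integral>\<^sup>+x. indicator {0..1} (c \<bullet> (x - p)) * (\<integral>\<^sup>+s. h (x + s *\<^sub>R e) \<partial>lborel) \<partial>lborel)"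
proof -
  have "(\<integral>\<^sup>+x. h x \<partial>lborel) =
    (\<integral>\<^sup>+x. (ennreal \<bar>c \<bullet> e\<bar> * (\<integral>\<^sup>+s. indicator {0..1} (c \<bullet> (x - p) + (- (c \<bullet> e)) * s) \<partial>lborel)) * h x \<partial>lborel)"
    using nn_integral_indicator_affine[of "- (c \<bullet> e)"] ce by simp
  also have "\<dots> = ennreal \<bar>c \<bullet> e\<bar> *
      (\<integral>\<^sup>+x. (\<integral>\<^sup>+s. indicator {0..1} (c \<bullet> (x - p) + (- (c \<bullet> e)) * s) * h x \<partial>lborel) \<partial>lborel)"
    by (subst nn_integral_cmult[symmetric]) (auto simp: nn_integral_multc mult.assoc)
  also have "(\<integral>\<^sup>+x. (\<integral>\<^sup>+s. indicator {0..1} (c \<bullet> (x - p) + (- (c \<bullet> e)) * s) * h x \<partial>lborel) \<partial>lborel) =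
      (\<integral>\<^sup>+s. (\<integral>\<^sup>+x. indicator {0..1} (c \<bullet> (x - p) + (- (c \<bullet> e)) * s) * h x \<partial>lborel) \<partial>lborel)"
    by (rule lborel_pair.Fubini'[symmetric]) simp
  also have "\<dots> = (\<integral>\<^sup>+s. (\<integral>\<^sup>+x. indicator {0..1} (c \<bullet> (x - p)) * h (x + s *\<^sub>R e) \<partial>lborel) \<partial>lborel)"
  proof (rule nn_integral_cong)
    fix s :: real
    show "(\<integral>\<^sup>+x. indicator {0..1} (c \<bullet> (x - p) + (- (c \<bullet> e)) * s) * h x \<partial>lborel) =
       (\<integral>\<^sup>+x. indicator {0..1} (c \<bullet> (x - p)) * h (x + s *\<^sub>R e) \<partial>lborel)"
      by (subst nn_integral_lborel_shift[of _ "s *\<^sub>R e", symmetric])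
        (auto simp: inner_simps algebra_simps)
  qed
  also have "\<dots> = (\<integral>\<^sup>+x. (\<integral>\<^sup>+s. indicator {0..1} (c \<bullet> (x - p)) * h (x + s *\<^sub>R e) \<partial>lborel) \<partial>lborel)"
    by (rule lborel_pair.Fubini') simp
  finally show ?thesis by (simp add: nn_integral_cmult)
qed

text \<open>On every line in direction \<open>e\<close> the map is affine in the line parameter with
  slope \<open>1 + b \<bullet> e\<close>, which is also its determinant. The slab formula, applied
  on both sides, reduces the claim to this one-dimensional substitution.\<close>

lemma nn_integral_rank_one_update:
  fixes h :: "'a::euclidean_space \<Rightarrow> ennreal"
  assumes [measurable]: "h \<in> borel_measurable borel" and be: "1 + b \<bullet> e \<noteq> 0"
  shows "(\<integral>\<^sup>+x. h x \<partial>lborel) = ennreal \<bar>1 + b \<bullet> e\<bar> * (\<integral>\<^sup>+x. h (x + (b \<bullet> (x - p)) *\<^sub>R e) \<partial>lborel)"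
proof (cases "e = 0")
  case False
  \<comment> \<open>Dual to \<open>e\<close>, so that the factor in the slab formula is 1.\<close>
  define c where "c = (1 / (e \<bullet> e)) *\<^sub>R e"
  have c: "c \<bullet> e = 1" using False by (simp add: c_def)
  have *: "(\<integral>\<^sup>+s. h (x + s *\<^sub>R e) \<partial>lborel) = ennreal \<bar>1 + b \<bullet> e\<bar> *
     (\<integral>\<^sup>+s. h (x + s *\<^sub>R e + (b \<bullet> (x + s *\<^sub>R e - p)) *\<^sub>R e) \<partial>lborel)" for x
    by (subst nn_integral_real_affine[OF _ be, of _ "b \<bullet> (x - p)"])
      (auto simp: inner_simps algebra_simps)
  let ?g = "\<lambda>x. h (x + (b \<bullet> (x - p)) *\<^sub>R e)"
  have "(\<integral>\<^sup>+x. h x \<partial>lborel) =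
      (\<integral>\<^sup>+x. indicator {0..1} (c \<bullet> (x - p)) * (\<integral>\<^sup>+s. h (x + s *\<^sub>R e) \<partial>lborel) \<partial>lborel)"
    using nn_integral_lborel_slab[of h c e p] c by simp
  also have "\<dots> = (\<integral>\<^sup>+x. ennreal \<bar>1 + b \<bullet> e\<bar> *
      (indicator {0..1} (c \<bullet> (x - p)) * (\<integral>\<^sup>+s. ?g (x + s *\<^sub>R e) \<partial>lborel)) \<partial>lborel)"
    by (rule nn_integral_cong) (subst *, simp only: ac_simps)
  also have "\<dots> = ennreal \<bar>1 + b \<bullet> e\<bar> *
      (\<integral>\<^sup>+x. indicator {0..1} (c \<bullet> (x - p)) * (\<integral>\<^sup>+s. ?g (x + s *\<^sub>R e) \<partial>lborel) \<partial>lborel)"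
    by (rule nn_integral_cmult) measurable
  also have "(\<integral>\<^sup>+x. indicator {0..1} (c \<bullet> (x - p)) * (\<integral>\<^sup>+s. ?g (x + s *\<^sub>R e) \<partial>lborel) \<partial>lborel) =
      (\<integral>\<^sup>+x. ?g x \<partial>lborel)"
    using nn_integral_lborel_slab[of ?g c e p] c by simp
  finally show ?thesis .
qed simp

text \<open>The change of variables of the library needs a well-ordered index type.\<close>

lemma nn_integral_linear:
  fixes L :: "real ^ 'n \<Rightarrow> real ^ 'n" and h :: "real ^ 'n \<Rightarrow> ennreal"
  assumes "linear L" and "det (matrix L) \<noteq> 0" and "h \<in> borel_measurable borel"
  shows "(\<integral>\<^sup>+x. h x \<partial>lborel) = ennreal \<bar>det (matrix L)\<bar> * (\<integral>\<^sup>+x. h (L x) \<partial>lborel)"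
proof -
  define P where "P L \<longleftrightarrow> (linear L \<longrightarrow> det (matrix L) \<noteq> 0 \<longrightarrow> (\<forall>h\<in>borel_measurable borel.
     (\<integral>\<^sup>+x. h x \<partial>lborel) = ennreal \<bar>det (matrix L)\<bar> * (\<integral>\<^sup>+x. h (L x) \<partial>lborel)))"
    for L :: "real ^ 'n \<Rightarrow> real ^ 'n"
  have "P L"
  proof (rule induct_linear_elementary[OF \<open>linear L\<close>])
    fix f g :: "real ^ 'n \<Rightarrow> real ^ 'n"
    assume lin: "linear f" "linear g" and P: "P f" "P g"
    show "P (f \<circ> g)"
      unfolding P_def
    proof (intro impI ballI)
      fix h :: "real ^ 'n \<Rightarrow> ennreal"
      assume nz: "det (matrix (f \<circ> g)) \<noteq> 0" and h[measurable]: "h \<in> borel_measurable borel"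
      have [measurable]: "f \<in> borel_measurable borel"
        using lin by (intro borel_measurable_continuous_onI linear_continuous_on)
          (simp add: linear_conv_bounded_linear)
      have d: "det (matrix (f \<circ> g)) = det (matrix f) * det (matrix g)"
        using lin by (simp add: matrix_compose det_mul)
      have 1: "(\<integral>\<^sup>+x. h x \<partial>lborel) = ennreal \<bar>det (matrix f)\<bar> * (\<integral>\<^sup>+x. h (f x) \<partial>lborel)"
        by (rule P(1)[unfolded P_def, rule_format]) (use nz d lin in auto)
      have 2: "(\<integral>\<^sup>+x. h (f x) \<partial>lborel) = ennreal \<bar>det (matrix g)\<bar> * (\<integral>\<^sup>+x. h (f (g x)) \<partial>lborel)"
        by (rule P(2)[unfolded P_def, rule_format]) (use nz d lin in auto)
      show "(\<integral>\<^sup>+x. h x \<partial>lborel) = ennreal \<bar>det (matrix (f \<circ> g))\<bar> * (\<integral>\<^sup>+x. h ((f \<circ> g) x) \<partial>lborel)"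
        by (simp add: 1 2 d abs_mult ennreal_mult mult.assoc)
    qed
  next
    fix f :: "real ^ 'n \<Rightarrow> real ^ 'n" and i
    assume f: "linear f" "\<And>x. f x $ i = 0"
    \<comment> \<open>A map with a vanishing coordinate has determinant zero, which makes
      \<open>P f\<close> vacuous.\<close>
    have "\<not> inj f"
      using f by (metis (full_types) linear_injective_imp_surjective one_neq_zero surjE vec_component)
    then show "P f"
      using det_nz_iff_inj[OF f(1)] by (auto simp: P_def)
  next
    fix c :: "'n \<Rightarrow> real"
    let ?f = "\<lambda>x::real ^ 'n. \<chi> i. c i * x $ i"
    have m: "det (matrix ?f) = (\<Prod>i\<in>UNIV. c i)"
      by (simp add: axis_def matrix_def det_diagonal)
    show "P ?f"
      unfolding P_def
    proof (intro impI ballI)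
      fix h :: "real ^ 'n \<Rightarrow> ennreal"
      assume nz: "det (matrix ?f) \<noteq> 0" and [measurable]: "h \<in> borel_measurable borel"
      \<comment> \<open>Diagonal scalings are given by factors indexed by basis vectors; the
        description recovers the coordinate from its unit vector.\<close>
      define d where "d j = c (THE i. j = axis i 1)" for j :: "real ^ 'n"
      have da: "d (axis i 1) = c i" for i
        unfolding d_def by (rule arg_cong[of _ _ c], rule the_equality) (auto simp: axis_eq_axis)
      have B: "(Basis :: (real ^ 'n) set) = (\<lambda>i. axis i 1) ` UNIV"
        by (auto simp: Basis_vec_def)
      have inj: "inj (\<lambda>i::'n. axis i (1::real))"
        by (auto simp: inj_on_def axis_eq_axis)
      have T: "0 + (\<Sum>j\<in>Basis. (d j * (x \<bullet> j)) *\<^sub>R j) = ?f x" for x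
      proof -
        have "0 + (\<Sum>j\<in>Basis. (d j * (x \<bullet> j)) *\<^sub>R j) = (\<Sum>i\<in>UNIV. (c i * x $ i) *\<^sub>R axis i 1)"
          by (simp add: B sum.reindex[OF inj] da inner_axis)
        also have "\<dots> = ?f x"
          by (simp add: vec_eq_iff axis_def if_distrib cong: if_cong)
        finally show ?thesis .
      qed
      have "(\<Prod>j\<in>Basis. \<bar>d j\<bar>) = \<bar>det (matrix ?f)\<bar>"
        by (simp add: B prod.reindex[OF inj] da m abs_prod)
      moreover have "d j \<noteq> 0" if "j \<in> Basis" for j
        using that nz m by (auto simp: B da)
      ultimately have lb: "lborel = density (distr lborel borel ?f) (\<lambda>_. ennreal \<bar>det (matrix ?f)\<bar>)"
        using lborel_affine_euclidean[of d 0] unfolding T by simp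
      have [measurable]: "?f \<in> borel_measurable borel"
        by (intro borel_measurable_continuous_onI continuous_intros)
      show "(\<integral>\<^sup>+x. h x \<partial>lborel) = ennreal \<bar>det (matrix ?f)\<bar> * (\<integral>\<^sup>+x. h (?f x) \<partial>lborel)"
        by (subst lb) (simp add: nn_integral_density nn_integral_distr nn_integral_cmult)
    qed
  next
    fix m n :: 'n assume mn: "m \<noteq> n"
    let ?f = "\<lambda>x::real ^ 'n. \<chi> i. x $ Transposition.transpose m n i"
    have "(\<chi> i j. if Transposition.transpose m n i = j then 1 else 0) = (\<chi> i j. if j = Transposition.transpose m n i then 1 else (0::real))"
      by (auto intro!: Cart_lambda_cong)
    then have "matrix ?f = transpose(\<chi> i j. mat 1 $ i $ Transposition.transpose m n j)"
      by (auto simp: matrix_eq transpose_def axis_def mat_def matrix_def)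
    then have 1: "\<bar>det (matrix ?f)\<bar> = 1"
      by (simp add: det_permute_columns permutes_swap_id sign_swap_id abs_mult)
    let ?e = "axis m 1 - axis n (1::real)"
    \<comment> \<open>A transposition of coordinates is the reflection in the hyperplane orthogonal
      to \<open>?e\<close>, hence a rank one update; its slope along \<open>?e\<close> is
      -1.\<close>
    have f: "?f x = x + ((- ?e) \<bullet> (x - 0)) *\<^sub>R ?e" for x
    proof -
      have "(- ?e) \<bullet> (x - 0) = x $ n - x $ m"
        by (simp add: inner_diff_left inner_axis')
      then show ?thesis
        using mn by (auto simp: vec_eq_iff axis_def Transposition.transpose_def)
    qed
    have e: "1 + (- ?e) \<bullet> ?e = -1"
      using mn by (simp add: inner_simps inner_axis_axis)
    have "(\<integral>\<^sup>+x. h x \<partial>lborel) = ennreal \<bar>det (matrix ?f)\<bar> * (\<integral>\<^sup>+x. h (?f x) \<partial>lborel)"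
      if "h \<in> borel_measurable borel" for h
      unfolding 1 unfolding f using nn_integral_rank_one_update[OF that, of "- ?e" ?e 0] unfolding e by simp
    then show "P ?f"
      unfolding P_def by blast
  next
    fix m n :: 'n assume mn: "m \<noteq> n"
    let ?f = "\<lambda>x::real ^ 'n. \<chi> i. if i = m then x $ m + x $ n else x $ i"
    have "matrix ?f = (\<chi> k. if k = m then row m (mat 1) + 1 *s row n (mat 1) else row k (mat 1))"
      using mn by (auto simp: matrix_def row_def mat_def axis_def vec_eq_iff)
    then have 1: "det (matrix ?f) = 1"
      using det_row_operation[OF mn, of "mat 1" "1::real"] by simp
    have f: "?f x = x + (axis n 1 \<bullet> (x - 0)) *\<^sub>R axis m 1" for x
    proof -
      have "axis n 1 \<bullet> (x - 0) = x $ n"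
        by (simp add: inner_axis')
      then show ?thesis
        using mn by (auto simp: vec_eq_iff axis_def)
    qed
    have e: "1 + axis n 1 \<bullet> axis m (1::real) = 1"
      using mn by (simp add: inner_axis_axis)
    have "(\<integral>\<^sup>+x. h x \<partial>lborel) = ennreal \<bar>det (matrix ?f)\<bar> * (\<integral>\<^sup>+x. h (?f x) \<partial>lborel)"
      if "h \<in> borel_measurable borel" for h
      unfolding 1 unfolding f using nn_integral_rank_one_update[OF that, of "axis n 1" "axis m 1" 0] unfolding e by simp
    then show "P ?f"
      unfolding P_def by blast
  qed
  then show ?thesis using assms unfolding P_def by blast
qed

text \<open>Testing with indicators turns the substitution rule into an equality of measures, from
  which it passes to integrals of signed functions.\<close>

lemma lborel_linear:
  fixes L :: "real ^ 'n \<Rightarrow> real ^ 'n"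
  assumes "linear L" and "det (matrix L) \<noteq> 0"
  shows "lborel = density (distr lborel borel L) (\<lambda>_. ennreal \<bar>det (matrix L)\<bar>)"
proof (rule measure_eqI)
  fix A :: "(real ^ 'n) set" assume "A \<in> sets lborel"
  then have [measurable]: "A \<in> sets borel" by simp
  have [measurable]: "L \<in> borel_measurable borel"
    using assms by (intro borel_measurable_continuous_onI linear_continuous_on)
      (simp add: linear_conv_bounded_linear)
  have "emeasure lborel A = (\<integral>\<^sup>+x. indicator A x \<partial>lborel)" by simp
  also have "\<dots> = ennreal \<bar>det (matrix L)\<bar> * (\<integral>\<^sup>+x. indicator A (L x) \<partial>lborel)"
    by (rule nn_integral_linear) (use assms in auto)
  also have "\<dots> = emeasure (density (distr lborel borel L) (\<lambda>_. ennreal \<bar>det (matrix L)\<bar>)) A"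
    by (simp add: emeasure_density nn_integral_cmult nn_integral_distr del: nn_integral_indicator)
  finally show "emeasure lborel A = emeasure (density (distr lborel borel L) (\<lambda>_. ennreal \<bar>det (matrix L)\<bar>)) A" .
qed simp

lemma lborel_integral_linear:
  fixes L :: "real ^ 'n \<Rightarrow> real ^ 'n" and h :: "real ^ 'n \<Rightarrow> real"
  assumes "linear L" and "det (matrix L) \<noteq> 0" and [measurable]: "h \<in> borel_measurable borel"
  shows "(\<integral>x. h x \<partial>lborel) = \<bar>det (matrix L)\<bar> * (\<integral>x. h (L x) \<partial>lborel)"
proof -
  have [measurable]: "L \<in> borel_measurable borel"
    using assms by (intro borel_measurable_continuous_onI linear_continuous_on)
      (simp add: linear_conv_bounded_linear)
  show ?thesis
    by (subst lborel_linear[OF assms(1,2)]) (simp add: integral_density integral_distr)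
qed

section \<open>Measures on hyperplanes and oblique projections\<close>

lemma nn_integral_hyperplane_measure:
  fixes g :: "real ^ 'd \<Rightarrow> ennreal"
  assumes [measurable]: "g \<in> borel_measurable borel"
  shows "(\<integral>\<^sup>+y. g y \<partial>hyperplane_measure p \<nu>) =
    (\<integral>\<^sup>+x. indicator {0..1} (\<nu> \<bullet> (x - p)) * g (x - (\<nu> \<bullet> (x - p)) *\<^sub>R \<nu>) \<partial>lborel)"
proof -
  let ?S = "{x. 0 \<le> \<nu> \<bullet> (x - p) \<and> \<nu> \<bullet> (x - p) \<le> 1}"
  have [measurable]: "?S \<in> sets borel" by measurable
  have "(\<integral>\<^sup>+y. g y \<partial>hyperplane_measure p \<nu>) =
      (\<integral>\<^sup>+x. g (x - (\<nu> \<bullet> (x - p)) *\<^sub>R \<nu>) \<partial>restrict_space lborel ?S)"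
    unfolding hyperplane_measure_def
    by (rule nn_integral_distr) (auto intro!: measurable_restrict_space1)
  also have "\<dots> = (\<integral>\<^sup>+x. g (x - (\<nu> \<bullet> (x - p)) *\<^sub>R \<nu>) * indicator ?S x \<partial>lborel)"
    by (rule nn_integral_restrict_space) auto
  also have "\<dots> = (\<integral>\<^sup>+x. indicator {0..1} (\<nu> \<bullet> (x - p)) * g (x - (\<nu> \<bullet> (x - p)) *\<^sub>R \<nu>) \<partial>lborel)"
    by (rule nn_integral_cong) (auto simp: indicator_def)
  finally show ?thesis .
qed

lemma sets_hyperplane_measure [simp, measurable_cong]: "sets (hyperplane_measure p \<nu>) = sets borel"
  by (simp add: hyperplane_measure_def)

lemma space_hyperplane_measure [simp]: "space (hyperplane_measure p \<nu>) = UNIV"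
  by (simp add: hyperplane_measure_def)

lemma AE_hyperplane_measure:
  assumes "norm \<nu> = 1"
  shows "AE y in hyperplane_measure p \<nu>. \<nu> \<bullet> (y - p) = 0"
proof -
  have "\<nu> \<bullet> \<nu> = 1" using assms by (simp add: norm_eq_1)
  then have "\<nu> \<bullet> (x - (\<nu> \<bullet> (x - p)) *\<^sub>R \<nu> - p) = 0" for x
    by (simp add: inner_simps)
  then show ?thesis
    unfolding hyperplane_measure_def
    by (subst AE_distr_iff) (auto intro!: measurable_restrict_space1)
qed

text \<open>A point of the slab has distance at most 1 from its projection, so the prism over
  \<open>S\<close> lies in a ball whose radius is enlarged by one.\<close>

lemma emeasure_hyperplane_measure_bounded:
  fixes p :: "real ^ 'd"
  assumes "bounded S" and [measurable]: "S \<in> sets borel" and \<nu>: "norm \<nu> = 1"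
  shows "emeasure (hyperplane_measure p \<nu>) S < \<infinity>"
proof -
  obtain B where B: "\<And>x. x \<in> S \<Longrightarrow> norm x \<le> B"
    using \<open>bounded S\<close> by (auto simp: bounded_iff)
  have "emeasure (hyperplane_measure p \<nu>) S = (\<integral>\<^sup>+y. indicator S y \<partial>hyperplane_measure p \<nu>)"
    by simp
  also have "\<dots> = (\<integral>\<^sup>+x. indicator {0..1} (\<nu> \<bullet> (x - p)) * indicator S (x - (\<nu> \<bullet> (x - p)) *\<^sub>R \<nu>) \<partial>lborel)"
    by (rule nn_integral_hyperplane_measure) simp
  also have "\<dots> \<le> (\<integral>\<^sup>+x. indicator (cball 0 (B + 1)) (x :: real ^ 'd) \<partial>lborel)"
  proof (rule nn_integral_mono)
    fix x
    have "norm x \<le> B + 1" if "x - (\<nu> \<bullet> (x - p)) *\<^sub>R \<nu> \<in> S" "0 \<le> \<nu> \<bullet> (x - p)" "\<nu> \<bullet> (x - p) \<le> 1"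
      using B[OF that(1)] norm_triangle_ineq[of "x - (\<nu> \<bullet> (x - p)) *\<^sub>R \<nu>" "(\<nu> \<bullet> (x - p)) *\<^sub>R \<nu>"] that \<nu>
      by simp
    then show "indicator {0..1} (\<nu> \<bullet> (x - p)) * indicator S (x - (\<nu> \<bullet> (x - p)) *\<^sub>R \<nu>)
        \<le> (indicator (cball 0 (B + 1)) x :: ennreal)"
      by (auto simp: indicator_def)
  qed
  also have "\<dots> < \<infinity>"
    using emeasure_bounded_finite[OF bounded_cball] by simp
  finally show ?thesis .
qed

text \<open>Provides Fubini's theorem for the product with Lebesgue measure on a line.\<close>

lemma sigma_finite_hyperplane_measure:
  fixes p :: "real ^ 'd"
  assumes "norm \<nu> = 1"
  shows "sigma_finite_measure (hyperplane_measure p \<nu>)"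
proof
  let ?A = "range (\<lambda>n::nat. cball (0 :: real ^ 'd) (real n))"
  have "\<Union> ?A = UNIV"
    by (auto simp: real_arch_simple)
  moreover have "emeasure (hyperplane_measure p \<nu>) a \<noteq> \<infinity>" if "a \<in> ?A" for a
    using that emeasure_hyperplane_measure_bounded[of a \<nu> p] assms by auto
  ultimately show "\<exists>A. countable A \<and> A \<subseteq> sets (hyperplane_measure p \<nu>) \<and> \<Union> A = space (hyperplane_measure p \<nu>) \<and>
      (\<forall>a\<in>A. emeasure (hyperplane_measure p \<nu>) a \<noteq> \<infinity>)"
    by (intro exI[of _ ?A]) auto
qed

text \<open>
  The projection along \<open>e\<close> differs from the orthogonal projection by a shear preserving the slab,
  so only the factor \<open>\<nu> \<bullet> e\<close> of the slab averaging survives.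
\<close>

lemma nn_integral_oblique:
  fixes h :: "real ^ 'd \<Rightarrow> ennreal"
  assumes [measurable]: "h \<in> borel_measurable borel" and \<nu>: "norm \<nu> = 1" and e: "\<nu> \<bullet> e \<noteq> 0"
  shows "(\<integral>\<^sup>+x. h x \<partial>lborel) = ennreal \<bar>\<nu> \<bullet> e\<bar> *
    (\<integral>\<^sup>+y. (\<integral>\<^sup>+s. h (y + s *\<^sub>R e) \<partial>lborel) \<partial>hyperplane_measure p \<nu>)"
proof -
  have \<nu>\<nu>: "\<nu> \<bullet> \<nu> = 1" using \<nu> by (simp add: norm_eq_1)
  define \<eta> where "\<eta> = (1 / (\<nu> \<bullet> e)) *\<^sub>R e - \<nu>"
  have \<eta>: "\<nu> \<bullet> \<eta> = 0" using e by (simp add: \<eta>_def inner_simps \<nu>\<nu>)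
  let ?g = "\<lambda>x. \<integral>\<^sup>+s. h (x + s *\<^sub>R e) \<partial>lborel"
  let ?b = "\<lambda>x. \<nu> \<bullet> (x - p)"
  have shift: "?g (x + a *\<^sub>R e) = ?g x" for x a
    using nn_integral_lborel_shift[of "\<lambda>s. h (x + s *\<^sub>R e)" a] by (simp add: algebra_simps)
  have "(\<integral>\<^sup>+x. indicator {0..1} (?b x) * ?g x \<partial>lborel) =
      (\<integral>\<^sup>+x. indicator {0..1} (?b (x + ?b x *\<^sub>R \<eta>)) * ?g (x + ?b x *\<^sub>R \<eta>) \<partial>lborel)"
    using nn_integral_rank_one_update[of "\<lambda>x. indicator {0..1} (?b x) * ?g x" \<nu> \<eta> p] \<eta> by simp
  also have "\<dots> = (\<integral>\<^sup>+x. indicator {0..1} (?b x) * ?g (x - ?b x *\<^sub>R \<nu>) \<partial>lborel)"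
  proof (rule nn_integral_cong)
    fix x
    \<comment> \<open>A step along \<open>\<eta>\<close> is the orthogonal step
      \<open>- t *\<^sub>R \<nu>\<close> followed by a displacement along \<open>e\<close>, to which
      \<open>?g\<close> is insensitive.\<close>
    have 1: "x + t *\<^sub>R \<eta> = (x - t *\<^sub>R \<nu>) + (t / (\<nu> \<bullet> e)) *\<^sub>R e" for t
      by (simp add: \<eta>_def scaleR_diff_right)
    have 2: "?b (x + ?b x *\<^sub>R \<eta>) = ?b x"
      using \<eta> by (simp add: inner_simps)
    show "indicator {0..1} (?b (x + ?b x *\<^sub>R \<eta>)) * ?g (x + ?b x *\<^sub>R \<eta>) =
        indicator {0..1} (?b x) * ?g (x - ?b x *\<^sub>R \<nu>)"
      unfolding 2 unfolding 1 shift ..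
  qed
  also have "\<dots> = (\<integral>\<^sup>+y. ?g y \<partial>hyperplane_measure p \<nu>)"
    by (rule nn_integral_hyperplane_measure[symmetric]) measurable
  finally show ?thesis
    by (subst nn_integral_lborel_slab[OF assms(1) e, of p]) simp
qed

text \<open>The formula for nonnegative functions says that \<open>lborel\<close> is a constant
  multiple of the image of the product of the hyperplane measure and the line. Integrability and the
  formula for signed functions then follow from Fubini's theorem.\<close>

lemma
  fixes h :: "real ^ 'd \<Rightarrow> real"
  assumes h: "integrable lborel h" and \<nu>: "norm \<nu> = 1" and e: "\<nu> \<bullet> e \<noteq> 0"
  shows integral_oblique: "(\<integral>x. h x \<partial>lborel) = \<bar>\<nu> \<bullet> e\<bar> *
      (\<integral>y. (\<integral>s. h (y + s *\<^sub>R e) \<partial>lborel) \<partial>hyperplane_measure p \<nu>)"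
    and integrable_oblique: "integrable (hyperplane_measure p \<nu>) (\<lambda>y. \<integral>s. h (y + s *\<^sub>R e) \<partial>lborel)"
proof -
  interpret sigma_finite_measure "hyperplane_measure p \<nu>"
    by (rule sigma_finite_hyperplane_measure) fact
  interpret P: pair_sigma_finite "hyperplane_measure p \<nu>" "lborel :: real measure" ..
  let ?T = "\<lambda>(y, s). y + s *\<^sub>R e"
  let ?D = "distr (hyperplane_measure p \<nu> \<Otimes>\<^sub>M (lborel :: real measure)) borel ?T"
  have T[measurable]: "?T \<in> borel_measurable (hyperplane_measure p \<nu> \<Otimes>\<^sub>M (lborel :: real measure))"
    by measurable
  have lb: "lborel = density ?D (\<lambda>_. ennreal \<bar>\<nu> \<bullet> e\<bar>)"
  proof (rule measure_eqI)
    fix A :: "(real ^ 'd) set" assume "A \<in> sets lborel"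
    then have [measurable]: "A \<in> sets borel" by simp
    have "emeasure lborel A = (\<integral>\<^sup>+x. indicator A x \<partial>lborel)" by simp
    also have "\<dots> = ennreal \<bar>\<nu> \<bullet> e\<bar> *
        (\<integral>\<^sup>+y. (\<integral>\<^sup>+s. indicator A (y + s *\<^sub>R e) \<partial>lborel) \<partial>hyperplane_measure p \<nu>)"
      by (rule nn_integral_oblique) (use \<nu> e in auto)
    also have "(\<integral>\<^sup>+y. (\<integral>\<^sup>+s. indicator A (y + s *\<^sub>R e) \<partial>lborel) \<partial>hyperplane_measure p \<nu>) =
        (\<integral>\<^sup>+z. indicator A (?T z) \<partial>(hyperplane_measure p \<nu> \<Otimes>\<^sub>M lborel))"
      by (subst lborel.nn_integral_fst[symmetric]) (auto simp: measurable_split_conv)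
    also have "\<dots> = (\<integral>\<^sup>+x. indicator A x \<partial>?D)"
      by (rule nn_integral_distr[symmetric]) measurable
    also have "ennreal \<bar>\<nu> \<bullet> e\<bar> * \<dots> = emeasure (density ?D (\<lambda>_. ennreal \<bar>\<nu> \<bullet> e\<bar>)) A"
      by (simp add: emeasure_density nn_integral_cmult)
    finally show "emeasure lborel A = emeasure (density ?D (\<lambda>_. ennreal \<bar>\<nu> \<bullet> e\<bar>)) A" .
  qed simp
  have hb[measurable]: "h \<in> borel_measurable borel"
    using borel_measurable_integrable[OF h] by simp
  have "integrable (density ?D (\<lambda>_. ennreal \<bar>\<nu> \<bullet> e\<bar>)) h"
    using h lb by simp
  then have "integrable ?D (\<lambda>x. \<bar>\<nu> \<bullet> e\<bar> *\<^sub>R h x)"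
    by (subst (asm) integrable_density) auto
  then have "integrable ?D h"
    using e by simp
  then have i: "integrable (hyperplane_measure p \<nu> \<Otimes>\<^sub>M lborel) (\<lambda>(y, s). h (y + s *\<^sub>R e))"
    by (subst (asm) integrable_distr_eq) (auto simp: case_prod_unfold)
  show "integrable (hyperplane_measure p \<nu>) (\<lambda>y. \<integral>s. h (y + s *\<^sub>R e) \<partial>lborel)"
    using P.integrable_fst'[OF i] by simp
  have "(\<integral>x. h x \<partial>lborel) = (\<integral>x. h x \<partial>density ?D (\<lambda>_. ennreal \<bar>\<nu> \<bullet> e\<bar>))"
    by (simp only: lb[symmetric])
  also have "\<dots> = \<bar>\<nu> \<bullet> e\<bar> * (\<integral>x. h x \<partial>?D)"
    by (subst integral_density) auto
  also have "(\<integral>x. h x \<partial>?D) = (\<integral>(y, s). h (y + s *\<^sub>R e) \<partial>(hyperplane_measure p \<nu> \<Otimes>\<^sub>M lborel))"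
    by (subst integral_distr) (auto simp: case_prod_unfold)
  also have "\<dots> = (\<integral>y. (\<integral>s. h (y + s *\<^sub>R e) \<partial>lborel) \<partial>hyperplane_measure p \<nu>)"
    using P.integral_fst'[OF i] by simp
  finally show "(\<integral>x. h x \<partial>lborel) = \<bar>\<nu> \<bullet> e\<bar> *
      (\<integral>y. (\<integral>s. h (y + s *\<^sub>R e) \<partial>lborel) \<partial>hyperplane_measure p \<nu>)" .
qed

text \<open>
  The slabs used to define the two measures lie on opposite sides of the hyperplane; a translation
  along the normal exchanges them.
\<close>

lemma hyperplane_measure_uminus_translate:
  fixes p q :: "real ^ 'd"
  assumes \<nu>: "norm \<nu> = 1"
  shows "hyperplane_measure (p + a) (- \<nu>) = distr (hyperplane_measure p \<nu>) borel (\<lambda>x. x + a)"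
proof (rule measure_eqI)
  fix A assume "A \<in> sets (hyperplane_measure (p + a) (- \<nu>))"
  then have [measurable]: "A \<in> sets borel" by simp
  have \<nu>\<nu>: "\<nu> \<bullet> \<nu> = 1" using \<nu> by (simp add: norm_eq_1)
  let ?b = "\<lambda>x. \<nu> \<bullet> (x - p)"
  let ?h = "\<lambda>x. indicator {0..1} ((- \<nu>) \<bullet> (x - (p + a))) *
      (indicator A (x - ((- \<nu>) \<bullet> (x - (p + a))) *\<^sub>R (- \<nu>)) :: ennreal)"
  have "emeasure (hyperplane_measure (p + a) (- \<nu>)) A = (\<integral>\<^sup>+y. indicator A y \<partial>hyperplane_measure (p + a) (- \<nu>))"
    by simp
  also have "\<dots> = (\<integral>\<^sup>+x. ?h x \<partial>lborel)"
    by (rule nn_integral_hyperplane_measure) simp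
  also have "\<dots> = (\<integral>\<^sup>+x. ?h (x + (a - \<nu>)) \<partial>lborel)"
    by (rule nn_integral_lborel_shift[symmetric]) measurable
  also have "\<dots> = (\<integral>\<^sup>+x. indicator {0..1} (?b x) * indicator A (x - ?b x *\<^sub>R \<nu> + a) \<partial>lborel)"
  proof (rule nn_integral_cong)
    fix x
    have 1: "(- \<nu>) \<bullet> (x + (a - \<nu>) - (p + a)) = 1 - ?b x"
      by (simp add: inner_simps \<nu>\<nu>)
    show "?h (x + (a - \<nu>)) = indicator {0..1} (?b x) * indicator A (x - ?b x *\<^sub>R \<nu> + a)"
      unfolding 1 by (auto simp: indicator_def algebra_simps)
  qed
  also have "\<dots> = (\<integral>\<^sup>+y. indicator A (y + a) \<partial>hyperplane_measure p \<nu>)"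
    by (rule nn_integral_hyperplane_measure[symmetric]) measurable
  also have "\<dots> = (\<integral>\<^sup>+y. indicator A y \<partial>distr (hyperplane_measure p \<nu>) borel (\<lambda>x. x + a))"
    by (rule nn_integral_distr[symmetric]) measurable
  also have "\<dots> = emeasure (distr (hyperplane_measure p \<nu>) borel (\<lambda>x. x + a)) A"
    by simp
  finally show "emeasure (hyperplane_measure (p + a) (- \<nu>)) A =
      emeasure (distr (hyperplane_measure p \<nu>) borel (\<lambda>x. x + a)) A" .
qed simp

section \<open>Barycentric coordinates\<close>

lemma sum_UNIV_option: "(\<Sum>l\<in>UNIV. f l) = f None + (\<Sum>i\<in>UNIV. f (Some (i::'n::finite)))"
  by (simp add: UNIV_option_conv sum.reindex)

text \<open>The rows of the inverse edge matrix form the dual basis of the edges issuing from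
  \<open>w None\<close>, hence are the gradients of the coordinates belonging to
  \<open>Some i\<close>. The remaining gradient is fixed by the requirement that all of them add up
  to zero.\<close>

definition bary_grad :: "('d::finite option \<Rightarrow> real ^ 'd) \<Rightarrow> 'd option \<Rightarrow> real ^ 'd" where
  "bary_grad w l = (case l of None \<Rightarrow> - (\<Sum>i\<in>UNIV. matrix_inv (edge_matrix w) $ i)
     | Some i \<Rightarrow> matrix_inv (edge_matrix w) $ i)"

definition bary :: "('d::finite option \<Rightarrow> real ^ 'd) \<Rightarrow> 'd option \<Rightarrow> real ^ 'd \<Rightarrow> real" where
  "bary w l x = (if l = None then 1 else 0) + bary_grad w l \<bullet> (x - w None)"

lemma bary_Some: "bary w (Some i) x = (matrix_inv (edge_matrix w) *v (x - w None)) $ i"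
  by (simp add: bary_def bary_grad_def matrix_vector_mul_component)

lemma sum_bary_grad: "(\<Sum>l\<in>UNIV. bary_grad w l) = 0"
  by (simp add: sum_UNIV_option bary_grad_def)

lemma sum_bary: "(\<Sum>l\<in>UNIV. bary w l x) = 1"
proof -
  have "(\<Sum>l\<in>UNIV. bary w l x) = (\<Sum>l\<in>(UNIV::'a option set). if l = None then 1 else 0) + (\<Sum>l\<in>UNIV. bary_grad w l) \<bullet> (x - w None)"
    by (simp only: bary_def sum.distrib inner_sum_left)
  then show ?thesis by (simp add: sum_bary_grad)
qed

lemma bary_diff: "bary w l x - bary w l y = bary_grad w l \<bullet> (x - y)"
  by (simp add: bary_def inner_simps)

lemma bary_add: "bary w l (x + s *\<^sub>R e) = bary w l x + s * (bary_grad w l \<bullet> e)"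
  by (simp add: bary_def inner_simps)

lemma continuous_on_bary [continuous_intros]:
  "continuous_on S f \<Longrightarrow> continuous_on S (\<lambda>x. bary w l (f x))"
  unfolding bary_def by (intro continuous_intros)

lemma GDERIV_bary: "GDERIV (bary w l) x :> bary_grad w l"
  unfolding gderiv_def bary_def by (auto intro!: derivative_eq_intros simp: inner_commute)

lemma edge_matrix_mult: "edge_matrix w *v \<xi> = (\<Sum>i\<in>UNIV. (\<xi> $ i) *\<^sub>R (w (Some i) - w None))"
  by (simp add: matrix_mult_sum column_def edge_matrix_def vec_eq_iff scalar_mult_eq_scaleR)

lemma affine_combination_ref_map:
  assumes "(\<Sum>l\<in>UNIV. c l) = 1"
  shows "(\<Sum>l\<in>UNIV. c l *\<^sub>R w l) = ref_map w (\<chi> i. c (Some i))"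
proof -
  have c: "c None = 1 - (\<Sum>i\<in>UNIV. c (Some i))"
    using assms by (simp add: sum_UNIV_option)
  show ?thesis
    unfolding sum_UNIV_option c
    by (simp add: ref_map_def edge_matrix_mult scaleR_diff_left scaleR_diff_right scaleR_sum_left sum_subtractf)
qed

lemma all_option_iff: "(\<forall>l. P l) \<longleftrightarrow> P None \<and> (\<forall>i. P (Some i))"
  by (metis option.exhaust)

lemma compact_simplex: "compact (convex hull (range w))" for w :: "'d::finite option \<Rightarrow> real ^ 'd"
  by (simp add: finite_imp_compact_convex_hull)

lemma compact_facet: "compact (facet w l)" for w :: "'d::finite option \<Rightarrow> real ^ 'd"
  by (simp add: facet_def finite_imp_compact_convex_hull)

lemma facet_subset_simplex: "facet w l \<subseteq> convex hull (range w)" for w :: "'d::finite option \<Rightarrow> real ^ 'd"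
  by (auto simp: facet_def intro!: hull_mono)

context
  fixes w :: "'d::finite option \<Rightarrow> real ^ 'd"
  assumes nondeg: "det (edge_matrix w) \<noteq> 0"
begin

lemma edge_matrix_inverse:
  "edge_matrix w ** matrix_inv (edge_matrix w) = mat 1"
  "matrix_inv (edge_matrix w) ** edge_matrix w = mat 1"
proof -
  have "\<exists>A'. edge_matrix w ** A' = mat 1 \<and> A' ** edge_matrix w = mat 1"
    using nondeg invertible_det_nz[of "edge_matrix w"] by (simp add: invertible_def)
  then have "edge_matrix w ** matrix_inv (edge_matrix w) = mat 1 \<and>
      matrix_inv (edge_matrix w) ** edge_matrix w = mat 1"
    unfolding matrix_inv_def by (rule someI_ex)
  then show "edge_matrix w ** matrix_inv (edge_matrix w) = mat 1"
    "matrix_inv (edge_matrix w) ** edge_matrix w = mat 1" by auto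
qed

lemma bary_ref_map: "bary w (Some i) (ref_map w \<xi>) = \<xi> $ i"
  by (simp add: bary_Some ref_map_def matrix_vector_mul_assoc edge_matrix_inverse)

lemma bary_None_ref_map: "bary w None (ref_map w \<xi>) = 1 - (\<Sum>i\<in>UNIV. \<xi> $ i)"
  using sum_bary[of w "ref_map w \<xi>"] by (simp add: sum_UNIV_option bary_ref_map)

lemma ref_map_bary: "ref_map w (\<chi> i. bary w (Some i) x) = x"
proof -
  have "(\<chi> i. bary w (Some i) x) = matrix_inv (edge_matrix w) *v (x - w None)"
    by (simp add: bary_Some vec_eq_iff)
  then show ?thesis
    by (simp add: ref_map_def matrix_vector_mul_assoc edge_matrix_inverse)
qed

lemma inv_ref_map: "inv (ref_map w) x = (\<chi> i. bary w (Some i) x)"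
proof -
  have "inj (ref_map w)"
    by (rule inj_on_inverseI[of _ "\<lambda>x. \<chi> i. bary w (Some i) x"]) (simp add: bary_ref_map)
  then show ?thesis
    using ref_map_bary inv_f_f by metis
qed

lemma sum_bary_scaleR: "(\<Sum>l\<in>UNIV. bary w l x *\<^sub>R w l) = x"
proof -
  have "(\<Sum>l\<in>UNIV. bary w l x *\<^sub>R w l) = ref_map w (\<chi> i. bary w (Some i) x)"
    by (rule affine_combination_ref_map) (rule sum_bary)
  then show ?thesis by (simp add: ref_map_bary)
qed

lemma bary_unique:
  assumes "(\<Sum>l\<in>UNIV. c l) = 1"
  shows "bary w l (\<Sum>l\<in>UNIV. c l *\<^sub>R w l) = c l"
proof -
  have c: "c None = 1 - (\<Sum>i\<in>UNIV. c (Some i))"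
    using assms by (simp add: sum_UNIV_option)
  then show ?thesis
    unfolding affine_combination_ref_map[OF assms]
    by (cases l) (simp_all add: bary_ref_map bary_None_ref_map c)
qed

lemma bary_vertex: "bary w l (w m) = (if l = m then 1 else 0)"
proof -
  have "(\<Sum>j\<in>UNIV. (if j = m then 1 else 0) *\<^sub>R w j) = w m"
    by (simp add: if_distrib[of "\<lambda>c. c *\<^sub>R _"] cong: if_cong)
  then show ?thesis
    using bary_unique[of "\<lambda>j. if j = m then 1 else 0" l] by simp
qed

lemma bary_grad_edge:
  "bary_grad w l \<bullet> (w m - w j) = (if l = m then 1 else 0) - (if l = j then 1 else 0)"
  by (simp add: bary_diff[symmetric] bary_vertex)

lemma inj_vertices: "inj w"
  by (rule injI) (metis bary_vertex zero_neq_one)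

text \<open>By uniqueness of barycentric coordinates, the coefficients of a convex combination are
  these coordinates. An arbitrary set of vertices is allowed in order to cover the simplex and its
  facets together.\<close>

lemma convex_hull_vertices:
  "convex hull (w ` A) = {x. (\<forall>l. 0 \<le> bary w l x) \<and> (\<forall>l. l \<notin> A \<longrightarrow> bary w l x = 0)}"
proof (intro set_eqI iffI)
  fix x assume "x \<in> convex hull (w ` A)"
  then obtain u where u: "\<forall>y\<in>w ` A. 0 \<le> u y" "sum u (w ` A) = 1" "(\<Sum>y\<in>w ` A. u y *\<^sub>R y) = x"
    by (auto simp: convex_hull_finite)
  define c where "c l = (if l \<in> A then u (w l) else 0)" for l
  have inj: "inj_on w A" using inj_vertices by (rule inj_on_subset) simp
  have s1: "(\<Sum>l\<in>UNIV. c l) = 1"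
    using u(2) by (simp add: c_def sum.reindex[OF inj] sum.If_cases)
  have "(\<Sum>l\<in>UNIV. c l *\<^sub>R w l) = x"
    using u(3) by (simp add: c_def sum.reindex[OF inj] if_distrib[of "\<lambda>c. c *\<^sub>R _"] sum.If_cases cong: if_cong)
  then have "bary w l x = c l" for l
    using bary_unique[OF s1] by metis
  then show "x \<in> {x. (\<forall>l. 0 \<le> bary w l x) \<and> (\<forall>l. l \<notin> A \<longrightarrow> bary w l x = 0)}"
    using u(1) by (auto simp: c_def)
next
  fix x assume x: "x \<in> {x. (\<forall>l. 0 \<le> bary w l x) \<and> (\<forall>l. l \<notin> A \<longrightarrow> bary w l x = 0)}"
  then have z: "bary w l x = 0" if "l \<in> UNIV - A" for l using that by auto
  have "(\<Sum>l\<in>A. bary w l x) = (\<Sum>l\<in>UNIV. bary w l x)"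
    by (rule sum.mono_neutral_left) (use z in auto)
  then have 1: "(\<Sum>l\<in>A. bary w l x) = 1" by (simp add: sum_bary)
  have "(\<Sum>l\<in>A. bary w l x *\<^sub>R w l) = (\<Sum>l\<in>UNIV. bary w l x *\<^sub>R w l)"
    by (rule sum.mono_neutral_left) (use z in auto)
  then have 2: "(\<Sum>l\<in>A. bary w l x *\<^sub>R w l) = x" by (simp add: sum_bary_scaleR)
  have "(\<Sum>l\<in>A. bary w l x *\<^sub>R w l) \<in> convex hull (w ` A)"
    by (rule convex_sum) (use x 1 in \<open>auto intro: hull_inc\<close>)
  then show "x \<in> convex hull (w ` A)" by (simp add: 2)
qed

lemma mem_simplex: "x \<in> convex hull (range w) \<longleftrightarrow> (\<forall>l. 0 \<le> bary w l x)"
  by (simp add: convex_hull_vertices)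

lemma mem_facet: "x \<in> facet w l \<longleftrightarrow> bary w l x = 0 \<and> (\<forall>j. 0 \<le> bary w j x)"
  by (auto simp: facet_def convex_hull_vertices)

lemma cell_of_bary: "cell_of w = {x. \<forall>l. 0 < bary w l x}"
proof
  show "{x. \<forall>l. 0 < bary w l x} \<subseteq> cell_of w"
    unfolding cell_of_def
  proof (rule interior_maximal)
    show "{x. \<forall>l. 0 < bary w l x} \<subseteq> convex hull (range w)"
      by (auto simp: mem_simplex less_imp_le)
    have "open (\<Inter>l. {x. 0 < bary w l x})"
      by (intro open_INT ballI open_Collect_less continuous_intros) simp
    then show "open {x. \<forall>l. 0 < bary w l x}"
      by (simp add: Collect_all_eq)
  qed
  show "cell_of w \<subseteq> {x. \<forall>l. 0 < bary w l x}"
  proof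
    fix x assume x: "x \<in> cell_of w"
    have "bary w l x \<noteq> 0" for l
    proof
      assume z: "bary w l x = 0"
      obtain m where m: "m \<noteq> l" by (metis (full_types) option.distinct(1))
      \<comment> \<open>Moving from \<open>x\<close> in the direction from vertex \<open>l\<close>
        to another vertex decreases coordinate \<open>l\<close>, so an interior point with vanishing
        coordinate \<open>l\<close> would leave the simplex at once.\<close>
      define e where "e = w m - w l"
      have e: "bary_grad w l \<bullet> e = -1" using m by (simp add: e_def bary_grad_edge)
      obtain r where r: "0 < r" "ball x r \<subseteq> convex hull (range w)"
        using x by (auto simp: cell_of_def mem_interior)
      \<comment> \<open>Adding 1 makes the divisor in \<open>s\<close> positive at no cost.\<close>
      define N where "N = norm e + 1"
      have N: "norm e < N" "0 < N" by (simp_all add: N_def add_nonneg_pos)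
      define s where "s = r / (2 * N)"
      have s: "0 < s" using r N by (simp add: s_def)
      have "s * norm e < r"
      proof -
        have "s * norm e < s * N" using s N by simp
        also have "\<dots> = r / 2" using N by (simp add: s_def)
        also have "\<dots> < r" using r by simp
        finally show ?thesis .
      qed
      then have "x + s *\<^sub>R e \<in> convex hull (range w)"
        using r s by (auto simp: dist_norm subset_iff)
      then have "0 \<le> bary w l (x + s *\<^sub>R e)" by (simp add: mem_simplex)
      then show False using s by (simp add: bary_add z e)
    qed
    moreover have "0 \<le> bary w l x" for l
      using x interior_subset[of "convex hull (range w)"] mem_simplex by (auto simp: cell_of_def)
    ultimately show "x \<in> {x. \<forall>l. 0 < bary w l x}"
      by (simp add: less_le eq_commute[of 0])
  qed
qed

lemma bary_grad_nonzero: "bary_grad w l \<noteq> 0"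
proof -
  obtain m where m: "m \<noteq> l" by (metis (full_types) option.distinct(1))
  then have "bary_grad w l \<bullet> (w l - w m) = 1"
    by (simp add: bary_grad_edge)
  then show ?thesis by auto
qed

text \<open>The edges are the columns of an invertible matrix. Vectors are identified below by
  testing them with edges only, both for normals and in the divergence theorem.\<close>

lemma edges_span:
  assumes "\<And>i. v \<bullet> (w (Some i) - w None) = 0"
  shows "v = 0"
proof -
  have "v \<bullet> y = 0" for y
  proof -
    have "y = edge_matrix w *v (matrix_inv (edge_matrix w) *v y)"
      by (simp add: matrix_vector_mul_assoc edge_matrix_inverse)
    then have "y = (\<Sum>i\<in>UNIV. ((matrix_inv (edge_matrix w) *v y) $ i) *\<^sub>R (w (Some i) - w None))"
      by (simp only: edge_matrix_mult)
    then have "v \<bullet> y = (\<Sum>i\<in>UNIV. ((matrix_inv (edge_matrix w) *v y) $ i) * (v \<bullet> (w (Some i) - w None)))"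
      by (metis (no_types, lifting) inner_scaleR_right inner_sum_right sum.cong)
    then show ?thesis by (simp add: assms)
  qed
  then show ?thesis using inner_eq_zero_iff by blast
qed

text \<open>For a suitable \<open>\<beta> > 0\<close> the vector
  \<open>\<nu> + \<beta> *\<^sub>R ?g\<close> is orthogonal to every edge and therefore zero; the
  norm of \<open>\<nu>\<close> then determines \<open>\<beta>\<close>.\<close>

lemma outward_normal_unique:
  assumes \<nu>: "norm \<nu> = 1" "\<And>i j. i \<noteq> l \<Longrightarrow> j \<noteq> l \<Longrightarrow> \<nu> \<bullet> (w i - w j) = 0"
    "\<And>i. i \<noteq> l \<Longrightarrow> \<nu> \<bullet> (w l - w i) < 0"
  shows "\<nu> = (- 1 / norm (bary_grad w l)) *\<^sub>R bary_grad w l"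
proof -
  let ?g = "bary_grad w l"
  obtain m where m: "m \<noteq> l" by (metis (full_types) option.distinct(1))
  define \<beta> where "\<beta> = - (\<nu> \<bullet> (w l - w m))"
  have \<beta>: "0 < \<beta>" using \<nu>(3)[OF m] by (simp add: \<beta>_def)
  have c: "(\<nu> + \<beta> *\<^sub>R ?g) \<bullet> (w i - w m) = 0" for i
    using \<nu>(2)[OF _ m, of i] m
    by (cases "i = l") (auto simp: inner_add_left inner_diff_left bary_grad_edge \<beta>_def)
  have "(\<nu> + \<beta> *\<^sub>R ?g) \<bullet> (w (Some i) - w None) = 0" for i
    using c[of "Some i"] c[of None] by (simp add: inner_diff_right)
  then have n: "\<nu> = - (\<beta> *\<^sub>R ?g)"
    using edges_span by (metis eq_neg_iff_add_eq_0)
  then have "\<beta> * norm ?g = 1" using \<nu>(1) \<beta> by simp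
  then have "\<beta> = 1 / norm ?g" by (metis mult_zero_right nonzero_eq_divide_eq zero_neq_one)
  then show ?thesis by (simp add: n)
qed

lemma outward_normal_eq: "outward_normal w l = (- 1 / norm (bary_grad w l)) *\<^sub>R bary_grad w l"
  unfolding outward_normal_def
proof (rule the_equality)
  let ?\<nu> = "(- 1 / norm (bary_grad w l)) *\<^sub>R bary_grad w l"
  show "norm ?\<nu> = 1 \<and> (\<forall>i j. i \<noteq> l \<longrightarrow> j \<noteq> l \<longrightarrow> ?\<nu> \<bullet> (w i - w j) = 0) \<and>
     (\<forall>i. i \<noteq> l \<longrightarrow> ?\<nu> \<bullet> (w l - w i) < 0)"
    using bary_grad_nonzero[of l] by (auto simp: bary_grad_edge)
qed (use outward_normal_unique in blast)

lemma norm_outward_normal: "norm (outward_normal w l) = 1"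
  using bary_grad_nonzero[of l] by (simp add: outward_normal_eq)

lemma outward_normal_edge:
  "outward_normal w l \<bullet> (w m - w j) =
     (- 1 / norm (bary_grad w l)) * ((if l = m then 1 else 0) - (if l = j then 1 else 0))"
  by (simp add: outward_normal_eq bary_grad_edge)

text \<open>Identifies the hyperplane carrying \<open>facet_measure w l\<close> as the zero set of
  coordinate \<open>l\<close>, because the centre has that coordinate zero and the normal is a
  multiple of its gradient.\<close>

lemma outward_normal_facet_center:
  "outward_normal w l \<bullet> (x - facet_center w l) = 0 \<longleftrightarrow> bary w l x = 0"
proof -
  have card: "card (- {l}) = CARD('d)"
    by (simp add: Compl_eq_Diff_UNIV card_Diff_subset card_UNIV_option)
  have "(\<Sum>i\<in>- {l}. (1 / real CARD('d)) *\<^sub>R w i) = (\<Sum>i\<in>UNIV. (if i = l then 0 else 1 / real CARD('d)) *\<^sub>R w i)"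
    by (simp add: if_distrib[of "\<lambda>c. c *\<^sub>R _"] sum.If_cases Compl_eq cong: if_cong)
  then have "facet_center w l = (\<Sum>i\<in>UNIV. (if i = l then 0 else 1 / real CARD('d)) *\<^sub>R w i)"
    by (simp add: facet_center_def scaleR_sum_right)
  moreover have "(\<Sum>i\<in>UNIV. (if i = l then 0 else 1 / real CARD('d))) = 1"
    using card by (simp add: sum.If_cases Compl_eq)
  ultimately have "bary w l (facet_center w l) = 0"
    using bary_unique[of "\<lambda>i. if i = l then 0 else 1 / real CARD('d)" l] by simp
  then have "bary w l x = bary_grad w l \<bullet> (x - facet_center w l)"
    using bary_diff[of w l x "facet_center w l"] by simp
  then show ?thesis
    using bary_grad_nonzero[of l] by (simp add: outward_normal_eq)
qed

lemma cell_of_ref_map: "cell_of w = ref_map w ` {\<xi>. (\<forall>i. 0 < \<xi> $ i) \<and> (\<Sum>i\<in>UNIV. \<xi> $ i) < 1}"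
proof (intro set_eqI iffI)
  fix x assume "x \<in> cell_of w"
  then have p: "0 < bary w l x" for l by (simp add: cell_of_bary)
  show "x \<in> ref_map w ` {\<xi>. (\<forall>i. 0 < \<xi> $ i) \<and> (\<Sum>i\<in>UNIV. \<xi> $ i) < 1}"
  proof (rule image_eqI)
    show "x = ref_map w (\<chi> i. bary w (Some i) x)" by (simp add: ref_map_bary)
    show "(\<chi> i. bary w (Some i) x) \<in> {\<xi>. (\<forall>i. 0 < \<xi> $ i) \<and> (\<Sum>i\<in>UNIV. \<xi> $ i) < 1}"
    proof -
      have "bary w None x + (\<Sum>i\<in>UNIV. bary w (Some i) x) = 1"
        using sum_bary[of w x] by (simp add: sum_UNIV_option)
      with p[of None] have "(\<Sum>i\<in>UNIV. bary w (Some i) x) < 1" by linarith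
      then show ?thesis using p by simp
    qed
  qed
next
  fix x assume "x \<in> ref_map w ` {\<xi>. (\<forall>i. 0 < \<xi> $ i) \<and> (\<Sum>i\<in>UNIV. \<xi> $ i) < 1}"
  then show "x \<in> cell_of w"
    by (auto simp: cell_of_bary bary_ref_map bary_None_ref_map all_option_iff)
qed

lemma cell_of_nonempty: "cell_of w \<noteq> {}"
proof -
  let ?c = "\<lambda>l::'d option. 1 / real CARD('d option)"
  have "bary w l (\<Sum>l\<in>UNIV. ?c l *\<^sub>R w l) = ?c l" for l
    by (rule bary_unique) simp
  then have "(\<Sum>l\<in>UNIV. ?c l *\<^sub>R w l) \<in> cell_of w"
    by (simp add: cell_of_bary)
  then show ?thesis by blast
qed

lemma closure_cell_of: "closure (cell_of w) = convex hull (range w)"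
  using convex_closure_interior[of "convex hull (range w)"] cell_of_nonempty compact_simplex[of w]
  by (simp add: cell_of_def compact_imp_closed)

end

text \<open>The reference simplex is the simplex with vertices 0 and the unit vectors, whose
  reference map is the identity; the description of general cells applies to it.\<close>

lemma interior_K_ref: "interior K_ref = {\<xi> :: real ^ 'd. (\<forall>i. 0 < \<xi> $ i) \<and> (\<Sum>i\<in>UNIV. \<xi> $ i) < 1}"
proof -
  define w :: "'d option \<Rightarrow> real ^ 'd" where "w l = (case l of None \<Rightarrow> 0 | Some i \<Rightarrow> axis i 1)" for l
  have m: "edge_matrix w = mat 1"
    by (auto simp: edge_matrix_def w_def mat_def axis_def vec_eq_iff)
  then have nd: "det (edge_matrix w) \<noteq> 0" by simp
  have id: "ref_map w \<xi> = \<xi>" for \<xi>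
    by (simp add: ref_map_def m w_def)
  have "K_ref = convex hull (range w)"
  proof (rule set_eqI)
    fix \<xi>
    have "bary w (Some i) \<xi> = \<xi> $ i" for i using bary_ref_map[OF nd, of i \<xi>] by (simp add: id)
    moreover have "bary w None \<xi> = 1 - (\<Sum>i\<in>UNIV. \<xi> $ i)"
      using bary_None_ref_map[OF nd, of \<xi>] by (simp add: id)
    ultimately show "\<xi> \<in> K_ref \<longleftrightarrow> \<xi> \<in> convex hull (range w)"
      by (auto simp: mem_simplex[OF nd] K_ref_def all_option_iff)
  qed
  then show ?thesis
    using cell_of_ref_map[OF nd] by (simp add: cell_of_def id)
qed

section \<open>The divergence theorem on a simplex\<close>

lemma GDERIV_continuous_on: "(\<And>x. GDERIV \<phi> x :> g x) \<Longrightarrow> continuous_on S \<phi>"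
  unfolding gderiv_def by (meson has_derivative_continuous continuous_at_imp_continuous_on)

lemma sets_facet_measure [simp, measurable_cong]: "sets (facet_measure w l) = sets borel"
  and space_facet_measure [simp]: "space (facet_measure w l) = UNIV"
  by (simp_all add: facet_measure_def)

lemma facet_borel [measurable]: "facet w l \<in> sets borel" for w :: "'d::finite option \<Rightarrow> real ^ 'd"
  using compact_facet[of w l] by (simp add: compact_imp_closed)

context
  fixes w :: "'d::finite option \<Rightarrow> real ^ 'd"
  assumes nondeg: "det (edge_matrix w) \<noteq> 0"
begin

lemma AE_facet_measure: "AE y in facet_measure w l. bary w l y = 0"
  using AE_hyperplane_measure[OF norm_outward_normal[OF nondeg], of l "facet_center w l"]
  unfolding facet_measure_def outward_normal_facet_center[OF nondeg] .

lemma integrable_facet: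
  assumes "continuous_on UNIV f"
  shows "set_integrable (facet_measure w l) (facet w l) (f :: real ^ 'd \<Rightarrow> real)"
  unfolding set_integrable_def
proof -
  have "bounded (f ` facet w l)"
    by (intro compact_imp_bounded compact_continuous_image compact_facet)
      (rule continuous_on_subset[OF assms], simp)
  then obtain B where B: "\<And>x. x \<in> facet w l \<Longrightarrow> norm (f x) \<le> B"
    by (auto simp: bounded_iff)
  show "integrable (facet_measure w l) (\<lambda>x. indicator (facet w l) x *\<^sub>R f x)"
  proof (rule integrableI_bounded_set_indicator[where B = B])
    show "f \<in> borel_measurable (facet_measure w l)"
      using borel_measurable_continuous_onI[OF assms]
      by (simp add: measurable_cong_sets[OF sets_facet_measure refl])
    show "emeasure (facet_measure w l) (facet w l) < \<infinity>"
      unfolding facet_measure_def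
      by (intro emeasure_hyperplane_measure_bounded norm_outward_normal nondeg
          compact_imp_bounded compact_facet) simp
  qed (use B in auto)
qed

context
  fixes \<phi> :: "real ^ 'd \<Rightarrow> real" and g :: "real ^ 'd \<Rightarrow> real ^ 'd"
  assumes GD: "\<And>x. GDERIV \<phi> x :> g x" and cont_g: "continuous_on UNIV g"
begin

text \<open>Along \<open>e\<close> coordinate \<open>l\<close> grows and coordinate \<open>m\<close>
  falls at unit rate while the others stay fixed. A line starting at \<open>y\<close> on facet
  \<open>l\<close> thus runs in the simplex exactly for \<open>0 \<le> s \<le> bary w m y\<close>
  and ends on facet \<open>m\<close>; on it the fundamental theorem of calculus applies.\<close>

lemma integral_edge_derivative:
  assumes lm: "l \<noteq> m" and e: "e = w l - w m"
  shows "(LINT x:convex hull (range w)|lborel. g x \<bullet> e) = \<bar>outward_normal w l \<bullet> e\<bar> *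
    (LINT y:facet w l|facet_measure w l. \<phi> (y + bary w m y *\<^sub>R e) - \<phi> y)"
proof -
  have el: "bary w l (y + s *\<^sub>R e) = bary w l y + s" for y s
    using lm by (simp add: bary_add) (simp add: e bary_grad_edge[OF nondeg])
  have em: "bary w m (y + s *\<^sub>R e) = bary w m y - s" for y s
    using lm by (simp add: bary_add) (simp add: e bary_grad_edge[OF nondeg])
  have ej: "bary w j (y + s *\<^sub>R e) = bary w j y" if "j \<noteq> l" "j \<noteq> m" for y s j
    using that by (simp add: bary_add) (simp add: e bary_grad_edge[OF nondeg])
  let ?h = "\<lambda>x. indicator (convex hull (range w)) x *\<^sub>R (g x \<bullet> e)"
  have ne: "outward_normal w l \<bullet> e \<noteq> 0"
    using lm bary_grad_nonzero[OF nondeg, of l] by (simp add: e outward_normal_edge[OF nondeg])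
  have h: "integrable lborel ?h"
    by (intro borel_integrable_compact compact_simplex continuous_intros
        continuous_on_subset[OF cont_g] subset_UNIV)
  have "(\<integral>x. ?h x \<partial>lborel) = \<bar>outward_normal w l \<bullet> e\<bar> *
      (\<integral>y. (\<integral>s. ?h (y + s *\<^sub>R e) \<partial>lborel) \<partial>facet_measure w l)"
    unfolding facet_measure_def
    by (rule integral_oblique[OF h norm_outward_normal[OF nondeg] ne])
  also have "(\<integral>y. (\<integral>s. ?h (y + s *\<^sub>R e) \<partial>lborel) \<partial>facet_measure w l) =
      (\<integral>y. indicator (facet w l) y *\<^sub>R (\<phi> (y + bary w m y *\<^sub>R e) - \<phi> y) \<partial>facet_measure w l)"
  proof (rule integral_cong_AE)
    show "(\<lambda>y. \<integral>s. ?h (y + s *\<^sub>R e) \<partial>lborel) \<in> borel_measurable (facet_measure w l)"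
      using integrable_oblique[OF h norm_outward_normal[OF nondeg] ne]
      unfolding facet_measure_def by (rule borel_measurable_integrable)
    have "continuous_on UNIV (\<lambda>y. \<phi> (y + bary w m y *\<^sub>R e) - \<phi> y)"
      by (intro continuous_intros continuous_on_compose2[OF GDERIV_continuous_on[OF GD]]) auto
    from integrable_facet[OF this]
    show "(\<lambda>y. indicator (facet w l) y *\<^sub>R (\<phi> (y + bary w m y *\<^sub>R e) - \<phi> y)) \<in> borel_measurable (facet_measure w l)"
      unfolding set_integrable_def by (rule borel_measurable_integrable)
    show "AE y in facet_measure w l. (\<integral>s. ?h (y + s *\<^sub>R e) \<partial>lborel) =
        indicator (facet w l) y *\<^sub>R (\<phi> (y + bary w m y *\<^sub>R e) - \<phi> y)"
      using AE_facet_measure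
    proof eventually_elim
      fix y assume y: "bary w l y = 0"
      have mem: "y + s *\<^sub>R e \<in> convex hull (range w) \<longleftrightarrow>
          0 \<le> s \<and> s \<le> bary w m y \<and> (\<forall>j. j \<noteq> l \<longrightarrow> j \<noteq> m \<longrightarrow> 0 \<le> bary w j y)" for s
      proof -
        have "(\<forall>j. 0 \<le> bary w j (y + s *\<^sub>R e)) \<longleftrightarrow> 0 \<le> bary w l (y + s *\<^sub>R e) \<and> 0 \<le> bary w m (y + s *\<^sub>R e) \<and>
           (\<forall>j. j \<noteq> l \<longrightarrow> j \<noteq> m \<longrightarrow> 0 \<le> bary w j (y + s *\<^sub>R e))" by metis
        then show ?thesis by (simp add: mem_simplex[OF nondeg] el em ej y)
      qed
      show "(\<integral>s. ?h (y + s *\<^sub>R e) \<partial>lborel) = indicator (facet w l) y *\<^sub>R (\<phi> (y + bary w m y *\<^sub>R e) - \<phi> y)"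
      proof (cases "y \<in> facet w l")
        case True
        then have pos: "0 \<le> bary w j y" for j by (simp add: mem_facet[OF nondeg])
        have "(\<integral>s. ?h (y + s *\<^sub>R e) \<partial>lborel) =
            (\<integral>s. indicator {0..bary w m y} s *\<^sub>R (g (y + s *\<^sub>R e) \<bullet> e) \<partial>lborel)"
          by (rule Bochner_Integration.integral_cong) (auto simp: indicator_def mem pos)
        also have "\<dots> = \<phi> (y + bary w m y *\<^sub>R e) - \<phi> (y + 0 *\<^sub>R e)"
        proof (rule integral_FTC_atLeastAtMost)
          show "0 \<le> bary w m y" by (rule pos)
          show "((\<lambda>s. \<phi> (y + s *\<^sub>R e)) has_vector_derivative g (y + s *\<^sub>R e) \<bullet> e) (at s within {0..bary w m y})" for s
          proof -
            have "((\<lambda>s. y + s *\<^sub>R e) has_derivative (\<lambda>s. s *\<^sub>R e)) (at s)"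
              by (auto intro!: derivative_eq_intros)
            from diff_chain_at[OF this GD[of "y + s *\<^sub>R e", unfolded gderiv_def]]
            have "((\<lambda>s. \<phi> (y + s *\<^sub>R e)) has_derivative (\<lambda>t. t *\<^sub>R (g (y + s *\<^sub>R e) \<bullet> e))) (at s)"
              by (simp add: o_def inner_commute)
            then show ?thesis
              unfolding has_vector_derivative_def by (rule has_derivative_at_withinI)
          qed
          show "continuous_on {0..bary w m y} (\<lambda>s. g (y + s *\<^sub>R e) \<bullet> e)"
            by (intro continuous_intros continuous_on_compose2[OF cont_g]) auto
        qed
        finally show ?thesis using True by simp
      next
        case False
        \<comment> \<open>If the line met the simplex, the fixed coordinates and that of
          \<open>m\<close> would be nonnegative at \<open>y\<close> already, so \<open>y\<close>
          would lie on the facet.\<close>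
        have "y + s *\<^sub>R e \<notin> convex hull (range w)" for s
        proof
          assume "y + s *\<^sub>R e \<in> convex hull (range w)"
          then have "0 \<le> bary w j y" for j
            unfolding mem using y by (cases "j = l"; cases "j = m") auto
          then show False using False y by (simp add: mem_facet[OF nondeg])
        qed
        then show ?thesis using False by simp
      qed
    qed
  qed
  finally show ?thesis by (simp only: set_lebesgue_integral_def)
qed

text \<open>Compares the measures of two facets under projection along their common edge. The
  function \<open>?h\<close> lives on an oblique prism which every line in direction
  \<open>e\<close> over the facet meets in a segment of parameter length one, and there it is
  constant. Slicing the same volume integral from either hyperplane gives the two sides.\<close>

lemma integral_facet_project:
  assumes lm: "l \<noteq> m" and e: "e = w l - w m"
  shows "\<bar>outward_normal w l \<bullet> e\<bar> * (LINT y:facet w l|facet_measure w l. \<phi> (y + bary w m y *\<^sub>R e)) =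
    \<bar>outward_normal w m \<bullet> e\<bar> * (LINT y:facet w m|facet_measure w m. \<phi> y)"
proof -
  have el: "bary w l (y + s *\<^sub>R e) = bary w l y + s" for y s
    using lm by (simp add: bary_add) (simp add: e bary_grad_edge[OF nondeg])
  have em: "bary w m (y + s *\<^sub>R e) = bary w m y - s" for y s
    using lm by (simp add: bary_add) (simp add: e bary_grad_edge[OF nondeg])
  have ej: "bary w j (y + s *\<^sub>R e) = bary w j y" if "j \<noteq> l" "j \<noteq> m" for y s j
    using that by (simp add: bary_add) (simp add: e bary_grad_edge[OF nondeg])
  let ?T = "\<lambda>x. x + bary w m x *\<^sub>R e"
  have T: "?T (y + s *\<^sub>R e) = ?T y" for y s
    by (simp add: em algebra_simps)
  \<comment> \<open>\<open>?T\<close> projects along \<open>e\<close> onto the hyperplane of facet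
    \<open>m\<close>; the bound on coordinate \<open>m\<close> cuts out a segment of length one,
    since this coordinate has slope -1 along \<open>e\<close>.\<close>
  define A where "A = {x. bary w m x \<in> {0..1} \<and> ?T x \<in> facet w m}"
  let ?h = "\<lambda>x. indicator A x *\<^sub>R \<phi> (?T x)"
  have cT: "continuous_on S ?T" for S
    by (intro continuous_intros)
  have "compact A"
  proof (rule compact_eq_bounded_closed[THEN iffD2], rule conjI)
    obtain B where B: "\<And>x. x \<in> facet w m \<Longrightarrow> norm x \<le> B"
      using compact_imp_bounded[OF compact_facet] by (meson bounded_iff)
    have "norm x \<le> B + norm e" if "x \<in> A" for x
    proof -
      have "norm x \<le> norm (?T x) + norm (bary w m x *\<^sub>R e)"
        by (metis add_diff_cancel norm_triangle_ineq4)
      also have "\<dots> \<le> B + 1 * norm e"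
        using that by (intro add_mono B) (auto simp: A_def intro!: mult_left_le_one_le)
      finally show ?thesis by simp
    qed
    then show "bounded A" by (auto simp: bounded_iff)
    have "closed ((bary w m -` {0..1}) \<inter> (?T -` facet w m))"
      using compact_imp_closed[OF compact_facet] cT[of UNIV]
      by (intro closed_Int closed_vimage continuous_intros) (auto simp: continuous_on_eq_continuous_at)
    then show "closed A"
      by (simp add: A_def vimage_def Int_def)
  qed
  then have h: "integrable lborel ?h"
    by (intro borel_integrable_compact continuous_on_compose2[OF GDERIV_continuous_on[OF GD] cT]) auto
  have ne: "outward_normal w l \<bullet> e \<noteq> 0" "outward_normal w m \<bullet> e \<noteq> 0"
    using lm bary_grad_nonzero[OF nondeg] by (simp_all add: e outward_normal_edge[OF nondeg])
  have int1: "(\<integral>s. indicator {0..1} (b - s) * c \<partial>lborel) = c" for b c :: real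
  proof -
    have "indicator {0..1} (b - s) = (indicator {b-1..b} s :: real)" for s
      by (auto simp: indicator_def)
    then show ?thesis by simp
  qed
  have inner: "(\<integral>s. ?h (y + s *\<^sub>R e) \<partial>lborel) = indicator (facet w m) (?T y) *\<^sub>R \<phi> (?T y)" for y
  proof -
    have A: "y + s *\<^sub>R e \<in> A \<longleftrightarrow> bary w m y - s \<in> {0..1} \<and> ?T y \<in> facet w m" for s
      unfolding A_def mem_Collect_eq T unfolding em ..
    have "?h (y + s *\<^sub>R e) = indicator {0..1} (bary w m y - s) * (indicator (facet w m) (?T y) *\<^sub>R \<phi> (?T y))" for s
      unfolding T indicator_def A by simp
    then show ?thesis by (simp only: int1)
  qed
  have meas: "(\<lambda>y. indicator (facet w m) (?T y) *\<^sub>R \<phi> (?T y)) \<in> borel_measurable borel"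
  proof -
    have [measurable]: "?T \<in> borel_measurable borel" "\<phi> \<in> borel_measurable borel"
      by (auto intro!: borel_measurable_continuous_onI cT GDERIV_continuous_on[OF GD])
    show ?thesis by measurable
  qed
  have "\<bar>outward_normal w l \<bullet> e\<bar> * (\<integral>y. (\<integral>s. ?h (y + s *\<^sub>R e) \<partial>lborel) \<partial>facet_measure w l) =
     \<bar>outward_normal w m \<bullet> e\<bar> * (\<integral>y. (\<integral>s. ?h (y + s *\<^sub>R e) \<partial>lborel) \<partial>facet_measure w m)"
    unfolding facet_measure_def
      integral_oblique[OF h norm_outward_normal[OF nondeg] ne(1), symmetric]
      integral_oblique[OF h norm_outward_normal[OF nondeg] ne(2), symmetric] ..
  moreover have "(\<integral>y. (\<integral>s. ?h (y + s *\<^sub>R e) \<partial>lborel) \<partial>facet_measure w l) =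
     (\<integral>y. indicator (facet w l) y *\<^sub>R \<phi> (?T y) \<partial>facet_measure w l)"
    unfolding inner
  proof (rule integral_cong_AE)
    show "(\<lambda>y. indicator (facet w m) (?T y) *\<^sub>R \<phi> (?T y)) \<in> borel_measurable (facet_measure w l)"
      using meas by (simp add: measurable_cong_sets[OF sets_facet_measure refl])
    have "continuous_on UNIV (\<lambda>y. \<phi> (?T y))"
      by (intro continuous_on_compose2[OF GDERIV_continuous_on[OF GD] cT]) auto
    from integrable_facet[OF this]
    show "(\<lambda>y. indicator (facet w l) y *\<^sub>R \<phi> (?T y)) \<in> borel_measurable (facet_measure w l)"
      unfolding set_integrable_def by (rule borel_measurable_integrable)
    show "AE y in facet_measure w l. indicator (facet w m) (?T y) *\<^sub>R \<phi> (?T y) = indicator (facet w l) y *\<^sub>R \<phi> (?T y)"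
      using AE_facet_measure
    proof eventually_elim
      fix y assume y: "bary w l y = 0"
      have "(\<forall>j. 0 \<le> bary w j (?T y)) \<longleftrightarrow> 0 \<le> bary w l (?T y) \<and> 0 \<le> bary w m (?T y) \<and>
          (\<forall>j. j \<noteq> l \<longrightarrow> j \<noteq> m \<longrightarrow> 0 \<le> bary w j (?T y))" by metis
      also have "\<dots> \<longleftrightarrow> 0 \<le> bary w m y \<and> (\<forall>j. j \<noteq> l \<longrightarrow> j \<noteq> m \<longrightarrow> 0 \<le> bary w j y)"
        by (simp add: el em ej y)
      also have "\<dots> \<longleftrightarrow> (\<forall>j. 0 \<le> bary w j y)"
        using y by (metis order_refl)
      finally have "?T y \<in> facet w m \<longleftrightarrow> y \<in> facet w l"
        by (simp add: mem_facet[OF nondeg] y em)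
      then show "indicator (facet w m) (?T y) *\<^sub>R \<phi> (?T y) = indicator (facet w l) y *\<^sub>R \<phi> (?T y)"
        by (simp add: indicator_def)
    qed
  qed
  moreover have "(\<integral>y. (\<integral>s. ?h (y + s *\<^sub>R e) \<partial>lborel) \<partial>facet_measure w m) =
     (\<integral>y. indicator (facet w m) y *\<^sub>R \<phi> y \<partial>facet_measure w m)"
    unfolding inner
  proof (rule integral_cong_AE)
    show "(\<lambda>y. indicator (facet w m) (?T y) *\<^sub>R \<phi> (?T y)) \<in> borel_measurable (facet_measure w m)"
      using meas by (simp add: measurable_cong_sets[OF sets_facet_measure refl])
    from integrable_facet[OF GDERIV_continuous_on[OF GD]]
    show "(\<lambda>y. indicator (facet w m) y *\<^sub>R \<phi> y) \<in> borel_measurable (facet_measure w m)"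
      unfolding set_integrable_def by (rule borel_measurable_integrable)
    show "AE y in facet_measure w m. indicator (facet w m) (?T y) *\<^sub>R \<phi> (?T y) = indicator (facet w m) y *\<^sub>R \<phi> y"
      using AE_facet_measure by eventually_elim simp
  qed
  ultimately show ?thesis by (simp only: set_lebesgue_integral_def)
qed

theorem integral_gradient_simplex:
  "(LINT x:convex hull (range w)|lborel. g x) =
    (\<Sum>l\<in>UNIV. (LINT y:facet w l|facet_measure w l. \<phi> y) *\<^sub>R outward_normal w l)"
proof -
  let ?V = "LINT x:convex hull (range w)|lborel. g x"
  let ?I = "\<lambda>l. LINT y:facet w l|facet_measure w l. \<phi> y"
  let ?\<nu> = "outward_normal w"
  have ig: "set_integrable lborel (convex hull (range w)) g"
    unfolding set_integrable_def
    by (intro borel_integrable_compact compact_simplex continuous_on_subset[OF cont_g]) auto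
  have "(?V - (\<Sum>l\<in>UNIV. ?I l *\<^sub>R ?\<nu> l)) \<bullet> (w (Some i) - w None) = 0" for i
  proof -
    let ?l = "Some i" and ?m = "None :: 'd option" and ?e = "w (Some i) - w None"
    have c: "continuous_on UNIV (\<lambda>y. \<phi> (y + bary w ?m y *\<^sub>R ?e))"
      by (intro continuous_intros continuous_on_compose2[OF GDERIV_continuous_on[OF GD]]) auto
    have "?V \<bullet> ?e = (LINT x:convex hull (range w)|lborel. g x \<bullet> ?e)"
      using ig integral_inner_left[of ?e lborel "\<lambda>x. indicator (convex hull range w) x *\<^sub>R g x"]
      by (simp add: set_lebesgue_integral_def set_integrable_def)
    also have "\<dots> = \<bar>?\<nu> ?l \<bullet> ?e\<bar> *
        (LINT y:facet w ?l|facet_measure w ?l. \<phi> (y + bary w ?m y *\<^sub>R ?e) - \<phi> y)"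
      by (rule integral_edge_derivative) auto
    also have "\<dots> = \<bar>?\<nu> ?l \<bullet> ?e\<bar> * (LINT y:facet w ?l|facet_measure w ?l. \<phi> (y + bary w ?m y *\<^sub>R ?e)) -
        \<bar>?\<nu> ?l \<bullet> ?e\<bar> * ?I ?l"
      by (subst set_integral_diff(2)[OF integrable_facet[OF c] integrable_facet[OF GDERIV_continuous_on[OF GD]]])
        (simp add: right_diff_distrib)
    also have "\<bar>?\<nu> ?l \<bullet> ?e\<bar> * (LINT y:facet w ?l|facet_measure w ?l. \<phi> (y + bary w ?m y *\<^sub>R ?e)) =
        \<bar>?\<nu> ?m \<bullet> ?e\<bar> * ?I ?m"
      by (rule integral_facet_project) auto
    \<comment> \<open>The edge points out of the simplex at facet \<open>?m\<close> and into it at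
      facet \<open>?l\<close>, which resolves the absolute values with opposite signs.\<close>
    also have "\<bar>?\<nu> ?m \<bullet> ?e\<bar> = ?\<nu> ?m \<bullet> ?e"
      by (simp add: outward_normal_edge[OF nondeg])
    also have "\<bar>?\<nu> ?l \<bullet> ?e\<bar> = - (?\<nu> ?l \<bullet> ?e)"
      by (simp add: outward_normal_edge[OF nondeg])
    finally have "?V \<bullet> ?e = ?I ?m * (?\<nu> ?m \<bullet> ?e) + ?I ?l * (?\<nu> ?l \<bullet> ?e)"
      by simp
    also have "\<dots> = (\<Sum>l\<in>UNIV. ?I l * (?\<nu> l \<bullet> ?e))"
    proof -
      have "(\<Sum>l\<in>UNIV. ?I l * (?\<nu> l \<bullet> ?e)) = (\<Sum>l\<in>{?m, ?l}. ?I l * (?\<nu> l \<bullet> ?e))"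
        by (rule sum.mono_neutral_right) (auto simp: outward_normal_edge[OF nondeg])
      then show ?thesis by simp
    qed
    also have "\<dots> = (\<Sum>l\<in>UNIV. ?I l *\<^sub>R ?\<nu> l) \<bullet> ?e"
      by (simp add: inner_sum_left)
    finally show ?thesis by (simp add: inner_diff_left)
  qed
  then have "?V - (\<Sum>l\<in>UNIV. ?I l *\<^sub>R ?\<nu> l) = 0"
    by (rule edges_span[OF nondeg])
  then show ?thesis by simp
qed

end

text \<open>A vector field is presented as a finite sum of scalar functions times constant vectors,
  so that its divergence is a sum of directional derivatives and the gradient theorem applies to
  each term.\<close>

corollary integral_divergence_simplex:
  fixes \<phi> :: "'i \<Rightarrow> real ^ 'd \<Rightarrow> real"
  assumes "finite I" and GD: "\<And>i x. i \<in> I \<Longrightarrow> GDERIV (\<phi> i) x :> g i x"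
    and cont: "\<And>i. i \<in> I \<Longrightarrow> continuous_on UNIV (g i)"
  shows "(LINT x:convex hull (range w)|lborel. \<Sum>i\<in>I. g i x \<bullet> e i) =
    (\<Sum>l\<in>UNIV. LINT y:facet w l|facet_measure w l. (\<Sum>i\<in>I. \<phi> i y *\<^sub>R e i) \<bullet> outward_normal w l)"
proof -
  let ?\<nu> = "outward_normal w"
  have ig: "set_integrable lborel (convex hull (range w)) (g i)" if "i \<in> I" for i
    unfolding set_integrable_def
    by (intro borel_integrable_compact compact_simplex continuous_on_subset[OF cont] that) auto
  have ige: "set_integrable lborel (convex hull (range w)) (\<lambda>x. g i x \<bullet> e i)" if "i \<in> I" for i
    using ig[OF that] unfolding set_integrable_def
    using integrable_inner_left[of "e i" lborel "\<lambda>x. indicator (convex hull range w) x *\<^sub>R g i x"] by simp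
  have ip: "set_integrable (facet_measure w l) (facet w l) (\<phi> i)" if "i \<in> I" for i l
    by (intro integrable_facet GDERIV_continuous_on[OF GD] that)
  have "(LINT x:convex hull (range w)|lborel. \<Sum>i\<in>I. g i x \<bullet> e i) =
      (\<Sum>i\<in>I. LINT x:convex hull (range w)|lborel. g i x \<bullet> e i)"
    unfolding set_lebesgue_integral_def scaleR_sum_right
    by (rule Bochner_Integration.integral_sum) (use ige in \<open>auto simp: set_integrable_def\<close>)
  also have "\<dots> = (\<Sum>i\<in>I. \<Sum>l\<in>UNIV. (LINT y:facet w l|facet_measure w l. \<phi> i y) * (?\<nu> l \<bullet> e i))"
  proof (rule sum.cong[OF refl])
    fix i assume i: "i \<in> I"
    have "(LINT x:convex hull (range w)|lborel. g i x \<bullet> e i) = (LINT x:convex hull (range w)|lborel. g i x) \<bullet> e i"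
      using ig[OF i] integral_inner_left[of "e i" lborel "\<lambda>x. indicator (convex hull range w) x *\<^sub>R g i x"]
      by (simp add: set_lebesgue_integral_def set_integrable_def)
    also have "\<dots> = (\<Sum>l\<in>UNIV. (LINT y:facet w l|facet_measure w l. \<phi> i y) *\<^sub>R ?\<nu> l) \<bullet> e i"
      by (subst integral_gradient_simplex[OF GD[OF i] cont[OF i]]) simp
    finally show "(LINT x:convex hull (range w)|lborel. g i x \<bullet> e i) =
        (\<Sum>l\<in>UNIV. (LINT y:facet w l|facet_measure w l. \<phi> i y) * (?\<nu> l \<bullet> e i))"
      by (simp add: inner_sum_left)
  qed
  also have "\<dots> = (\<Sum>l\<in>UNIV. \<Sum>i\<in>I. (LINT y:facet w l|facet_measure w l. \<phi> i y * (e i \<bullet> ?\<nu> l)))"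
    by (subst sum.swap) (simp add: inner_commute)
  also have "\<dots> = (\<Sum>l\<in>UNIV. LINT y:facet w l|facet_measure w l. \<Sum>i\<in>I. \<phi> i y * (e i \<bullet> ?\<nu> l))"
  proof (rule sum.cong[OF refl])
    fix l
    show "(\<Sum>i\<in>I. (LINT y:facet w l|facet_measure w l. \<phi> i y * (e i \<bullet> ?\<nu> l))) =
        (LINT y:facet w l|facet_measure w l. \<Sum>i\<in>I. \<phi> i y * (e i \<bullet> ?\<nu> l))"
      unfolding set_lebesgue_integral_def scaleR_sum_right
      by (rule Bochner_Integration.integral_sum[symmetric])
        (use ip in \<open>auto simp: set_integrable_def mult.assoc[symmetric]\<close>)
  qed
  finally show ?thesis by (simp add: inner_sum_left)
qed

end

section \<open>Matched facets\<close>

lemma continuous_on_det: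
  fixes A :: "'a::topological_space \<Rightarrow> real ^ 'n ^ 'n"
  assumes "\<And>i j. continuous_on T (\<lambda>t. A t $ i $ j)"
  shows "continuous_on T (\<lambda>t. det (A t))"
  unfolding det_def by (intro continuous_intros assms)

lemma continuous_on_edge_matrix:
  assumes "\<And>l. continuous_on T (\<lambda>t. w t l)"
  shows "continuous_on T (\<lambda>t. edge_matrix (w t) $ r $ i)"
  unfolding edge_matrix_def by (simp, intro continuous_intros assms)

text \<open>Cramer's rule exhibits a coordinate as a quotient of determinants, in which continuity
  in the vertices, and so in time, is visible.\<close>

lemma bary_Some_cramer:
  assumes "det (edge_matrix w) \<noteq> 0"
  shows "bary w (Some i) x =
    det (\<chi> r j. if j = i then (x - w None) $ r else edge_matrix w $ r $ j) / det (edge_matrix w)"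
proof -
  have "edge_matrix w *v (\<chi> i. bary w (Some i) x) = x - w None"
    using ref_map_bary[OF assms, of x] by (simp add: ref_map_def algebra_simps)
  then have "(\<chi> i. bary w (Some i) x) = (\<chi> k. det (\<chi> r j. if j = k then (x - w None) $ r else edge_matrix w $ r $ j) / det (edge_matrix w))"
    unfolding cramer[OF assms] .
  from arg_cong[OF this, of "\<lambda>v. v $ i"] show ?thesis by simp
qed

lemma continuous_on_bary_param:
  assumes w: "\<And>l. continuous_on T (\<lambda>t. w t l)" and x: "continuous_on T x"
    and nd: "\<And>t. t \<in> T \<Longrightarrow> det (edge_matrix (w t)) \<noteq> 0"
  shows "continuous_on T (\<lambda>t. bary (w t) l (x t))"
proof -
  have S: "continuous_on T (\<lambda>t. bary (w t) (Some i) (x t))" for i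
  proof -
    have "continuous_on T (\<lambda>t. det (\<chi> r j. if j = i then (x t - w t None) $ r else edge_matrix (w t) $ r $ j)
        / det (edge_matrix (w t)))"
    proof (intro continuous_on_divide continuous_on_det)
      fix r j
      show "continuous_on T (\<lambda>t. (\<chi> r j. if j = i then (x t - w t None) $ r else edge_matrix (w t) $ r $ j) $ r $ j)"
        by (cases "j = i") (auto intro!: continuous_intros w x continuous_on_edge_matrix)
    qed (use nd continuous_on_edge_matrix[OF w] in auto)
    then show ?thesis
      by (rule continuous_on_eq) (use nd in \<open>simp add: bary_Some_cramer\<close>)
  qed
  show ?thesis
  proof (cases l)
    case None
    have "bary (w t) None (x t) = 1 - (\<Sum>i\<in>UNIV. bary (w t) (Some i) (x t))" for t
      using sum_bary[of "w t" "x t"] by (simp add: sum_UNIV_option)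
    then show ?thesis unfolding None by (auto intro!: continuous_intros S)
  qed (simp add: S)
qed

lemma bary_affine_combination:
  assumes "finite A" "(\<Sum>j\<in>A. c j) = 1"
  shows "bary w l (\<Sum>j\<in>A. c j *\<^sub>R p j) = (\<Sum>j\<in>A. c j * bary w l (p j))"
proof -
  have "(\<Sum>j\<in>A. c j * bary w l (p j)) =
      (\<Sum>j\<in>A. c j) * ((if l = None then 1 else 0) - bary_grad w l \<bullet> w None) + (\<Sum>j\<in>A. c j * (bary_grad w l \<bullet> p j))"
    unfolding sum_distrib_right sum.distrib[symmetric]
    by (rule sum.cong) (auto simp: bary_def inner_simps algebra_simps)
  then show ?thesis
    by (simp add: assms bary_def inner_simps inner_sum_right)
qed

text \<open>
  The facet \<open>l\<close> of \<open>w\<close>, translated by \<open>s\<close>, is the facet \<open>l'\<close> of \<open>w'\<close>.  The opposite vertices \<open>w l\<close>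
  and \<open>w' l'\<close> are not related; \<open>\<rho> l = l'\<close> only makes \<open>\<rho>\<close> a bijection of all indices.
\<close>

locale matched_facets =
  fixes w w' :: "'d::finite option \<Rightarrow> real ^ 'd" and l l' :: "'d option" and s :: "real ^ 'd"
    and \<rho> :: "'d option \<Rightarrow> 'd option"
  assumes nd: "det (edge_matrix w) \<noteq> 0" and nd': "det (edge_matrix w') \<noteq> 0"
    and \<rho>: "bij \<rho>" "\<rho> l = l'" and match: "\<And>i. i \<noteq> l \<Longrightarrow> w' (\<rho> i) = w i + s"
begin

lemma \<rho>_cases:
  assumes "j \<noteq> l'"
  obtains i where "i \<noteq> l" "j = \<rho> i"
  using assms \<rho> by (metis bij_pointE)

text \<open>Both sides are affine in \<open>y\<close>, vanish at the vertices of the common facet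
  and agree at the opposite vertex of \<open>w'\<close>. The sign of the constant factor tells
  whether the simplices lie on the same side.\<close>

lemma bary_proportional: "bary w l (y - s) = bary w' l' y * bary w l (w' l' - s)"
proof -
  have "y - s = (\<Sum>j\<in>UNIV. bary w' j y *\<^sub>R (w' j - s))"
    by (simp add: scaleR_diff_right sum_subtractf sum_bary_scaleR[OF nd'] sum_bary
        flip: scaleR_sum_left)
  then have "bary w l (y - s) = (\<Sum>j\<in>UNIV. bary w' j y * bary w l (w' j - s))"
    by (simp only: bary_affine_combination[OF finite_class.finite_UNIV sum_bary])
  also have "\<dots> = (\<Sum>j\<in>{l'}. bary w' j y * bary w l (w' j - s))"
  proof (rule sum.mono_neutral_right)
    show "\<forall>j\<in>UNIV - {l'}. bary w' j y * bary w l (w' j - s) = 0"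
    proof
      fix j assume "j \<in> UNIV - {l'}"
      then obtain i where "i \<noteq> l" "j = \<rho> i" using \<rho>_cases by blast
      then show "bary w' j y * bary w l (w' j - s) = 0"
        by (simp add: match bary_vertex[OF nd])
    qed
  qed auto
  finally show ?thesis by simp
qed

lemma opposite_vertex_nonzero: "bary w l (w' l' - s) \<noteq> 0"
  using bary_proportional[of "w l + s"] by (auto simp: bary_vertex[OF nd])

text \<open>On the common hyperplane the opposite vertices carry weight zero, so both families of
  coordinates are weights on the same translated vertices.\<close>

lemma bary_match:
  assumes "bary w l x = 0"
  shows "bary w' (\<rho> i) (x + s) = bary w i x"
proof -
  have bij: "bij_betw \<rho> UNIV UNIV" using \<rho> by simp
  have "x + s = (\<Sum>i\<in>UNIV. bary w i x *\<^sub>R (w i + s))"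
    by (simp add: scaleR_add_right sum.distrib sum_bary_scaleR[OF nd] sum_bary
        flip: scaleR_sum_left)
  also have "\<dots> = (\<Sum>i\<in>UNIV. bary w i x *\<^sub>R w' (\<rho> i))"
    by (rule sum.cong) (use assms match in \<open>metis scale_eq_0_iff\<close>)+
  also have "\<dots> = (\<Sum>i\<in>UNIV. (\<lambda>j. bary w (inv \<rho> j) x *\<^sub>R w' j) (\<rho> i))"
    using \<rho>(1) by (simp add: bij_is_inj)
  also have "\<dots> = (\<Sum>j\<in>UNIV. bary w (inv \<rho> j) x *\<^sub>R w' j)"
    by (rule sum.reindex_bij_betw[OF bij])
  finally have eq: "x + s = (\<Sum>j\<in>UNIV. bary w (inv \<rho> j) x *\<^sub>R w' j)" .
  have "(\<Sum>j\<in>UNIV. bary w (inv \<rho> j) x) = (\<Sum>i\<in>UNIV. (\<lambda>j. bary w (inv \<rho> j) x) (\<rho> i))"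
    by (rule sum.reindex_bij_betw[OF bij, symmetric])
  also have "\<dots> = 1" using \<rho>(1) by (simp add: bij_is_inj sum_bary)
  finally have "(\<Sum>j\<in>UNIV. bary w (inv \<rho> j) x) = 1" .
  from bary_unique[OF nd' this, of "\<rho> i"] show ?thesis
    using \<rho>(1) by (simp add: eq bij_is_inj)
qed

lemma mem_facet_match: "x + s \<in> facet w' l' \<longleftrightarrow> x \<in> facet w l"
proof -
  have "bary w l x = 0 \<longleftrightarrow> bary w' l' (x + s) = 0"
    using bary_proportional[of "x + s"] opposite_vertex_nonzero by simp
  moreover have "(\<forall>j. 0 \<le> bary w' j (x + s)) \<longleftrightarrow> (\<forall>i. 0 \<le> bary w i x)" if "bary w l x = 0"
    using bary_match[OF that] \<rho>(1) by (metis bij_pointE)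
  ultimately show ?thesis by (auto simp: mem_facet[OF nd] mem_facet[OF nd'])
qed

lemma facet_center_match: "facet_center w' l' = facet_center w l + s"
proof -
  have im: "\<rho> ` (- {l}) = - {l'}"
    using \<rho> by (simp add: bij_image_Compl_eq)
  have inj: "inj_on \<rho> (- {l})"
    using \<rho>(1) by (meson bij_is_inj inj_on_subset subset_UNIV)
  have "(\<Sum>j\<in>- {l'}. w' j) = (\<Sum>i\<in>- {l}. w' (\<rho> i))"
    unfolding im[symmetric] by (simp add: sum.reindex[OF inj])
  also have "\<dots> = (\<Sum>i\<in>- {l}. w i) + real (card (- {l})) *\<^sub>R s"
    by (simp add: match sum.distrib sum_constant_scaleR del: sum_constant)
  also have "card (- {l}) = CARD('d)"
    by (simp add: Compl_eq_Diff_UNIV card_Diff_subset card_UNIV_option)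
  finally show ?thesis
    by (simp add: facet_center_def scaleR_add_right)
qed

text \<open>Translates the condition on normals in the periodic identification into a strict sign,
  the form which can be carried through time by continuity, and back again.\<close>

lemma outward_normal_match_iff:
  "outward_normal w' l' = - outward_normal w l \<longleftrightarrow> bary w l (w' l' - s) < 0"
proof -
  let ?g = "bary_grad w l"
  have ng: "0 < norm ?g" using bary_grad_nonzero[OF nd] by simp
  have eq: "(- outward_normal w l) \<bullet> (w' l' - w' (\<rho> i)) = bary w l (w' l' - s) / norm ?g" if "i \<noteq> l" for i
  proof -
    have "bary w l (w' l' - s) = bary w l (w' l' - s) - bary w l (w i)"
      using that by (simp add: bary_vertex[OF nd])
    also have "\<dots> = ?g \<bullet> (w' l' - w' (\<rho> i))"
      using that by (simp add: bary_diff match algebra_simps)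
    finally show ?thesis by (simp add: outward_normal_eq[OF nd])
  qed
  show ?thesis
  proof
    assume "outward_normal w' l' = - outward_normal w l"
    moreover obtain i where i: "i \<noteq> l" by (metis (full_types) option.distinct(1))
    moreover have "\<rho> i \<noteq> l'" using \<rho> i by (metis bij_pointE)
    then have "outward_normal w' l' \<bullet> (w' l' - w' (\<rho> i)) < 0"
      using bary_grad_nonzero[OF nd', of l'] by (auto simp: outward_normal_edge[OF nd'])
    ultimately have "bary w l (w' l' - s) / norm ?g < 0"
      using eq[OF i] by simp
    then show "bary w l (w' l' - s) < 0"
      using ng by (simp add: divide_less_0_iff)
  next
    assume neg: "bary w l (w' l' - s) < 0"
    have "- outward_normal w l = (- 1 / norm (bary_grad w' l')) *\<^sub>R bary_grad w' l'"
    proof (rule outward_normal_unique[OF nd'])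
      show "norm (- outward_normal w l) = 1"
        by (simp add: norm_outward_normal[OF nd])
      show "(- outward_normal w l) \<bullet> (w' i - w' j) = 0" if ij: "i \<noteq> l'" "j \<noteq> l'" for i j
      proof -
        obtain i' j' where "i' \<noteq> l" "i = \<rho> i'" "j' \<noteq> l" "j = \<rho> j'" using \<rho>_cases ij by metis
        then have "w' i - w' j = w i' - w j'" by (simp add: match)
        then show ?thesis using \<open>i' \<noteq> l\<close> \<open>j' \<noteq> l\<close> by (simp add: outward_normal_edge[OF nd])
      qed
      show "(- outward_normal w l) \<bullet> (w' l' - w' i) < 0" if "i \<noteq> l'" for i
      proof -
        obtain i' where "i' \<noteq> l" "i = \<rho> i'" using \<rho>_cases[OF \<open>i \<noteq> l'\<close>] by blast
        have "bary w l (w' l' - s) / norm ?g < 0" using neg ng by (rule divide_neg_pos)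
        then show ?thesis unfolding \<open>i = \<rho> i'\<close> eq[OF \<open>i' \<noteq> l\<close>] .
      qed
    qed
    then show "outward_normal w' l' = - outward_normal w l"
      by (simp add: outward_normal_eq[OF nd'])
  qed
qed

lemma facet_measure_match:
  assumes "bary w l (w' l' - s) < 0"
  shows "facet_measure w' l' = distr (facet_measure w l) borel (\<lambda>x. x + s)"
  unfolding facet_measure_def facet_center_match assms[folded outward_normal_match_iff]
  by (rule hyperplane_measure_uminus_translate[OF norm_outward_normal[OF nd]])

lemma indicator_facet_match: "indicator (facet w' l') (x + s) = indicator (facet w l) x"
  by (simp add: indicator_def mem_facet_match)

lemma
  fixes h :: "real ^ 'd \<Rightarrow> real"
  assumes "bary w l (w' l' - s) < 0" and h: "set_integrable (facet_measure w' l') (facet w' l') h"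
  shows set_integrable_match: "set_integrable (facet_measure w l) (facet w l) (\<lambda>x. h (x + s))"
    and set_integral_match: "(LINT y:facet w' l'|facet_measure w' l'. h y) =
      (LINT x:facet w l|facet_measure w l. h (x + s))"
proof -
  let ?k = "\<lambda>y. indicator (facet w' l') y *\<^sub>R h y"
  have k: "?k \<in> borel_measurable borel"
    using borel_measurable_integrable[OF h[unfolded set_integrable_def]]
    by (simp add: measurable_cong_sets[OF sets_facet_measure refl])
  have T: "(\<lambda>x. x + s) \<in> measurable (facet_measure w l) borel"
    by (simp add: measurable_cong_sets[OF sets_facet_measure refl])
  show "set_integrable (facet_measure w l) (facet w l) (\<lambda>x. h (x + s))"
    using h unfolding set_integrable_def facet_measure_match[OF assms(1)] integrable_distr_eq[OF T k]
    by (simp add: indicator_facet_match)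
  show "(LINT y:facet w' l'|facet_measure w' l'. h y) = (LINT x:facet w l|facet_measure w l. h (x + s))"
    unfolding set_lebesgue_integral_def facet_measure_match[OF assms(1)] integral_distr[OF T k]
    by (simp add: indicator_facet_match)
qed

end

section \<open>On which side of a common facet a cell lies\<close>

lemma matched_side_constant:
  fixes a b t :: real
  assumes M: "\<And>t. t \<in> {a..b} \<Longrightarrow> matched_facets (w t) (w' t) l l' s \<rho>"
    and cont: "\<And>l. continuous_on {a..b} (\<lambda>t. w t l)" "\<And>l. continuous_on {a..b} (\<lambda>t. w' t l)"
    and neg: "bary (w a) l (w' a l' - s) < 0" and t: "t \<in> {a..b}"
  shows "bary (w t) l (w' t l' - s) < 0"
proof (rule ccontr)
  let ?f = "\<lambda>t. bary (w t) l (w' t l' - s)"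
  assume "\<not> ?f t < 0"
  moreover have "continuous_on {a..b} ?f"
    by (intro continuous_on_bary_param cont continuous_intros)
      (use M matched_facets.nd in blast)
  then have "continuous_on {a..t} ?f"
    by (rule continuous_on_subset) (use t in simp)
  ultimately obtain r where "a \<le> r" "r \<le> t" "?f r = 0"
    using IVT'[of ?f a 0 t] neg t by fastforce
  then show False
    using matched_facets.opposite_vertex_nonzero[OF M[of r]] t by auto
qed

text \<open>Two simplices meet in a common face, and a face containing an interior point is the
  whole simplex.\<close>

lemma interior_disjoint_triangulation:
  assumes "triangulation \<T>" "S \<in> \<T>" "S' \<in> \<T>" "S \<noteq> S'"
  shows "interior S \<inter> interior S' = {}"
proof (rule ccontr)
  assume "interior S \<inter> interior S' \<noteq> {}"
  then obtain x where x: "x \<in> interior S" "x \<in> interior S'" by blast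
  then have xx: "x \<in> S \<inter> S'" using interior_subset by blast
  have "(S \<inter> S') face_of S" "(S' \<inter> S) face_of S'"
    using assms by (auto simp: triangulation_def)
  then have "S \<inter> S' = S" "S' \<inter> S = S'"
    using face_of_disjoint_interior x xx by blast+
  then show False using assms(4) by auto
qed

text \<open>If both simplices were on the same side, a short step from the centre of the common
  facet towards \<open>w' l'\<close> would lead into the interior of both.\<close>

lemma (in matched_facets) opposite_side:
  assumes disj: "cell_of w \<inter> cell_of w' = {}" and s: "s = 0"
  shows "bary w l (w' l' - s) < 0"
proof (rule ccontr)
  assume "\<not> bary w l (w' l' - s) < 0"
  with opposite_vertex_nonzero s have pos: "0 < bary w l (w' l')"
    by (simp add: less_le)
  define d where "d = real CARD('d)"
  have d: "0 < d" by (simp add: d_def)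
  define c where "c = facet_center w l"
  have cc: "bary w i c = (if i = l then 0 else 1 / d)" for i
  proof -
    have "(\<Sum>i\<in>- {l}. (1 / d) *\<^sub>R w i) = (\<Sum>i\<in>UNIV. (if i = l then 0 else 1 / d) *\<^sub>R w i)"
      by (simp add: if_distrib[of "\<lambda>c. c *\<^sub>R _"] sum.If_cases Compl_eq cong: if_cong)
    then have "c = (\<Sum>i\<in>UNIV. (if i = l then 0 else 1 / d) *\<^sub>R w i)"
      by (simp add: c_def facet_center_def scaleR_sum_right d_def)
    moreover have "card (- {l}) = CARD('d)"
      by (simp add: Compl_eq_Diff_UNIV card_Diff_subset card_UNIV_option)
    then have "(\<Sum>i\<in>UNIV. (if i = l then 0 else 1 / d)) = 1"
      by (simp add: sum.If_cases Compl_eq d_def)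
    ultimately show ?thesis
      using bary_unique[OF nd, of "\<lambda>i. if i = l then 0 else 1 / d" i] by simp
  qed
  have cc': "bary w' (\<rho> i) c = (if i = l then 0 else 1 / d)" for i
    using bary_match[of c i] cc s by simp
  define y where "y \<epsilon> = c + \<epsilon> *\<^sub>R (w' l' - c)" for \<epsilon> :: real
  have by1: "bary w i (y \<epsilon>) = bary w i c + \<epsilon> * (bary w i (w' l') - bary w i c)" for i \<epsilon>
    by (simp add: y_def bary_add bary_diff)
  have by2: "bary w' i (y \<epsilon>) = bary w' i c + \<epsilon> * (bary w' i (w' l') - bary w' i c)" for i \<epsilon>
    by (simp add: y_def bary_add bary_diff)
  \<comment> \<open>Coordinate \<open>l\<close> starts at 0 with the positive rate
    \<open>bary w l (w' l')\<close>; every other coordinate starts at \<open>1 / d\<close> and stays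
    positive for small \<open>\<epsilon>\<close>.\<close>
  have "\<forall>\<^sub>F \<epsilon> in at_right 0. 0 < bary w i (y \<epsilon>)" for i
  proof (cases "i = l")
    case True
    have "\<forall>\<^sub>F \<epsilon> in at_right (0::real). 0 < \<epsilon>" by (rule eventually_at_right_less)
    then show ?thesis by eventually_elim (use pos True in \<open>simp add: by1 cc\<close>)
  next
    case False
    have "((\<lambda>\<epsilon>. bary w i (y \<epsilon>)) \<longlongrightarrow> bary w i c + 0 * (bary w i (w' l') - bary w i c)) (at_right 0)"
      unfolding by1 by (intro tendsto_intros)
    then show ?thesis
      by (rule order_tendstoD(1)) (use False d in \<open>simp add: cc\<close>)
  qed
  then have "\<forall>\<^sub>F \<epsilon> in at_right 0. \<forall>i. 0 < bary w i (y \<epsilon>)"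
    by (rule eventually_all_finite)
  moreover have "\<forall>\<^sub>F \<epsilon> in at_right (0::real). 0 < \<epsilon> \<and> \<epsilon> < 1"
    by (intro eventually_conj eventually_at_right_less) (simp add: eventually_at_right_field, use zero_less_one in blast)
  ultimately have "\<forall>\<^sub>F \<epsilon> in at_right (0::real). (\<forall>i. 0 < bary w i (y \<epsilon>)) \<and> 0 < \<epsilon> \<and> \<epsilon> < 1"
    by (rule eventually_conj)
  then obtain \<epsilon> where \<epsilon>: "\<forall>i. 0 < bary w i (y \<epsilon>)" "0 < \<epsilon>" "\<epsilon> < 1"
    using eventually_happens trivial_limit_at_right_real by blast
  have "0 < bary w' (\<rho> i) (y \<epsilon>)" for i
  proof (cases "i = l")
    case True
    then show ?thesis using \<epsilon> \<rho> cc'[of l] by (simp add: by2 bary_vertex[OF nd'])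
  next
    case False
    then have "\<rho> i \<noteq> l'" using \<rho> by (metis bij_pointE)
    then show ?thesis using \<epsilon> False d cc'[of i] by (simp add: by2 bary_vertex[OF nd'] divide_strict_right_mono)
  qed
  moreover have "\<exists>i. j = \<rho> i" for j
    using \<rho>(1) bij_is_surj surjD by metis
  ultimately have "0 < bary w' j (y \<epsilon>)" for j
    by metis
  then have "y \<epsilon> \<in> cell_of w \<inter> cell_of w'"
    using \<epsilon> by (simp add: cell_of_bary[OF nd] cell_of_bary[OF nd'])
  then show False using disj by blast
qed

section \<open>Pairing of the faces of a periodic moving mesh\<close>

text \<open>Converts a bijection between the nodes of two faces into a permutation of vertex
  numbers. It serves shared interior faces, with the identity for \<open>\<sigma>\<close>, as well
  as identified boundary faces.\<close>

lemma extend_matching: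
  fixes f :: "'i \<Rightarrow> 'a" and g :: "'i \<Rightarrow> 'b"
  assumes f: "inj f" and g: "inj g" and \<sigma>: "bij_betw \<sigma> (f ` (- {l})) (g ` (- {l'}))"
  shows "\<exists>\<rho>. bij \<rho> \<and> \<rho> l = l' \<and> (\<forall>i. i \<noteq> l \<longrightarrow> g (\<rho> i) = \<sigma> (f i))"
proof -
  define \<rho> where "\<rho> i = (if i = l then l' else inv_into (- {l'}) g (\<sigma> (f i)))" for i
  have "bij_betw f (- {l}) (f ` (- {l}))"
    using f by (auto simp: bij_betw_def inj_on_def)
  moreover have "bij_betw g (- {l'}) (g ` (- {l'}))"
    using g by (auto simp: bij_betw_def inj_on_def)
  then have g': "bij_betw (inv_into (- {l'}) g) (g ` (- {l'})) (- {l'})"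
    by (rule bij_betw_inv_into)
  ultimately have "bij_betw (inv_into (- {l'}) g \<circ> (\<sigma> \<circ> f)) (- {l}) (- {l'})"
    using \<sigma> by (meson bij_betw_trans)
  then have "bij_betw \<rho> (- {l}) (- {l'})"
    by (rule bij_betw_cong[THEN iffD1, rotated]) (simp add: \<rho>_def)
  moreover have "bij_betw \<rho> {l} {l'}"
    by (simp add: \<rho>_def bij_betw_def)
  ultimately have "bij_betw \<rho> (- {l} \<union> {l}) (- {l'} \<union> {l'})"
    by (rule bij_betw_combine) auto
  then have "bij \<rho>" by (simp add: Un_commute)
  moreover have "g (\<rho> i) = \<sigma> (f i)" if "i \<noteq> l" for i
  proof -
    have "\<sigma> (f i) \<in> g ` (- {l'})"
      using \<sigma> that by (auto simp: bij_betw_def)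
    then show ?thesis using that by (simp add: \<rho>_def f_inv_into_f)
  qed
  ultimately show ?thesis by (intro exI[of _ \<rho>]) (simp add: \<rho>_def)
qed

definition node_velocity :: "('d::finite, 'c, 'v) mesh \<Rightarrow> nat \<Rightarrow> 'v \<Rightarrow> real ^ 'd" where
  "node_velocity M n a =
     (1 / (time_level M (Suc n) - time_level M n)) *\<^sub>R (node_at M (Suc n) a - node_at M n a)"

definition vertex_velocity :: "('d::finite, 'c, 'v) mesh \<Rightarrow> nat \<Rightarrow> 'c \<Rightarrow> 'd option \<Rightarrow> real ^ 'd" where
  "vertex_velocity M n c l = node_velocity M n (cell_node M c l)"

lemma vertices_eq:
  "vertices M n t c l = level_vertices M n c l + (t - time_level M n) *\<^sub>R vertex_velocity M n c l"
  by (simp add: vertices_def node_pos_def level_vertices_def vertex_velocity_def node_velocity_def)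

lemma continuous_on_vertices: "continuous_on T (\<lambda>t. vertices M n t c l)"
  unfolding vertices_eq by (intro continuous_intros)

locale periodic_mesh =
  fixes \<Omega> :: "(real ^ 'd::finite) set" and M :: "('d, 'c, 'v) mesh"
    and partner :: "'c \<times> 'd option \<Rightarrow> 'c \<times> 'd option" and shift :: "'c \<times> 'd option \<Rightarrow> real ^ 'd"
  assumes open_\<Omega>: "open \<Omega>" and convex_\<Omega>: "convex \<Omega>"
    and moving: "moving_mesh \<Omega> M" and periodic: "periodic_identification M partner shift"
begin

lemma time_level_less: "n < num_steps M \<Longrightarrow> time_level M n < time_level M (Suc n)"
  using moving by (simp add: moving_mesh_def)

lemma finite_cells: "finite (cells M)"
  using moving by (simp add: moving_mesh_def)

lemma inj_cell_node: "c \<in> cells M \<Longrightarrow> inj (cell_node M c)"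
  using moving by (simp add: moving_mesh_def)

lemma conforming: "n \<le> num_steps M \<Longrightarrow> conforming_mesh_at \<Omega> M n"
  using moving by (simp add: moving_mesh_def)

lemma nondeg_level: "n \<le> num_steps M \<Longrightarrow> c \<in> cells M \<Longrightarrow> det (edge_matrix (level_vertices M n c)) \<noteq> 0"
  using conforming by (force simp: conforming_mesh_at_def)

lemma jacobian_pos: "n < num_steps M \<Longrightarrow> t \<in> time_slab M n \<Longrightarrow> c \<in> cells M \<Longrightarrow> 0 < jacobian M n t c"
  using moving by (simp add: moving_mesh_def)

lemma nondeg: "n < num_steps M \<Longrightarrow> t \<in> time_slab M n \<Longrightarrow> c \<in> cells M \<Longrightarrow>
    det (edge_matrix (vertices M n t c)) \<noteq> 0"
  using jacobian_pos[of n t c] by (simp add: jacobian_def)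

lemma vertices_level: "vertices M n (time_level M n) c = level_vertices M n c"
  by (rule ext) (simp add: vertices_eq)

lemma vertices_next_level:
  assumes "n < num_steps M"
  shows "vertices M n (time_level M (Suc n)) c = level_vertices M (Suc n) c"
  using time_level_less[OF assms]
  by (intro ext) (simp add: vertices_def node_pos_def level_vertices_def)

lemma level_in_slab: "n < num_steps M \<Longrightarrow> time_level M n \<in> time_slab M n"
  "n < num_steps M \<Longrightarrow> time_level M (Suc n) \<in> time_slab M n"
  using time_level_less[of n] by (simp_all add: time_slab_def)

lemma level_cells_disjoint:
  assumes n: "n \<le> num_steps M" and c: "c \<in> cells M" "c' \<in> cells M" "c \<noteq> c'"
  shows "cell_of (level_vertices M n c) \<inter> cell_of (level_vertices M n c') = {}"
proof -
  let ?S = "\<lambda>c. convex hull (range (level_vertices M n c))"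
  have "inj_on ?S (cells M)" "triangulation (?S ` cells M)"
    using conforming[OF n] by (simp_all add: conforming_mesh_at_def)
  then show ?thesis
    unfolding cell_of_def using c
    by (intro interior_disjoint_triangulation[of "?S ` cells M"]) (auto dest: inj_onD)
qed

text \<open>One relation for interior faces, with \<open>s = 0\<close>, and for periodic ones. A
  single \<open>\<rho>\<close> must work at all time levels, which makes matching vertices move
  alike; the last clause says that the cells lie on opposite sides of the face.\<close>

definition paired :: "'c \<times> 'd option \<Rightarrow> 'c \<times> 'd option \<Rightarrow> real ^ 'd \<Rightarrow> bool" where
  "paired F G s \<longleftrightarrow> (\<exists>\<rho>. bij \<rho> \<and> \<rho> (snd F) = snd G \<and>
     (\<forall>i. i \<noteq> snd F \<longrightarrow> (\<forall>n\<le>num_steps M.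
        node_at M n (cell_node M (fst G) (\<rho> i)) = node_at M n (cell_node M (fst F) i) + s)) \<and>
     (\<forall>n\<le>num_steps M. bary (level_vertices M n (fst F)) (snd F) (level_vertices M n (fst G) (snd G) - s) < 0))"

lemma matched_level:
  assumes n: "n \<le> num_steps M" and FG: "F \<in> faces M" "G \<in> faces M"
    and \<rho>: "bij \<rho>" "\<rho> (snd F) = snd G"
    "\<And>i. i \<noteq> snd F \<Longrightarrow> node_at M n (cell_node M (fst G) (\<rho> i)) = node_at M n (cell_node M (fst F) i) + s"
  shows "matched_facets (level_vertices M n (fst F)) (level_vertices M n (fst G)) (snd F) (snd G) s \<rho>"
proof
  show "det (edge_matrix (level_vertices M n (fst F))) \<noteq> 0" "det (edge_matrix (level_vertices M n (fst G))) \<noteq> 0"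
    using FG nondeg_level[OF n] by (auto simp: faces_def)
qed (use \<rho> in \<open>simp_all add: level_vertices_def\<close>)

text \<open>The two faces belong to different cells, and these are disjoint at the time levels
  because the mesh is a triangulation there; this puts them on opposite sides.\<close>

lemma paired_interior:
  assumes FG: "F \<in> faces M" "G \<in> faces M" and ne: "F \<noteq> G" and nodes: "face_nodes M G = face_nodes M F"
  shows "paired F G 0"
proof -
  have cells: "fst F \<in> cells M" "fst G \<in> cells M" using FG by (auto simp: faces_def)
  have "fst F \<noteq> fst G"
  proof
    assume eq: "fst F = fst G"
    \<comment> \<open>The nodes of a cell are distinct, so different facets of one cell have
      different node sets.\<close>
    then have "- {snd G} = - {snd F}"
      using nodes inj_image_eq_iff[OF inj_cell_node[OF cells(1)]] by (simp add: face_nodes_def)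
    then have "snd G = snd F" by blast
    with eq ne show False by (simp add: prod_eq_iff)
  qed
  obtain \<rho> where \<rho>: "bij \<rho>" "\<rho> (snd F) = snd G"
    "\<And>i. i \<noteq> snd F \<Longrightarrow> cell_node M (fst G) (\<rho> i) = cell_node M (fst F) i"
    using extend_matching[OF inj_cell_node[OF cells(1)] inj_cell_node[OF cells(2)], of "\<lambda>x. x" "snd F" "snd G"] nodes
    by (auto simp: face_nodes_def bij_betw_def)
  show ?thesis
    unfolding paired_def
  proof (intro exI[of _ \<rho>] conjI allI impI)
    fix n assume n: "n \<le> num_steps M"
    interpret matched_facets "level_vertices M n (fst F)" "level_vertices M n (fst G)" "snd F" "snd G" 0 \<rho>
      by (rule matched_level[OF n FG]) (use \<rho> in auto)
    show "bary (level_vertices M n (fst F)) (snd F) (level_vertices M n (fst G) (snd G) - 0) < 0"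
      by (rule opposite_side[OF level_cells_disjoint[OF n cells \<open>fst F \<noteq> fst G\<close>] refl])
  qed (use \<rho> in auto)
qed

lemma boundary_face: "F \<in> boundary_faces M \<Longrightarrow> F \<in> faces M"
  by (simp add: boundary_faces_def)

lemma
  assumes "F \<in> boundary_faces M"
  shows partner_boundary: "partner F \<in> boundary_faces M"
    and partner_partner: "partner (partner F) = F"
  using periodic assms by (simp_all add: periodic_identification_def)

lemma paired_boundary:
  assumes F: "F \<in> boundary_faces M"
  shows "paired F (partner F) (shift F)"
proof -
  have FG: "F \<in> faces M" "partner F \<in> faces M"
    using F partner_boundary boundary_face by blast+
  then have cells: "fst F \<in> cells M" "fst (partner F) \<in> cells M" by (auto simp: faces_def)
  obtain \<sigma> where \<sigma>: "bij_betw \<sigma> (face_nodes M F) (face_nodes M (partner F))"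
    "\<And>n a. n \<le> num_steps M \<Longrightarrow> a \<in> face_nodes M F \<Longrightarrow> node_at M n (\<sigma> a) = node_at M n a + shift F"
    using periodic F unfolding periodic_identification_def by meson
  obtain \<rho> where \<rho>: "bij \<rho>" "\<rho> (snd F) = snd (partner F)"
    "\<And>i. i \<noteq> snd F \<Longrightarrow> cell_node M (fst (partner F)) (\<rho> i) = \<sigma> (cell_node M (fst F) i)"
    using extend_matching[OF inj_cell_node[OF cells(1)] inj_cell_node[OF cells(2)], of \<sigma> "snd F" "snd (partner F)"] \<sigma>(1)
    by (auto simp: face_nodes_def)
  have node: "node_at M n (cell_node M (fst (partner F)) (\<rho> i)) = node_at M n (cell_node M (fst F) i) + shift F"
    if "i \<noteq> snd F" "n \<le> num_steps M" for i n
    using that by (simp add: \<rho> \<sigma>(2) face_nodes_def)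
  show ?thesis
    unfolding paired_def
  proof (intro exI[of _ \<rho>] conjI allI impI)
    fix n assume n: "n \<le> num_steps M"
    interpret matched_facets "level_vertices M n (fst F)" "level_vertices M n (fst (partner F))"
      "snd F" "snd (partner F)" "shift F" \<rho>
      by (rule matched_level[OF n FG]) (use \<rho> node n in auto)
    show "bary (level_vertices M n (fst F)) (snd F)
        (level_vertices M n (fst (partner F)) (snd (partner F)) - shift F) < 0"
      using periodic F n by (simp add: periodic_identification_def flip: outward_normal_match_iff)
  qed (use \<rho> node in auto)
qed

text \<open>Refines \<open>neighbour\<close>, which records only the adjacent cell: the facet number
  is needed too in order to pair faces.\<close>

definition nbr :: "'c \<times> 'd option \<Rightarrow> 'c \<times> 'd option" where
  "nbr F = (if F \<in> boundary_faces M then partner F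
     else (THE G. G \<in> faces M \<and> G \<noteq> F \<and> face_nodes M G = face_nodes M F))"

definition offset :: "'c \<times> 'd option \<Rightarrow> real ^ 'd" where
  "offset F = (if F \<in> boundary_faces M then shift F else 0)"

lemma neighbour_eq: "neighbour M partner F = fst (nbr F)"
  by (simp add: neighbour_def nbr_def)

text \<open>Among three cells sharing a facet, two would lie on the same side of it.\<close>

lemma interior_nbr_unique:
  assumes F: "F \<in> faces M" "F \<notin> boundary_faces M"
  shows "\<exists>!G. G \<in> faces M \<and> G \<noteq> F \<and> face_nodes M G = face_nodes M F"
proof -
  obtain G where G: "G \<in> faces M" "G \<noteq> F" "face_nodes M G = face_nodes M F"
    using F by (auto simp: boundary_faces_def)
  have "H = G" if H: "H \<in> faces M" "H \<noteq> F" "face_nodes M H = face_nodes M F" for H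
  proof (rule ccontr)
    assume "H \<noteq> G"
    let ?w = "\<lambda>F. level_vertices M 0 (fst F)"
    have FG: "paired F G 0" and FH: "paired F H 0" and GH: "paired G H 0"
      using F G H \<open>H \<noteq> G\<close> by (auto intro!: paired_interior)
    obtain \<rho> where \<rho>: "bij \<rho>" "\<rho> (snd F) = snd G"
     "\<And>i. i \<noteq> snd F \<Longrightarrow> node_at M 0 (cell_node M (fst G) (\<rho> i)) = node_at M 0 (cell_node M (fst F) i) + 0"
      using FG by (auto simp: paired_def)
    interpret matched_facets "?w F" "?w G" "snd F" "snd G" 0 \<rho>
      by (rule matched_level[OF le0 F(1) G(1) \<rho>])
    \<comment> \<open>By proportionality the left side is a product of two negative numbers, yet it
      is negative itself.\<close>
    have "bary (?w F) (snd F) (?w H (snd H)) =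
        bary (?w G) (snd G) (?w H (snd H)) * bary (?w F) (snd F) (?w G (snd G))"
      using bary_proportional[of "?w H (snd H)"] by simp
    moreover have "bary (?w F) (snd F) (?w H (snd H)) < 0" "bary (?w G) (snd G) (?w H (snd H)) < 0"
      "bary (?w F) (snd F) (?w G (snd G)) < 0"
      using FG FH GH by (auto simp: paired_def)
    ultimately show False by (metis mult_neg_neg not_less_iff_gr_or_eq)
  qed
  with G show ?thesis by blast
qed

lemma nbr_interior:
  assumes F: "F \<in> faces M" "F \<notin> boundary_faces M"
  shows "nbr F \<in> faces M" "nbr F \<noteq> F" "face_nodes M (nbr F) = face_nodes M F"
  using theI'[OF interior_nbr_unique[OF assms]] F by (simp_all add: nbr_def)

lemma nbr_boundary_iff:
  assumes F: "F \<in> faces M"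
  shows "nbr F \<in> boundary_faces M \<longleftrightarrow> F \<in> boundary_faces M"
proof (cases "F \<in> boundary_faces M")
  case True
  then show ?thesis by (simp add: nbr_def partner_boundary)
next
  case False
  then show ?thesis
    using nbr_interior[OF F False] F unfolding boundary_faces_def by auto
qed

lemma nbr_faces: "F \<in> faces M \<Longrightarrow> nbr F \<in> faces M"
  by (metis boundary_face nbr_boundary_iff nbr_interior(1))

lemma nbr_nbr:
  assumes F: "F \<in> faces M"
  shows "nbr (nbr F) = F"
proof (cases "F \<in> boundary_faces M")
  case True
  then show ?thesis by (simp add: nbr_def partner_boundary partner_partner)
next
  case False
  then have "nbr F \<notin> boundary_faces M" using F nbr_boundary_iff by blast
  from interior_nbr_unique[OF nbr_faces[OF F] this] nbr_interior[OF nbr_faces[OF F] this]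
    nbr_interior[OF F False] F
  show ?thesis by metis
qed

lemma paired_nbr:
  assumes F: "F \<in> faces M"
  shows "paired F (nbr F) (offset F)"
proof (cases "F \<in> boundary_faces M")
  case True
  then show ?thesis using paired_boundary by (simp add: nbr_def offset_def)
next
  case False
  then show ?thesis
    using nbr_interior[OF F False] F by (simp add: offset_def paired_interior)
qed

text \<open>The identification does not state that the two shifts of a pair are opposite. This
  follows by comparing facet centres, since passing to the neighbour twice returns to the original
  face.\<close>

lemma offset_nbr:
  assumes F: "F \<in> faces M"
  shows "offset (nbr F) = - offset F"
proof -
  have c: "facet_center (level_vertices M 0 (fst (nbr F))) (snd (nbr F)) =
      facet_center (level_vertices M 0 (fst F)) (snd F) + offset F" if F: "F \<in> faces M" for F
  proof -
    obtain \<rho> where \<rho>: "bij \<rho>" "\<rho> (snd F) = snd (nbr F)"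
     "\<And>i. i \<noteq> snd F \<Longrightarrow> node_at M 0 (cell_node M (fst (nbr F)) (\<rho> i)) = node_at M 0 (cell_node M (fst F) i) + offset F"
      using paired_nbr[OF F] by (auto simp: paired_def)
    show ?thesis
      by (rule matched_facets.facet_center_match[OF matched_level[OF le0 F nbr_faces[OF F] \<rho>]])
  qed
  from c[OF F] c[OF nbr_faces[OF F]] show ?thesis
    by (simp add: nbr_nbr[OF F]) (metis add.commute add_cancel_right_right add.assoc minus_unique)
qed

text \<open>Equal offsets at both ends of the slab give equal velocities, so the affine motion
  preserves the match throughout with one \<open>\<rho>\<close>; the sign is inherited from the
  initial level.\<close>

lemma nbr_matched:
  assumes n: "n < num_steps M" and F: "F \<in> faces M"
  obtains \<rho> where
    "\<And>t. t \<in> time_slab M n \<Longrightarrow> matched_facets (vertices M n t (fst F)) (vertices M n t (fst (nbr F)))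
       (snd F) (snd (nbr F)) (offset F) \<rho>"
    "\<And>t. t \<in> time_slab M n \<Longrightarrow>
       bary (vertices M n t (fst F)) (snd F) (vertices M n t (fst (nbr F)) (snd (nbr F)) - offset F) < 0"
    "\<And>i. i \<noteq> snd F \<Longrightarrow> vertex_velocity M n (fst (nbr F)) (\<rho> i) = vertex_velocity M n (fst F) i"
proof -
  obtain \<rho> where \<rho>: "bij \<rho>" "\<rho> (snd F) = snd (nbr F)"
    and node: "\<And>i n. i \<noteq> snd F \<Longrightarrow> n \<le> num_steps M \<Longrightarrow>
        node_at M n (cell_node M (fst (nbr F)) (\<rho> i)) = node_at M n (cell_node M (fst F) i) + offset F"
    and side: "\<And>n. n \<le> num_steps M \<Longrightarrow> bary (level_vertices M n (fst F)) (snd F)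
        (level_vertices M n (fst (nbr F)) (snd (nbr F)) - offset F) < 0"
    using paired_nbr[OF F] unfolding paired_def by blast
  have cells: "fst F \<in> cells M" "fst (nbr F) \<in> cells M"
    using F nbr_faces[OF F] by (auto simp: faces_def)
  have vel: "vertex_velocity M n (fst (nbr F)) (\<rho> i) = vertex_velocity M n (fst F) i" if "i \<noteq> snd F" for i
    using node[OF that, of n] node[OF that, of "Suc n"] n
    by (simp add: vertex_velocity_def node_velocity_def)
  have match: "matched_facets (vertices M n t (fst F)) (vertices M n t (fst (nbr F)))
      (snd F) (snd (nbr F)) (offset F) \<rho>" if t: "t \<in> time_slab M n" for t
  proof
    show "vertices M n t (fst (nbr F)) (\<rho> i) = vertices M n t (fst F) i + offset F" if "i \<noteq> snd F" for i
      using node[OF that, of n] n vel[OF that] by (simp add: vertices_eq level_vertices_def)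
  qed (use \<rho> nondeg[OF n t] cells in auto)
  show thesis
  proof (rule that[OF match _ vel])
    fix t assume t: "t \<in> time_slab M n"
    show "bary (vertices M n t (fst F)) (snd F) (vertices M n t (fst (nbr F)) (snd (nbr F)) - offset F) < 0"
      by (rule matched_side_constant[of "time_level M n" "time_level M (Suc n)" _ _ _ _ _ \<rho>])
        (use t match side[of n] n in \<open>auto simp: time_slab_def vertices_level intro!: continuous_on_vertices\<close>)
  qed
qed

end

section \<open>Integration over a cell\<close>

lemma set_integral_lebesgue_lborel:
  assumes "A \<in> sets borel" "h \<in> borel_measurable borel"
  shows "(LINT x:A|lebesgue. h x) = (LINT x:A|lborel. (h x :: real))"
  unfolding set_lebesgue_integral_def
  by (rule integral_completion) (use assms in measurable)

lemma cell_of_borel [measurable]: "cell_of w \<in> sets borel"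
  by (simp add: cell_of_def)

text \<open>The method integrates over open cells with the completed measure, the divergence theorem
  over closed simplices with the Borel one. The difference is the frontier of a convex set, which is
  null.\<close>

lemma cell_integral_eq_simplex:
  assumes nd: "det (edge_matrix w) \<noteq> 0" and h: "h \<in> borel_measurable borel"
  shows "(LINT x:cell_of w|lebesgue. h x) = (LINT x:convex hull (range w)|lborel. (h x :: real))"
proof -
  let ?S = "convex hull (range w)"
  have S[measurable]: "?S \<in> sets borel"
    using compact_simplex[of w] by (simp add: compact_imp_closed)
  have m: "(\<lambda>x. indicator A x *\<^sub>R h x) \<in> borel_measurable lebesgue" if "A \<in> sets borel" for A
    using h that by (intro measurable_completion) simp
  have "negligible (frontier ?S)"
    by (rule negligible_convex_frontier) simp
  then have N: "frontier ?S \<in> null_sets lebesgue"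
    by (simp add: negligible_iff_null_sets)
  have "(LINT x:cell_of w|lebesgue. h x) = (LINT x:?S|lebesgue. h x)"
    unfolding set_lebesgue_integral_def
  proof (rule integral_cong_AE)
    show "AE x in lebesgue. indicator (cell_of w) x *\<^sub>R h x = indicator ?S x *\<^sub>R h x"
      using AE_not_in[OF N]
    proof eventually_elim
      fix x assume "x \<notin> frontier ?S"
      moreover have "frontier ?S = ?S - interior ?S"
        using compact_simplex[of w] by (simp add: frontier_def compact_imp_closed)
      ultimately have "x \<in> cell_of w \<longleftrightarrow> x \<in> ?S"
        using interior_subset by (auto simp: cell_of_def)
      then show "indicator (cell_of w) x *\<^sub>R h x = indicator ?S x *\<^sub>R h x"
        by (simp add: indicator_def)
    qed
  qed (intro m S cell_of_borel)+
  also have "\<dots> = (LINT x:?S|lborel. h x)"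
    by (rule set_integral_lebesgue_lborel[OF S h])
  finally show ?thesis .
qed

lemma continuous_on_inv_ref_map:
  assumes "det (edge_matrix w) \<noteq> 0"
  shows "continuous_on S (inv (ref_map w))"
  using assms by (auto simp: inv_ref_map intro!: continuous_intros cong: continuous_on_cong)

lemma cell_of_eq_ref_map_image:
  assumes "det (edge_matrix w) \<noteq> 0"
  shows "cell_of w = ref_map w ` interior K_ref"
  by (simp add: interior_K_ref cell_of_ref_map[OF assms])

lemma inv_ref_map_ref_map:
  assumes "det (edge_matrix w) \<noteq> 0"
  shows "inv (ref_map w) (ref_map w \<xi>) = \<xi>"
  by (simp add: inv_ref_map[OF assms] bary_ref_map[OF assms])

text \<open>Separates time from space: for a fixed function on the reference simplex, only the
  Jacobian depends on the position of the cell.\<close>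

lemma cell_integral_ref_map:
  assumes nd: "det (edge_matrix w) \<noteq> 0" and p[measurable]: "p \<in> borel_measurable borel"
  shows "(LINT x:cell_of w|lebesgue. p (inv (ref_map w) x)) =
    \<bar>det (edge_matrix w)\<bar> * (LINT \<xi>:interior K_ref|lborel. (p \<xi> :: real))"
proof -
  have inv[measurable]: "inv (ref_map w) \<in> borel_measurable borel"
    by (rule borel_measurable_continuous_onI[OF continuous_on_inv_ref_map[OF nd]])
  let ?h = "\<lambda>x. indicator (cell_of w) x *\<^sub>R p (inv (ref_map w) x)"
  let ?L = "(*v) (edge_matrix w)"
  have h[measurable]: "?h \<in> borel_measurable borel" by measurable
  have "(LINT x:cell_of w|lebesgue. p (inv (ref_map w) x)) = (\<integral>x. ?h x \<partial>lborel)"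
    by (subst set_integral_lebesgue_lborel) (auto simp: set_lebesgue_integral_def)
  also have "\<dots> = (\<integral>x. ?h x \<partial>(distr lborel borel ((+) (w None))))"
    by (simp add: lborel_distr_plus)
  also have "\<dots> = (\<integral>x. ?h (w None + x) \<partial>lborel)"
    by (rule integral_distr) auto
  also have "\<dots> = \<bar>det (matrix ?L)\<bar> * (\<integral>\<xi>. ?h (w None + ?L \<xi>) \<partial>lborel)"
    by (rule lborel_integral_linear) (simp_all add: matrix_of_matrix_vector_mul nd)
  also have "(\<integral>\<xi>. ?h (w None + ?L \<xi>) \<partial>lborel) = (LINT \<xi>:interior K_ref|lborel. p \<xi>)"
    unfolding set_lebesgue_integral_def
  proof (rule Bochner_Integration.integral_cong[OF refl])
    fix \<xi>
    have r: "w None + ?L \<xi> = ref_map w \<xi>" by (simp add: ref_map_def)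
    have "ref_map w \<xi> \<in> cell_of w \<longleftrightarrow> \<xi> \<in> interior K_ref"
      unfolding cell_of_eq_ref_map_image[OF nd]
      using inv_ref_map_ref_map[OF nd] by (metis image_iff)
    then show "?h (w None + ?L \<xi>) = indicator (interior K_ref) \<xi> *\<^sub>R p \<xi>"
      by (simp add: r inv_ref_map_ref_map[OF nd] indicator_def)
  qed
  finally show ?thesis by (simp add: matrix_of_matrix_vector_mul)
qed

section \<open>Continuously differentiable functions and polynomials\<close>

text \<open>Differentiability is asked on the whole space. On each cell the solution is the
  restriction of a polynomial, and using its global extension avoids one-sided derivatives at
  facets.\<close>

definition cont_grad :: "(real ^ 'd \<Rightarrow> real) \<Rightarrow> bool" where
  "cont_grad \<phi> \<longleftrightarrow> (\<exists>g. (\<forall>x. GDERIV \<phi> x :> g x) \<and> continuous_on UNIV g)"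

lemma cont_grad_continuous: "cont_grad \<phi> \<Longrightarrow> continuous_on S \<phi>"
  unfolding cont_grad_def using GDERIV_continuous_on by blast

lemma cont_grad_const: "cont_grad (\<lambda>x. c)"
  unfolding cont_grad_def by (intro exI[of _ "\<lambda>x. 0"]) (auto simp: GDERIV_const)

lemma cont_grad_bary: "cont_grad (bary w l)"
  unfolding cont_grad_def by (intro exI[of _ "\<lambda>x. bary_grad w l"]) (auto simp: GDERIV_bary)

lemma cont_grad_add: "cont_grad \<phi> \<Longrightarrow> cont_grad \<psi> \<Longrightarrow> cont_grad (\<lambda>x. \<phi> x + \<psi> x)"
  unfolding cont_grad_def by (elim exE conjE, rule exI) (auto intro!: GDERIV_add continuous_intros)

lemma cont_grad_mult:
  assumes "cont_grad \<phi>" "cont_grad \<psi>"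
  shows "cont_grad (\<lambda>x. \<phi> x * \<psi> x)"
proof -
  obtain g h where g: "\<And>x. GDERIV \<phi> x :> g x" "continuous_on UNIV g"
    and h: "\<And>x. GDERIV \<psi> x :> h x" "continuous_on UNIV h"
    using assms unfolding cont_grad_def by blast
  show ?thesis
    unfolding cont_grad_def
    by (intro exI[of _ "\<lambda>x. \<phi> x *\<^sub>R h x + \<psi> x *\<^sub>R g x"] conjI allI GDERIV_mult g h
        continuous_intros assms[THEN cont_grad_continuous])
qed

lemma cont_grad_sum: "(\<And>i. i \<in> I \<Longrightarrow> cont_grad (\<phi> i)) \<Longrightarrow> cont_grad (\<lambda>x. \<Sum>i\<in>I. \<phi> i x)"
  by (induction I rule: infinite_finite_induct) (auto intro: cont_grad_const cont_grad_add)

lemma cont_grad_prod: "(\<And>i. i \<in> I \<Longrightarrow> cont_grad (\<phi> i)) \<Longrightarrow> cont_grad (\<lambda>x. \<Prod>i\<in>I. \<phi> i x)"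
  by (induction I rule: infinite_finite_induct) (auto intro: cont_grad_const cont_grad_mult)

lemma cont_grad_power: "cont_grad \<phi> \<Longrightarrow> cont_grad (\<lambda>x. \<phi> x ^ n)"
  by (induction n) (auto intro: cont_grad_const cont_grad_mult)

definition poly_at :: "nat \<Rightarrow> (('d::finite \<Rightarrow> nat) \<Rightarrow> real) \<Rightarrow> real ^ 'd \<Rightarrow> real" where
  "poly_at k a \<xi> = (\<Sum>\<alpha>\<in>multi_indices k. a \<alpha> * monomial_at \<alpha> \<xi>)"

lemma cont_grad_poly:
  assumes "det (edge_matrix w) \<noteq> 0"
  shows "cont_grad (\<lambda>x. poly_at k a (inv (ref_map w) x))"
  unfolding poly_at_def monomial_at_def inv_ref_map[OF assms]
  by (simp, intro cont_grad_sum cont_grad_mult cont_grad_prod cont_grad_power cont_grad_const cont_grad_bary)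

lemma continuous_on_monomial: "continuous_on S (monomial_at \<alpha>)"
  unfolding monomial_at_def[abs_def] by (intro continuous_intros)

lemma continuous_on_poly_at: "continuous_on S (poly_at k a)"
  unfolding poly_at_def[abs_def] by (intro continuous_intros continuous_on_monomial)

text \<open>Points of the closed simplex are limit points of the open cell, so the limit defining
  the trace is unique and is given by the continuous extension.\<close>

lemma trace_from_eq:
  assumes nd: "det (edge_matrix w) \<noteq> 0" and x: "x \<in> convex hull (range w)"
    and \<phi>: "continuous_on UNIV \<phi>" and v: "\<And>y. y \<in> cell_of w \<Longrightarrow> v y = \<phi> y"
  shows "trace_from (cell_of w) v x = \<phi> x"
  unfolding trace_from_def
proof (rule tendsto_Lim)
  have o: "open (cell_of w)" by (simp add: cell_of_def)
  have "x islimpt cell_of w"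
  proof (cases "x \<in> cell_of w")
    case True
    then show ?thesis using interior_limit_point[of x "cell_of w"] by (simp add: interior_open[OF o])
  next
    case False
    then show ?thesis using x closure_cell_of[OF nd] by (metis UnE closure_def mem_Collect_eq)
  qed
  then show "\<not> trivial_limit (at x within cell_of w)"
    by (simp add: trivial_limit_within)
  have "(\<phi> \<longlongrightarrow> \<phi> x) (at x within cell_of w)"
    using \<phi> by (meson continuous_on_def UNIV_I filterlim_mono at_le order_refl subset_UNIV)
  moreover have "\<forall>\<^sub>F y in at x within cell_of w. \<phi> y = v y"
    using v by (auto simp: eventually_at_filter)
  ultimately show "(v \<longlongrightarrow> \<phi> x) (at x within cell_of w)"
    by (rule Lim_transform_eventually)
qed

lemma grad_eq:
  assumes "open S" "x \<in> S" and v: "\<And>y. y \<in> S \<Longrightarrow> v y = \<phi> y" and g: "GDERIV \<phi> x :> g"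
  shows "grad v x = g"
  unfolding grad_def
proof (rule the_equality)
  show D: "GDERIV v x :> g"
    using g v unfolding gderiv_def
    by (metis (no_types, lifting) assms(1,2) has_derivative_transform_within_open)
  fix D assume "GDERIV v x :> D"
  then have "(\<lambda>h. h \<bullet> D) = (\<lambda>h. h \<bullet> g)"
    using D unfolding gderiv_def by (rule has_derivative_unique)
  then have "h \<bullet> D = h \<bullet> g" for h by metis
  then show "D = g" by (metis vector_eq_ldot)
qed

section \<open>Motion of a cell\<close>

text \<open>Jacobi's formula at the identity, from the Leibniz expansion. A permutation other than
  \<open>id\<close> moves at least two indices, so after differentiating one factor an off-diagonal
  zero remains.\<close>

lemma det_mat_1_add_derivative:
  fixes B :: "real ^ 'n ^ 'n"
  shows "((\<lambda>h. det (mat 1 + h *\<^sub>R B)) has_real_derivative (\<Sum>i\<in>UNIV. B $ i $ i)) (at 0)"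
proof -
  let ?P = "{p. p permutes (UNIV :: 'n set)}"
  let ?D = "\<lambda>p. \<Sum>i\<in>UNIV. B $ i $ p i * (\<Prod>j\<in>UNIV - {i}. (mat 1 + 0 *\<^sub>R B :: real ^ 'n ^ 'n) $ j $ p j)"
  have "((\<lambda>h. \<Prod>i\<in>UNIV. (mat 1 + h *\<^sub>R B) $ i $ p i) has_real_derivative ?D p) (at 0)" for p
    by (rule has_field_derivative_prod) (auto intro!: derivative_eq_intros)
  then have "((\<lambda>h. \<Sum>p\<in>?P. of_int (sign p) * (\<Prod>i\<in>UNIV. (mat 1 + h *\<^sub>R B) $ i $ p i)) has_real_derivative
      (\<Sum>p\<in>?P. of_int (sign p) * ?D p)) (at 0)"
    by (intro DERIV_sum DERIV_cmult)
  moreover have "(\<Sum>p\<in>?P. of_int (sign p) * ?D p) = (\<Sum>p\<in>{id}. of_int (sign p) * ?D p)"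
  proof (rule sum.mono_neutral_right)
    show "\<forall>p\<in>?P - {id}. of_int (sign p) * ?D p = 0"
    proof
      fix p assume p: "p \<in> ?P - {id}"
      have "(\<Prod>j\<in>UNIV - {i}. (mat 1 + 0 *\<^sub>R B :: real ^ 'n ^ 'n) $ j $ p j) = 0" for i
      proof -
        have "\<exists>j. j \<noteq> i \<and> p j \<noteq> j"
        proof (rule ccontr)
          assume "\<nexists>j. j \<noteq> i \<and> p j \<noteq> j"
          then have fp: "p j = j" if "j \<noteq> i" for j using that by blast
          have "p i = i"
            using p fp by (metis DiffD1 mem_Collect_eq permutes_inj inj_eq)
          then have "p = id" using fp by (metis eq_id_iff)
          then show False using p by simp
        qed
        then obtain j where "j \<noteq> i" "p j \<noteq> j" by blast
        then show ?thesis
          by (intro prod_zero bexI[of _ j]) (auto simp: mat_def)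
      qed
      then show "of_int (sign p) * ?D p = 0"
        by (simp only: mult_zero_right sum.neutral_const)
    qed
  qed (auto simp: permutes_id)
  moreover have "?D id = (\<Sum>i\<in>UNIV. B $ i $ i)"
    by (simp add: mat_def)
  ultimately show ?thesis
    by (simp add: det_def)
qed

lemma edge_matrix_affine:
  "edge_matrix (\<lambda>l. w l + h *\<^sub>R v l) = edge_matrix w + h *\<^sub>R edge_matrix v"
  by (simp add: edge_matrix_def vec_eq_iff algebra_simps)

text \<open>Factoring out the edge matrix leaves a perturbation of the identity. The trace that
  results is the divergence of the velocity field interpolating the vertex velocities.\<close>

lemma det_edge_matrix_derivative:
  assumes nd: "det (edge_matrix w) \<noteq> 0"
  shows "((\<lambda>h. det (edge_matrix (\<lambda>l. w l + h *\<^sub>R v l))) has_real_derivative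
    det (edge_matrix w) * (\<Sum>l\<in>UNIV. bary_grad w l \<bullet> v l)) (at 0)"
proof -
  let ?E = "edge_matrix w" and ?B = "matrix_inv (edge_matrix w) ** edge_matrix v"
  have "?E ** (mat 1 + h *\<^sub>R ?B) = edge_matrix (\<lambda>l. w l + h *\<^sub>R v l)" for h
  proof -
    have "?E ** (h *\<^sub>R ?B) = h *\<^sub>R (?E ** ?B)"
      by (simp add: matrix_matrix_mult_def vec_eq_iff sum_distrib_left ac_simps)
    also have "?E ** ?B = edge_matrix v"
      by (simp add: matrix_mul_assoc edge_matrix_inverse[OF nd])
    finally show ?thesis
      by (simp add: matrix_add_ldistrib edge_matrix_affine)
  qed
  then have "det (edge_matrix (\<lambda>l. w l + h *\<^sub>R v l)) = det ?E * det (mat 1 + h *\<^sub>R ?B)" for h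
    by (metis det_mul)
  moreover have "(\<Sum>i\<in>UNIV. ?B $ i $ i) = (\<Sum>l\<in>UNIV. bary_grad w l \<bullet> v l)"
  proof -
    have "?B $ i $ i = bary_grad w (Some i) \<bullet> (v (Some i) - v None)" for i
      by (simp add: matrix_matrix_mult_def edge_matrix_def bary_grad_def inner_vec_def)
    then have "(\<Sum>i\<in>UNIV. ?B $ i $ i) = (\<Sum>i\<in>UNIV. bary_grad w (Some i) \<bullet> v (Some i)) -
        (\<Sum>i\<in>UNIV. bary_grad w (Some i)) \<bullet> v None"
      by (simp add: inner_diff_right sum_subtractf inner_sum_left)
    also have "(\<Sum>i\<in>UNIV. bary_grad w (Some i)) = - bary_grad w None"
      using sum_bary_grad[of w] by (simp add: sum_UNIV_option add_eq_0_iff2)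
    finally show ?thesis by (simp add: sum_UNIV_option)
  qed
  ultimately show ?thesis
    using DERIV_cmult[OF det_mat_1_add_derivative[of ?B], of "det ?E"] by simp
qed

text \<open>The affine interpolant of the vertex velocities \<open>v\<close>, the closed form of the
  grid velocity on a cell.\<close>

definition affine_velocity :: "('d::finite option \<Rightarrow> real ^ 'd) \<Rightarrow> ('d option \<Rightarrow> real ^ 'd) \<Rightarrow> real ^ 'd \<Rightarrow> real ^ 'd" where
  "affine_velocity w v x = (\<Sum>l\<in>UNIV. bary w l x *\<^sub>R v l)"

lemma continuous_on_affine_velocity: "continuous_on S (affine_velocity w v)"
  unfolding affine_velocity_def[abs_def] by (intro continuous_intros)

text \<open>The divergence theorem for the field F(U) - U^2 \<omega> / 2. Its components of F(U)
  times unit vectors are indexed by \<open>Inl\<close>, and the terms - U^2 / 2 times a barycentric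
  coordinate times a vertex velocity by \<open>Inr\<close>; the product rule on the latter yields
  both the transport term and the divergence of \<omega>.\<close>

lemma simplex_energy_identity:
  fixes w v :: "'d::finite option \<Rightarrow> real ^ 'd"
  assumes nd: "det (edge_matrix w) \<noteq> 0" and f: "continuous_on UNIV f"
    and F: "\<And>y. (F has_vector_derivative f y) (at y)"
    and U: "\<And>x. GDERIV U x :> g x" and g: "continuous_on UNIV g"
  shows "(LINT x:convex hull (range w)|lborel. (f (U x) - U x *\<^sub>R affine_velocity w v x) \<bullet> g x
        - (U x)\<^sup>2 / 2 * (\<Sum>l\<in>UNIV. bary_grad w l \<bullet> v l)) =
    (\<Sum>l\<in>UNIV. LINT y:facet w l|facet_measure w l.
        (F (U y) - ((U y)\<^sup>2 / 2) *\<^sub>R affine_velocity w v y) \<bullet> outward_normal w l)"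
proof -
  define \<phi> where "\<phi> j x = (case j of Inl i \<Rightarrow> F (U x) $ i | Inr l \<Rightarrow> - ((U x)\<^sup>2 / 2) * bary w l x)"
    for j :: "'d + 'd option" and x
  define G where "G j x = (case j of Inl i \<Rightarrow> (f (U x) $ i) *\<^sub>R g x
      | Inr l \<Rightarrow> (- ((U x)\<^sup>2 / 2)) *\<^sub>R bary_grad w l + (- (U x * bary w l x)) *\<^sub>R g x)"
    for j :: "'d + 'd option" and x
  define e where "e j = (case j of Inl i \<Rightarrow> axis i 1 | Inr l \<Rightarrow> v l)" for j :: "'d + 'd option"
  have cU: "continuous_on S U" for S
    by (rule GDERIV_continuous_on[OF U])
  have GD: "GDERIV (\<phi> j) x :> G j x" for j x
  proof (cases j)
    case (Inl i)
    have "((\<lambda>y. F y $ i) has_vector_derivative f (U x) $ i) (at (U x))"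
      using bounded_linear.has_vector_derivative[OF bounded_linear_vec_nth F] .
    then have "DERIV (\<lambda>y. F y $ i) (U x) :> f (U x) $ i"
      by (simp add: has_real_derivative_iff_has_vector_derivative)
    moreover have "\<phi> j = (\<lambda>x. F (U x) $ i)"
      by (simp add: Inl \<phi>_def fun_eq_iff)
    ultimately show ?thesis
      using GDERIV_DERIV_compose[OF U, of "\<lambda>y. F y $ i"] by (simp add: Inl G_def)
  next
    case (Inr l)
    have "DERIV (\<lambda>y. - (y\<^sup>2 / 2)) (U x) :> - U x"
      by (auto intro!: derivative_eq_intros)
    from GDERIV_mult[OF GDERIV_DERIV_compose[OF U this] GDERIV_bary[of w l]]
    have "GDERIV (\<lambda>x. - ((U x)\<^sup>2 / 2) * bary w l x) x :> G j x"
      by (simp add: Inr G_def ac_simps)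
    moreover have "\<phi> j = (\<lambda>x. - ((U x)\<^sup>2 / 2) * bary w l x)"
      by (simp add: Inr \<phi>_def fun_eq_iff)
    ultimately show ?thesis by simp
  qed
  have cG: "continuous_on UNIV (G j)" for j
    by (cases j) (auto simp: G_def[abs_def] intro!: continuous_intros cU g continuous_on_compose2[OF f cU])
  have sum_Plus: "(\<Sum>j\<in>UNIV. h j) = (\<Sum>i\<in>UNIV. h (Inl i)) + (\<Sum>l\<in>UNIV. h (Inr l))"
    for h :: "'d + 'd option \<Rightarrow> 'z::comm_monoid_add"
    unfolding UNIV_Plus_UNIV[symmetric] by (subst sum.Plus) auto
  have "(\<Sum>j\<in>UNIV. G j x \<bullet> e j) = (f (U x) - U x *\<^sub>R affine_velocity w v x) \<bullet> g x
        - (U x)\<^sup>2 / 2 * (\<Sum>l\<in>UNIV. bary_grad w l \<bullet> v l)" for x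
  proof -
    have "(\<Sum>i\<in>UNIV. G (Inl i) x \<bullet> e (Inl i)) = f (U x) \<bullet> g x"
    proof -
      have "G (Inl i) x \<bullet> e (Inl i) = f (U x) $ i * g x $ i" for i
        by (simp add: G_def e_def inner_axis)
      then show ?thesis by (simp add: inner_vec_def)
    qed
    moreover have "(\<Sum>l\<in>UNIV. G (Inr l) x \<bullet> e (Inr l)) =
        (\<Sum>l\<in>UNIV. - (U x * (bary w l x * (v l \<bullet> g x))) - (U x)\<^sup>2 / 2 * (bary_grad w l \<bullet> v l))"
      by (rule sum.cong) (auto simp: G_def e_def inner_simps inner_commute)
    ultimately show ?thesis
      by (simp add: sum_Plus affine_velocity_def inner_diff_left inner_sum_left sum_subtractf
          sum_negf sum_distrib_left)
  qed
  moreover have "(\<Sum>j\<in>UNIV. \<phi> j y *\<^sub>R e j) = F (U y) - ((U y)\<^sup>2 / 2) *\<^sub>R affine_velocity w v y" for y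
  proof -
    have "(\<Sum>i\<in>UNIV. \<phi> (Inl i) y *\<^sub>R e (Inl i)) = F (U y)"
      using basis_expansion[of "F (U y)"] by (simp add: \<phi>_def e_def scalar_mult_eq_scaleR)
    moreover have "(\<Sum>l\<in>UNIV. \<phi> (Inr l) y *\<^sub>R e (Inr l)) = - (((U y)\<^sup>2 / 2) *\<^sub>R affine_velocity w v y)"
      by (simp add: \<phi>_def e_def affine_velocity_def scaleR_sum_right sum_negf)
    ultimately show ?thesis by (simp add: sum_Plus)
  qed
  ultimately show ?thesis
    using integral_divergence_simplex[OF nd, of UNIV \<phi> G e, OF _ GD cG] by simp
qed

text \<open>A point that is fixed in the reference simplex keeps its barycentric coordinates, so its
  trajectory is a fixed combination of the vertex trajectories. At the ends of the slab the
  derivative is one-sided and still unique.\<close>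

lemma grid_velocity_eq:
  assumes nd: "det (edge_matrix (vertices M n t c)) \<noteq> 0"
    and less: "time_level M n < time_level M (Suc n)" and t: "t \<in> time_slab M n"
  shows "grid_velocity M n t c x = affine_velocity (vertices M n t c) (vertex_velocity M n c) x"
proof -
  let ?w = "vertices M n t c"
  have "cell_map M n s c (inv (cell_map M n t c) x) = (\<Sum>l\<in>UNIV. bary ?w l x *\<^sub>R vertices M n s c l)" for s
    unfolding cell_map_def inv_ref_map[OF nd] by (rule affine_combination_ref_map[OF sum_bary, symmetric])
  moreover have "((\<lambda>s. \<Sum>l\<in>UNIV. bary ?w l x *\<^sub>R vertices M n s c l) has_vector_derivative
      affine_velocity ?w (vertex_velocity M n c) x) (at t within time_slab M n)"
    unfolding affine_velocity_def vertices_eq[of M n _ c]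
    by (auto intro!: derivative_eq_intros)
  ultimately show ?thesis
    unfolding grid_velocity_def time_slab_def
    using less t by (simp add: vector_derivative_within_closed_interval time_slab_def)
qed

lemma jacobian_derivative:
  assumes nd: "det (edge_matrix (vertices M n t c)) \<noteq> 0"
  shows "((\<lambda>s. jacobian M n s c) has_real_derivative jacobian M n t c *
    (\<Sum>l\<in>UNIV. bary_grad (vertices M n t c) l \<bullet> vertex_velocity M n c l)) (at t)"
proof -
  let ?w = "vertices M n t c" and ?v = "vertex_velocity M n c"
  have eq: "jacobian M n s c = det (edge_matrix (\<lambda>l. ?w l + (s - t) *\<^sub>R ?v l))" for s
  proof -
    have "vertices M n s c = (\<lambda>l. ?w l + (s - t) *\<^sub>R ?v l)"
      by (rule ext) (simp add: vertices_eq algebra_simps)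
    then show ?thesis by (simp add: jacobian_def)
  qed
  have "((\<lambda>s. det (edge_matrix (\<lambda>l. ?w l + (s - t) *\<^sub>R ?v l))) has_real_derivative
     det (edge_matrix ?w) * (\<Sum>l\<in>UNIV. bary_grad ?w l \<bullet> ?v l)) (at t)"
    using DERIV_shift[of "\<lambda>h. det (edge_matrix (\<lambda>l. ?w l + h *\<^sub>R ?v l))" _ t "- t"]
      det_edge_matrix_derivative[OF nd, of ?v] by simp
  then show ?thesis by (simp only: eq) (simp add: jacobian_def)
qed

lemma integrable_simplex:
  fixes h :: "real ^ 'd \<Rightarrow> real" and w :: "'d::finite option \<Rightarrow> real ^ 'd"
  assumes "continuous_on UNIV h"
  shows "set_integrable lborel (convex hull (range w)) h"
  unfolding set_integrable_def
  by (intro borel_integrable_compact compact_simplex continuous_on_subset[OF assms]) auto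

lemma integrable_cell:
  fixes h :: "real ^ 'd \<Rightarrow> real" and w :: "'d::finite option \<Rightarrow> real ^ 'd"
  assumes "continuous_on UNIV h"
  shows "set_integrable lebesgue (cell_of w) h"
proof -
  have "set_integrable lborel (cell_of w) h"
    by (rule set_integrable_subset[OF integrable_simplex[OF assms]])
      (auto simp: cell_of_def intro: interior_subset[THEN subsetD])
  then show ?thesis
    unfolding set_integrable_def by (simp add: integrable_completion borel_measurable_integrable)
qed

lemma measure_simplex_cell:
  fixes w :: "'d::finite option \<Rightarrow> real ^ 'd"
  assumes nd: "det (edge_matrix w) \<noteq> 0"
  shows "measure lebesgue (convex hull (range w)) = measure lebesgue (cell_of w)"
    and "measure lebesgue (cell_of w) = \<bar>det (edge_matrix w)\<bar> * (LINT \<xi>:interior (K_ref :: (real ^ 'd) set)|lborel. 1)"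
proof -
  have S: "convex hull (range w) \<in> sets borel"
    using compact_simplex[of w] by (simp add: compact_imp_closed)
  have "measure lebesgue (cell_of w) = (LINT x:cell_of w|lebesgue. 1)"
    using cell_of_borel[of w] by (simp add: set_lebesgue_integral_def)
  also have "\<dots> = (LINT x:convex hull (range w)|lborel. 1)"
    by (rule cell_integral_eq_simplex[OF nd]) simp
  also have "\<dots> = measure lebesgue (convex hull (range w))"
    using S by (simp add: set_lebesgue_integral_def)
  finally show "measure lebesgue (convex hull (range w)) = measure lebesgue (cell_of w)" ..
  show "measure lebesgue (cell_of w) = \<bar>det (edge_matrix w)\<bar> * (LINT \<xi>:interior (K_ref :: (real ^ 'd) set)|lborel. 1)"
    using cell_integral_ref_map[OF nd, of "\<lambda>x. 1"] cell_of_borel[of w]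
    by (simp add: set_lebesgue_integral_def)
qed

lemma flux_dissipation:
  assumes flux: "numerical_flux f ghat" and F: "\<And>y. (F has_vector_derivative f y) (at y)"
    and \<nu>: "norm \<nu> = 1"
  shows "(F a - (a\<^sup>2 / 2) *\<^sub>R \<omega>) \<bullet> \<nu> - (F b - (b\<^sup>2 / 2) *\<^sub>R \<omega>) \<bullet> \<nu> - ghat \<omega> a b \<nu> * (a - b) \<le> 0"
proof -
  \<comment> \<open>The claim is \<open>h a \<le> h b\<close>. The derivative of \<open>h\<close> is
    the difference of fluxes whose sign monotonicity controls between \<open>a\<close> and
    \<open>b\<close>, so no integral has to be formed.\<close>
  define h where "h y = (F y - (y\<^sup>2 / 2) *\<^sub>R \<omega>) \<bullet> \<nu> - ghat \<omega> a b \<nu> * y" for y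
  have P: "ghat \<omega> y y \<nu> = (f y - y *\<^sub>R \<omega>) \<bullet> \<nu>" "mono (\<lambda>u. ghat \<omega> u y \<nu>)" "antimono (\<lambda>u. ghat \<omega> y u \<nu>)" for y
    using flux \<nu> unfolding numerical_flux_def ale_flux_def by blast+
  have D: "DERIV h y :> ghat \<omega> y y \<nu> - ghat \<omega> a b \<nu>" for y
  proof -
    have "((\<lambda>y. F y - (y\<^sup>2 / 2) *\<^sub>R \<omega>) has_vector_derivative f y - y *\<^sub>R \<omega>) (at y)"
      by (auto intro!: derivative_eq_intros F)
    from bounded_linear.has_vector_derivative[OF bounded_linear_inner_left this, of \<nu>]
    have "DERIV (\<lambda>y. (F y - (y\<^sup>2 / 2) *\<^sub>R \<omega>) \<bullet> \<nu>) y :> (f y - y *\<^sub>R \<omega>) \<bullet> \<nu>"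
      by (simp add: has_real_derivative_iff_has_vector_derivative)
    then show ?thesis
      unfolding h_def[abs_def] P(1) by (auto intro!: derivative_eq_intros)
  qed
  have "h a \<le> h b"
  proof (cases "a \<le> b")
    case True
    then show ?thesis
    proof (rule DERIV_nonneg_imp_nondecreasing)
      fix y assume y: "a \<le> y" "y \<le> b"
      have "ghat \<omega> a b \<nu> \<le> ghat \<omega> a y \<nu>" using antimonoD[OF P(3) y(2)] .
      also have "\<dots> \<le> ghat \<omega> y y \<nu>" using monoD[OF P(2) y(1)] .
      finally show "\<exists>z. DERIV h y :> z \<and> 0 \<le> z" using D[of y] by force
    qed
  next
    case False
    then have "b \<le> a" by simp
    then show ?thesis
    proof (rule DERIV_nonpos_imp_nonincreasing)
      fix y assume y: "b \<le> y" "y \<le> a"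
      have "ghat \<omega> y y \<nu> \<le> ghat \<omega> a y \<nu>" using monoD[OF P(2) y(2)] .
      also have "\<dots> \<le> ghat \<omega> a b \<nu>" using antimonoD[OF P(3) y(1)] .
      finally show "\<exists>z. DERIV h y :> z \<and> z \<le> 0" using D[of y] by force
    qed
  qed
  then show ?thesis by (simp add: h_def right_diff_distrib)
qed

section \<open>Conservation of volume\<close>

context periodic_mesh
begin

text \<open>Pairing every face with its neighbour makes a sum over all faces telescope.\<close>

lemma face_sum_nonpos:
  assumes n: "n < num_steps M" and t: "t \<in> time_slab M n"
    and H: "\<And>c l. c \<in> cells M \<Longrightarrow> set_integrable (facet_measure (vertices M n t c) l) (facet (vertices M n t c) l) (H (c, l))"
    and le: "\<And>F x. F \<in> faces M \<Longrightarrow> x \<in> facet (vertices M n t (fst F)) (snd F) \<Longrightarrow>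
        H F x + H (nbr F) (x + offset F) \<le> 0"
  shows "(\<Sum>c\<in>cells M. \<Sum>l\<in>UNIV. LINT x:facet (vertices M n t c) l|facet_measure (vertices M n t c) l. H (c, l) x) \<le> (0::real)"
proof -
  let ?w = "\<lambda>F. vertices M n t (fst F)"
  let ?I = "\<lambda>F. LINT x:facet (?w F) (snd F)|facet_measure (?w F) (snd F). H F x"
  have H': "set_integrable (facet_measure (?w F) (snd F)) (facet (?w F) (snd F)) (H F)" if "F \<in> faces M" for F
    using H[of "fst F" "snd F"] that by (simp add: faces_def mem_Times_iff)
  have "?I F + ?I (nbr F) \<le> 0" if F: "F \<in> faces M" for F
  proof -
    from nbr_matched[OF n F] obtain \<rho> where mf:
      "matched_facets (?w F) (?w (nbr F)) (snd F) (snd (nbr F)) (offset F) \<rho>"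
      "bary (?w F) (snd F) (?w (nbr F) (snd (nbr F)) - offset F) < 0"
      using t by metis
    interpret matched_facets "?w F" "?w (nbr F)" "snd F" "snd (nbr F)" "offset F" \<rho> by (rule mf(1))
    note i = H'[OF nbr_faces[OF F]]
    have "?I F + ?I (nbr F) =
        (LINT x:facet (?w F) (snd F)|facet_measure (?w F) (snd F). H F x + H (nbr F) (x + offset F))"
      unfolding set_integral_match[OF mf(2) i]
      by (rule set_integral_add(2)[symmetric]) (use H'[OF F] set_integrable_match[OF mf(2) i] in auto)
    also have "\<dots> \<le> 0"
    proof -
      let ?h = "\<lambda>x. indicator (facet (?w F) (snd F)) x *\<^sub>R (H F x + H (nbr F) (x + offset F))"
      have "0 \<le> (\<integral>x. - ?h x \<partial>facet_measure (?w F) (snd F))"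
        using le[OF F] by (intro Bochner_Integration.integral_nonneg) (auto simp: indicator_def)
      then show ?thesis by (simp add: set_lebesgue_integral_def del: minus_add_distrib)
    qed
    finally show ?thesis .
  qed
  then have "(\<Sum>F\<in>faces M. ?I F + ?I (nbr F)) \<le> 0"
    by (rule sum_nonpos)
  \<comment> \<open>As \<open>nbr\<close> is an involution, the neighbours contribute the same
    total, and twice the wanted sum is nonpositive.\<close>
  moreover have "bij_betw nbr (faces M) (faces M)"
    by (rule bij_betw_byWitness[where f' = nbr]) (auto simp: nbr_nbr nbr_faces)
  then have "(\<Sum>F\<in>faces M. ?I (nbr F)) = (\<Sum>F\<in>faces M. ?I F)"
    by (rule sum.reindex_bij_betw)
  ultimately have "(\<Sum>F\<in>faces M. ?I F) \<le> 0"
    by (simp add: sum.distrib)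
  then show ?thesis
    by (simp add: faces_def sum.cartesian_product case_prod_unfold)
qed

text \<open>The velocity on a facet depends only on the vertices of that facet, and these have equal
  weights and equal velocities in both cells.\<close>

lemma affine_velocity_nbr:
  assumes n: "n < num_steps M" and t: "t \<in> time_slab M n" and F: "F \<in> faces M"
    and x: "x \<in> facet (vertices M n t (fst F)) (snd F)"
  shows "affine_velocity (vertices M n t (fst (nbr F))) (vertex_velocity M n (fst (nbr F))) (x + offset F) =
    affine_velocity (vertices M n t (fst F)) (vertex_velocity M n (fst F)) x"
proof -
  let ?w = "\<lambda>F. vertices M n t (fst F)" and ?v = "\<lambda>F. vertex_velocity M n (fst F)"
  from nbr_matched[OF n F] obtain \<rho> where mf:
    "matched_facets (?w F) (?w (nbr F)) (snd F) (snd (nbr F)) (offset F) \<rho>"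
    "\<And>i. i \<noteq> snd F \<Longrightarrow> ?v (nbr F) (\<rho> i) = ?v F i"
    using t by metis
  interpret matched_facets "?w F" "?w (nbr F)" "snd F" "snd (nbr F)" "offset F" \<rho> by (rule mf(1))
  have z: "bary (?w F) (snd F) x = 0" using x by (simp add: mem_facet[OF nd])
  have "affine_velocity (?w (nbr F)) (?v (nbr F)) (x + offset F) =
      (\<Sum>i\<in>UNIV. bary (?w (nbr F)) (\<rho> i) (x + offset F) *\<^sub>R ?v (nbr F) (\<rho> i))"
    unfolding affine_velocity_def using mf(1)
    by (intro sum.reindex_bij_betw[symmetric]) (simp add: matched_facets_def)
  also have "\<dots> = affine_velocity (?w F) (?v F) x"
    unfolding affine_velocity_def
  proof (rule sum.cong[OF refl])
    fix i
    show "bary (?w (nbr F)) (\<rho> i) (x + offset F) *\<^sub>R ?v (nbr F) (\<rho> i) = bary (?w F) i x *\<^sub>R ?v F i"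
      unfolding bary_match[OF z] using mf(2)[of i] z by (cases "i = snd F") auto
  qed
  finally show ?thesis .
qed

lemma outward_normal_nbr:
  assumes n: "n < num_steps M" and t: "t \<in> time_slab M n" and F: "F \<in> faces M"
  shows "outward_normal (vertices M n t (fst (nbr F))) (snd (nbr F)) = - outward_normal (vertices M n t (fst F)) (snd F)"
proof -
  from nbr_matched[OF n F] obtain \<rho> where \<rho>:
    "matched_facets (vertices M n t (fst F)) (vertices M n t (fst (nbr F))) (snd F) (snd (nbr F)) (offset F) \<rho>"
    "bary (vertices M n t (fst F)) (snd F) (vertices M n t (fst (nbr F)) (snd (nbr F)) - offset F) < 0"
    using t by metis
  show ?thesis
    using matched_facets.outward_normal_match_iff[OF \<rho>(1)] \<rho>(2) by simp
qed

lemma facet_nbr: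
  assumes n: "n < num_steps M" and t: "t \<in> time_slab M n" and F: "F \<in> faces M"
    and x: "x \<in> facet (vertices M n t (fst F)) (snd F)"
  shows "x + offset F \<in> facet (vertices M n t (fst (nbr F))) (snd (nbr F))"
proof -
  from nbr_matched[OF n F] obtain \<rho> where
    "matched_facets (vertices M n t (fst F)) (vertices M n t (fst (nbr F))) (snd F) (snd (nbr F)) (offset F) \<rho>"
    using t by metis
  from matched_facets.mem_facet_match[OF this] show ?thesis using x by simp
qed

text \<open>The divergence of the grid velocity, constant on each cell, and at the same time the
  logarithmic derivative of the Jacobian.\<close>

definition divergence :: "nat \<Rightarrow> real \<Rightarrow> 'c \<Rightarrow> real" where
  "divergence n t c = (\<Sum>l\<in>UNIV. bary_grad (vertices M n t c) l \<bullet> vertex_velocity M n c l)"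

lemma volume_derivative_zero:
  assumes n: "n < num_steps M" and t: "t \<in> time_slab M n"
  shows "(\<Sum>c\<in>cells M. jacobian M n t c * divergence n t c) * (LINT \<xi>:interior (K_ref :: (real ^ 'd) set)|lborel. 1) = 0"
proof -
  let ?w = "\<lambda>c. vertices M n t c" and ?v = "\<lambda>c. vertex_velocity M n c"
  let ?H = "\<lambda>F y. affine_velocity (?w (fst F)) (?v (fst F)) y \<bullet> outward_normal (?w (fst F)) (snd F)"
  let ?S = "\<lambda>H. \<Sum>c\<in>cells M. \<Sum>l\<in>UNIV. LINT x:facet (?w c) l|facet_measure (?w c) l. H (c, l) x"
  have i: "set_integrable (facet_measure (?w c) l) (facet (?w c) l) (?H (c, l))"
    if "c \<in> cells M" for c l
    by (rule integrable_facet[OF nondeg[OF n t that]]) (auto intro!: continuous_intros continuous_on_affine_velocity)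
  have eq: "?H (nbr F) (x + offset F) = - ?H F x"
    if F: "F \<in> faces M" "x \<in> facet (?w (fst F)) (snd F)" for F x
    by (simp add: affine_velocity_nbr[OF n t F] outward_normal_nbr[OF n t F(1)])
  have "?S ?H \<le> 0"
    by (rule face_sum_nonpos[OF n t]) (use i eq in auto)
  \<comment> \<open>Here the contributions of the two sides cancel exactly, so the inequality for
    sums over faces can be used with either sign.\<close>
  moreover have "?S (\<lambda>F y. - ?H F y) \<le> 0"
  proof (rule face_sum_nonpos[OF n t])
    show "set_integrable (facet_measure (?w c) l) (facet (?w c) l) (\<lambda>y. - ?H (c, l) y)" if "c \<in> cells M" for c l
      using i[OF that, of l] by (simp add: set_integrable_def)
  qed (use eq in auto)
  then have "- ?S ?H \<le> 0"
    by (simp add: set_lebesgue_integral_def sum_negf)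
  ultimately have S: "?S ?H = 0" by linarith
  have "divergence n t c * (jacobian M n t c * (LINT \<xi>:interior (K_ref :: (real ^ 'd) set)|lborel. 1)) =
      (\<Sum>l\<in>UNIV. LINT x:facet (?w c) l|facet_measure (?w c) l. ?H (c, l) x)" if c: "c \<in> cells M" for c
  proof -
    note nd = nondeg[OF n t c]
    \<comment> \<open>The energy identity with U = 1 and zero flux is the divergence theorem for the
      field - \<omega> / 2.\<close>
    have "(LINT x:convex hull (range (?w c))|lborel. - (divergence n t c / 2)) =
        (\<Sum>l\<in>UNIV. LINT x:facet (?w c) l|facet_measure (?w c) l. - (?H (c, l) x / 2))"
      using simplex_energy_identity[OF nd, of "\<lambda>y. 0" "\<lambda>y. 0" "\<lambda>x. 1" "\<lambda>x. 0" "?v c"]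
      by (simp add: GDERIV_const divergence_def inner_commute)
    moreover have "(LINT x:convex hull (range (?w c))|lborel. - (divergence n t c / 2)) =
        - (divergence n t c / 2) * measure lebesgue (convex hull (range (?w c)))"
      using compact_simplex[of "?w c"] by (simp add: set_lebesgue_integral_def compact_imp_closed)
    moreover have "(\<Sum>l\<in>UNIV. LINT x:facet (?w c) l|facet_measure (?w c) l. - (?H (c, l) x / 2)) =
        - (\<Sum>l\<in>UNIV. LINT x:facet (?w c) l|facet_measure (?w c) l. ?H (c, l) x) / 2"
      by (simp add: set_lebesgue_integral_def sum_negf sum_divide_distrib)
    ultimately show ?thesis
      using jacobian_pos[OF n t c] by (simp add: measure_simplex_cell[OF nd] jacobian_def)
  qed
  then have "(\<Sum>c\<in>cells M. divergence n t c * (jacobian M n t c * (LINT \<xi>:interior (K_ref :: (real ^ 'd) set)|lborel. 1))) = ?S ?H"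
    by (intro sum.cong refl) blast
  moreover have "(\<Sum>c\<in>cells M. jacobian M n t c * divergence n t c) * m =
      (\<Sum>c\<in>cells M. divergence n t c * (jacobian M n t c * m))" for m
    unfolding sum_distrib_right by (rule sum.cong) auto
  ultimately show ?thesis
    by (simp only: S)
qed

lemma volume_constant:
  assumes n: "n < num_steps M" and t: "t \<in> time_slab M n"
  shows "(\<Sum>c\<in>cells M. measure lebesgue (cell M n t c)) = (\<Sum>c\<in>cells M. measure lebesgue (cell_of (level_vertices M n c)))"
proof -
  let ?m = "LINT \<xi>:interior (K_ref :: (real ^ 'd) set)|lborel. (1::real)"
  let ?V = "\<lambda>t. \<Sum>c\<in>cells M. jacobian M n t c * ?m"
  have vol: "(\<Sum>c\<in>cells M. measure lebesgue (cell M n t c)) = ?V t" if t: "t \<in> time_slab M n" for t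
  proof (rule sum.cong[OF refl])
    fix c assume c: "c \<in> cells M"
    show "measure lebesgue (cell M n t c) = jacobian M n t c * ?m"
      using jacobian_pos[OF n t c] measure_simplex_cell(2)[OF nondeg[OF n t c]]
      by (simp add: cell_def jacobian_def)
  qed
  have "(?V has_real_derivative 0) (at t within time_slab M n)" if t: "t \<in> time_slab M n" for t
  proof -
    have "(?V has_real_derivative (\<Sum>c\<in>cells M. jacobian M n t c * divergence n t c * ?m)) (at t)"
      unfolding divergence_def
      by (intro DERIV_sum DERIV_cmult_right jacobian_derivative nondeg n t)
    then show ?thesis
      using volume_derivative_zero[OF n t]
      by (simp add: sum_distrib_right has_field_derivative_at_within)
  qed
  then obtain C where "\<And>t. t \<in> time_slab M n \<Longrightarrow> ?V t = C"
    using has_field_derivative_zero_constant[of "time_slab M n" ?V] by (auto simp: time_slab_def)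
  then have "?V t = ?V (time_level M n)"
    using t level_in_slab(1)[OF n] by metis
  then show ?thesis
    using vol[OF t] vol[OF level_in_slab(1)[OF n]] by (simp add: cell_def vertices_level)
qed

section \<open>Disjointness of the moving cells\<close>

lemma closure_domain_level:
  "n \<le> num_steps M \<Longrightarrow> closure \<Omega> = (\<Union>c\<in>cells M. convex hull (range (level_vertices M n c)))"
  using conforming by (simp add: conforming_mesh_at_def)

lemma compact_closure_domain: "compact (closure \<Omega>)"
  unfolding closure_domain_level[OF le0] by (intro compact_UN finite_cells compact_simplex)

lemma closure_cell: "n < num_steps M \<Longrightarrow> t \<in> time_slab M n \<Longrightarrow> c \<in> cells M \<Longrightarrow>
    closure (cell M n t c) = convex hull (range (vertices M n t c))"
  by (simp add: cell_def closure_cell_of nondeg)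

lemma closure_domain_slab: "n < num_steps M \<Longrightarrow> t \<in> time_slab M n \<Longrightarrow>
    closure \<Omega> = (\<Union>c\<in>cells M. convex hull (range (vertices M n t c)))"
  using moving closure_cell by (simp add: moving_mesh_def)

lemma cells_disjoint:
  assumes n: "n < num_steps M" and t: "t \<in> time_slab M n" and c: "c \<in> cells M" "c' \<in> cells M" "c \<noteq> c'"
  shows "cell M n t c \<inter> cell M n t c' = {}"
proof (rule ccontr)
  assume ne: "cell M n t c \<inter> cell M n t c' \<noteq> {}"
  let ?S = "\<lambda>c. convex hull (range (vertices M n t c))"
  let ?m = "measure lebesgue"
  have S: "?S c \<in> lmeasurable" for c
    by (rule lmeasurable_compact[OF compact_simplex])
  have cellS: "cell M n t c \<subseteq> ?S c" for c
    by (simp add: cell_def cell_of_def interior_subset)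
  have lev: "cell_of (level_vertices M n c) \<in> lmeasurable" for c
    unfolding cell_of_def by (intro lmeasurable_interior compact_imp_bounded compact_simplex)
  have "(\<Sum>c\<in>cells M. ?m (?S c)) = (\<Sum>c\<in>cells M. ?m (cell M n t c))"
    by (rule sum.cong) (simp_all add: cell_def measure_simplex_cell(1) nondeg n t)
  also have "\<dots> = (\<Sum>c\<in>cells M. ?m (cell_of (level_vertices M n c)))"
    by (rule volume_constant[OF n t])
  \<comment> \<open>Disjointness enters only at the time level, where it comes from the
    triangulation.\<close>
  also have "\<dots> = ?m (\<Union>c\<in>cells M. cell_of (level_vertices M n c))"
    by (rule measure_UNION'[symmetric])
       (use finite_cells lev level_cells_disjoint n in \<open>auto simp: pairwise_def disjnt_def\<close>)
  also have "\<dots> \<le> ?m (closure \<Omega>)"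
  proof (rule measure_mono_fmeasurable)
    show "(\<Union>c\<in>cells M. cell_of (level_vertices M n c)) \<subseteq> closure \<Omega>"
      unfolding closure_domain_level[OF less_imp_le[OF n]] cell_of_def
      using interior_subset by blast
    show "(\<Union>c\<in>cells M. cell_of (level_vertices M n c)) \<in> sets lebesgue"
      using lev finite_cells by (intro sets.finite_UN) auto
    show "closure \<Omega> \<in> lmeasurable"
      by (rule lmeasurable_compact[OF compact_closure_domain])
  qed
  finally have 1: "(\<Sum>c\<in>cells M. ?m (?S c)) \<le> ?m (closure \<Omega>)" .
  have 2: "closure \<Omega> = (?S c \<union> ?S c') \<union> (\<Union>c\<in>cells M - {c, c'}. ?S c)"
    using c unfolding closure_domain_slab[OF n t] by blast
  have 3: "?m ((?S c \<union> ?S c') \<union> (\<Union>c\<in>cells M - {c, c'}. ?S c)) \<le>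
      ?m (?S c \<union> ?S c') + ?m (\<Union>c\<in>cells M - {c, c'}. ?S c)"
    using S c finite_cells by (intro measure_Un_le sets.Un sets.finite_UN) auto
  have 4: "?m (\<Union>c\<in>cells M - {c, c'}. ?S c) \<le> (\<Sum>c\<in>cells M - {c, c'}. ?m (?S c))"
    by (rule measure_UNION_le) (use S finite_cells in auto)
  have 5: "?m (?S c \<union> ?S c') = ?m (?S c) + ?m (?S c') - ?m (?S c \<inter> ?S c')"
    by (rule measure_Un3) (use S c in auto)
  have 6: "(\<Sum>c\<in>cells M. ?m (?S c)) = ?m (?S c) + ?m (?S c') + (\<Sum>c\<in>cells M - {c, c'}. ?m (?S c))"
    using c sum.subset_diff[of "{c, c'}" "cells M" "\<lambda>c. ?m (?S c)"] finite_cells by simp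
  have "?m (?S c \<inter> ?S c') \<le> 0"
    using 1 3 4 5 6 unfolding 2[symmetric] by linarith
  moreover have "?m (cell M n t c \<inter> cell M n t c') \<le> ?m (?S c \<inter> ?S c')"
    using cellS S c by (intro measure_mono_fmeasurable) (auto simp: cell_def fmeasurable.Int)
  ultimately have "?m (cell M n t c \<inter> cell M n t c') = 0"
    by (meson measure_nonneg order_antisym order_trans)
  moreover have "cell M n t c \<inter> cell M n t c' \<in> lmeasurable"
    by (rule fmeasurableI2[of "?S c"]) (use cellS S c in \<open>auto simp: cell_def\<close>)
  ultimately have "negligible (cell M n t c \<inter> cell M n t c')"
    by (simp add: negligible_iff_measure)
  moreover have "open (cell M n t c \<inter> cell M n t c')"
    by (simp add: cell_def cell_of_def open_Int)
  ultimately show False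
    using ne open_not_negligible by blast
qed

end

section \<open>Energy\<close>

lemma integrable_K_ref:
  fixes h :: "real ^ 'd \<Rightarrow> real"
  assumes "continuous_on UNIV h"
  shows "integrable lborel (\<lambda>\<xi>. indicator (interior K_ref) \<xi> *\<^sub>R h \<xi>)"
proof -
  have "bounded (interior K_ref :: (real ^ 'd) set)"
  proof (rule boundedI)
    fix \<xi> :: "real ^ 'd" assume "\<xi> \<in> interior K_ref"
    then have p: "\<And>i. 0 < \<xi> $ i" and s: "(\<Sum>i\<in>UNIV. \<xi> $ i) < 1" by (auto simp: interior_K_ref)
    have "norm \<xi> \<le> (\<Sum>i\<in>UNIV. \<bar>\<xi> $ i\<bar>)" by (rule norm_le_l1_cart)
    also have "\<dots> \<le> 1" using p s by (simp add: less_imp_le)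
    finally show "norm \<xi> \<le> 1" .
  qed
  then have "compact (closure (interior K_ref :: (real ^ 'd) set))" by simp
  then have "set_integrable lborel (closure (interior K_ref)) h"
    unfolding set_integrable_def by (intro borel_integrable_compact continuous_on_subset[OF assms]) auto
  then have "set_integrable lborel (interior K_ref) h"
    by (rule set_integrable_subset) (auto simp: closure_subset[THEN subsetD])
  then show ?thesis by (simp add: set_integrable_def)
qed

definition ref_mass :: "('d::finite \<Rightarrow> nat) \<Rightarrow> ('d \<Rightarrow> nat) \<Rightarrow> real" where
  "ref_mass \<alpha> \<beta> = (LINT \<xi>:interior K_ref|lborel. monomial_at \<alpha> \<xi> * monomial_at \<beta> \<xi>)"

lemma ref_mass_commute: "ref_mass \<alpha> \<beta> = ref_mass \<beta> \<alpha>"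
  by (simp add: ref_mass_def mult.commute)

lemma integral_poly_product:
  "(LINT \<xi>:interior K_ref|lborel. poly_at k a \<xi> * poly_at k b \<xi>) =
    (\<Sum>\<alpha>\<in>multi_indices k. \<Sum>\<beta>\<in>multi_indices k. a \<alpha> * b \<beta> * ref_mass \<alpha> \<beta>)"
proof -
  let ?I = "\<lambda>\<alpha> \<beta> \<xi>. indicator (interior K_ref) \<xi> *\<^sub>R (monomial_at \<alpha> \<xi> * monomial_at \<beta> \<xi>)"
  have i: "integrable lborel (?I \<alpha> \<beta>)" for \<alpha> \<beta> :: "'a \<Rightarrow> nat"
    by (intro integrable_K_ref continuous_intros continuous_on_monomial)
  have eq: "indicator (interior K_ref) \<xi> *\<^sub>R (poly_at k a \<xi> * poly_at k b \<xi>) =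
      (\<Sum>\<alpha>\<in>multi_indices k. \<Sum>\<beta>\<in>multi_indices k. a \<alpha> * b \<beta> * ?I \<alpha> \<beta> \<xi>)" for \<xi> :: "real ^ 'a"
    unfolding poly_at_def sum_product scaleR_sum_right by (intro sum.cong refl) simp
  have "(\<integral>\<xi>. (\<Sum>\<alpha>\<in>multi_indices k. \<Sum>\<beta>\<in>multi_indices k. a \<alpha> * b \<beta> * ?I \<alpha> \<beta> \<xi>) \<partial>lborel) =
      (\<Sum>\<alpha>\<in>multi_indices k. \<integral>\<xi>. (\<Sum>\<beta>\<in>multi_indices k. a \<alpha> * b \<beta> * ?I \<alpha> \<beta> \<xi>) \<partial>lborel)"
    by (intro Bochner_Integration.integral_sum Bochner_Integration.integrable_sum integrable_mult_right i)
  also have "\<dots> = (\<Sum>\<alpha>\<in>multi_indices k. \<Sum>\<beta>\<in>multi_indices k. \<integral>\<xi>. a \<alpha> * b \<beta> * ?I \<alpha> \<beta> \<xi> \<partial>lborel)"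
    by (intro sum.cong refl Bochner_Integration.integral_sum integrable_mult_right i)
  finally show ?thesis
    unfolding set_lebesgue_integral_def ref_mass_def eq integral_mult_right_zero .
qed

text \<open>Turns the choices behind existential statements into parameters: a primitive
  \<open>F\<close> of the flux, and the coefficients \<open>a\<close> of the solution on every
  cell.\<close>

locale ale_dg = periodic_mesh \<Omega> M partner shift
  for \<Omega> :: "(real ^ 'd::finite) set" and M :: "('d, 'c, 'v) mesh"
    and partner :: "'c \<times> 'd option \<Rightarrow> 'c \<times> 'd option" and shift :: "'c \<times> 'd option \<Rightarrow> real ^ 'd" +
  fixes k :: nat and f :: "real \<Rightarrow> real ^ 'd" and ghat :: "real ^ 'd \<Rightarrow> real \<Rightarrow> real \<Rightarrow> real ^ 'd \<Rightarrow> real"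
    and u :: "real \<Rightarrow> real ^ 'd \<Rightarrow> real" and F :: "real \<Rightarrow> real ^ 'd"
    and a :: "'c \<Rightarrow> ('d \<Rightarrow> nat) \<Rightarrow> real \<Rightarrow> real"
  assumes cont_f: "continuous_on UNIV f" and flux: "numerical_flux f ghat"
    and sol: "ale_dg_solution \<Omega> M partner shift k f ghat u"
    and F: "\<And>y. (F has_vector_derivative f y) (at y)"
    and coeff_diff: "\<And>c \<alpha> n. c \<in> cells M \<Longrightarrow> \<alpha> \<in> multi_indices k \<Longrightarrow> n < num_steps M \<Longrightarrow>
        a c \<alpha> differentiable_on time_slab M n"
    and coeff: "\<And>c n t \<xi>. c \<in> cells M \<Longrightarrow> n < num_steps M \<Longrightarrow> t \<in> time_slab M n \<Longrightarrow> \<xi> \<in> interior K_ref \<Longrightarrow>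
        u t (cell_map M n t c \<xi>) = poly_at k (\<lambda>\<alpha>. a c \<alpha> t) \<xi>"
begin

text \<open>The polynomial which the solution equals on cell \<open>c\<close>, extended to the whole
  space; its values on the facets are the traces.\<close>

definition ext :: "nat \<Rightarrow> real \<Rightarrow> 'c \<Rightarrow> real ^ 'd \<Rightarrow> real" where
  "ext n t c x = poly_at k (\<lambda>\<alpha>. a c \<alpha> t) (inv (cell_map M n t c) x)"

lemma cell_eq_image: "n < num_steps M \<Longrightarrow> t \<in> time_slab M n \<Longrightarrow> c \<in> cells M \<Longrightarrow>
    cell M n t c = cell_map M n t c ` interior K_ref"
  by (simp add: cell_def cell_map_def cell_of_eq_ref_map_image nondeg)

lemma inv_cell_map: "n < num_steps M \<Longrightarrow> t \<in> time_slab M n \<Longrightarrow> c \<in> cells M \<Longrightarrow>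
    inv (cell_map M n t c) (cell_map M n t c \<xi>) = \<xi>"
  by (simp add: cell_map_def inv_ref_map_ref_map nondeg)

lemma u_eq_ext:
  assumes n: "n < num_steps M" and t: "t \<in> time_slab M n" and c: "c \<in> cells M" and x: "x \<in> cell M n t c"
  shows "u t x = ext n t c x"
proof -
  obtain \<xi> where "\<xi> \<in> interior K_ref" "x = cell_map M n t c \<xi>"
    using x by (auto simp: cell_eq_image[OF n t c])
  then show ?thesis by (simp add: ext_def coeff[OF c n t] inv_cell_map[OF n t c])
qed

lemma cont_grad_ext: "n < num_steps M \<Longrightarrow> t \<in> time_slab M n \<Longrightarrow> c \<in> cells M \<Longrightarrow> cont_grad (ext n t c)"
  unfolding ext_def[abs_def] cell_map_def by (intro cont_grad_poly nondeg)

text \<open>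
  Test functions are constant along the mesh motion, so the equation at time \<open>s\<close> is tested with
  the solution at time \<open>s\<close>, transported to all other times \<open>t\<close> of the slab.
\<close>

definition frozen :: "nat \<Rightarrow> real \<Rightarrow> real \<Rightarrow> real ^ 'd \<Rightarrow> real" where
  "frozen n s t x = (\<Sum>c\<in>cells M. indicator (cell M n t c) x * poly_at k (\<lambda>\<alpha>. a c \<alpha> s) (inv (cell_map M n t c) x))"

lemma frozen_eq:
  assumes n: "n < num_steps M" and t: "t \<in> time_slab M n" and c: "c \<in> cells M" and x: "x \<in> cell M n t c"
  shows "frozen n s t x = poly_at k (\<lambda>\<alpha>. a c \<alpha> s) (inv (cell_map M n t c) x)"
proof -
  have "frozen n s t x = (\<Sum>c'\<in>{c}. indicator (cell M n t c') x * poly_at k (\<lambda>\<alpha>. a c' \<alpha> s) (inv (cell_map M n t c') x))"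
    unfolding frozen_def
  proof (rule sum.mono_neutral_right)
    \<comment> \<open>Disjointness of the cells removes all other summands.\<close>
    show "\<forall>c'\<in>cells M - {c}. indicator (cell M n t c') x * poly_at k (\<lambda>\<alpha>. a c' \<alpha> s) (inv (cell_map M n t c') x) = 0"
      using cells_disjoint[OF n t c] x by (auto simp: indicator_def)
  qed (use c finite_cells in auto)
  then show ?thesis using x by simp
qed

text \<open>Square integrability holds because polynomials are bounded on the compact simplices and
  the domain, whose closure is a finite union of simplices, has finite measure.\<close>

lemma frozen_test_function:
  assumes n: "n < num_steps M"
  shows "test_function \<Omega> M k n (frozen n s)"
  unfolding test_function_def
proof (intro conjI ballI)
  fix t assume t: "t \<in> time_slab M n"
  let ?p = "\<lambda>c x. poly_at k (\<lambda>\<alpha>. a c \<alpha> s) (inv (cell_map M n t c) x)"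
  have cp: "continuous_on UNIV (?p c)" if "c \<in> cells M" for c
    unfolding cell_map_def by (intro cont_grad_continuous cont_grad_poly nondeg n t that)
  have [measurable]: "?p c \<in> borel_measurable borel" if "c \<in> cells M" for c
    by (rule borel_measurable_continuous_onI[OF cp[OF that]])
  have [measurable]: "cell M n t c \<in> sets borel" for c
    by (simp add: cell_def)
  have meas: "frozen n s t \<in> borel_measurable borel"
    unfolding frozen_def[abs_def] by measurable
  have meas': "frozen n s t \<in> borel_measurable lebesgue"
    using meas by (intro measurable_completion) simp
  have Om: "\<Omega> \<in> sets lebesgue" using open_\<Omega> by auto
  have "\<exists>B. \<forall>x\<in>cell M n t c. \<bar>?p c x\<bar> \<le> B" if c: "c \<in> cells M" for c
  proof -
    have "bounded (?p c ` (convex hull (range (vertices M n t c))))"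
      by (intro compact_imp_bounded compact_continuous_image compact_simplex continuous_on_subset[OF cp[OF c]]) auto
    then obtain B where "\<forall>x\<in>convex hull (range (vertices M n t c)). \<bar>?p c x\<bar> \<le> B"
      by (auto simp: bounded_iff)
    then show ?thesis
      using interior_subset unfolding cell_def cell_of_def by blast
  qed
  then obtain B where B: "\<And>c x. c \<in> cells M \<Longrightarrow> x \<in> cell M n t c \<Longrightarrow> \<bar>?p c x\<bar> \<le> B c"
    by metis
  have bound: "\<bar>frozen n s t x\<bar> \<le> (\<Sum>c\<in>cells M. \<bar>B c\<bar>)" for x
    unfolding frozen_def
    by (rule order_trans[OF sum_abs sum_mono]) (use B in \<open>fastforce simp: indicator_def\<close>)
  have "\<Omega> \<in> lmeasurable"
    by (rule bounded_set_imp_lmeasurable)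
      (use compact_imp_bounded[OF compact_closure_domain] bounded_subset closure_subset Om in blast)+
  then have fin: "emeasure lebesgue \<Omega> < \<infinity>"
    by (simp add: fmeasurable_def del: emeasure_completion)
  have "set_integrable lebesgue \<Omega> (\<lambda>x. (frozen n s t x)\<^sup>2)"
    unfolding set_integrable_def
  proof (rule integrableI_bounded_set_indicator[OF Om _ fin, where B = "(\<Sum>c\<in>cells M. \<bar>B c\<bar>)\<^sup>2"])
    show "(\<lambda>x. (frozen n s t x)\<^sup>2) \<in> borel_measurable lebesgue"
      using meas' by measurable
    have "norm ((frozen n s t x)\<^sup>2) \<le> (\<Sum>c\<in>cells M. \<bar>B c\<bar>)\<^sup>2" for x
      using power_mono[OF bound[of x], of 2] by simp
    then show "AE x in lebesgue. x \<in> \<Omega> \<longrightarrow> norm ((frozen n s t x)\<^sup>2) \<le> (\<Sum>c\<in>cells M. \<bar>B c\<bar>)\<^sup>2"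
      by simp
  qed
  moreover have "set_borel_measurable lebesgue \<Omega> (frozen n s t)"
    unfolding set_borel_measurable_def using Om meas' by measurable
  ultimately have "frozen n s t \<in> L2_functions \<Omega>"
    by (simp add: L2_functions_def)
  moreover have "\<exists>p\<in>poly_space k. \<forall>\<xi>\<in>interior K_ref. frozen n s t (cell_map M n t c \<xi>) = p \<xi>"
    if c: "c \<in> cells M" for c
  proof (rule bexI[of _ "poly_at k (\<lambda>\<alpha>. a c \<alpha> s)"])
    show "poly_at k (\<lambda>\<alpha>. a c \<alpha> s) \<in> poly_space k"
      by (auto simp: poly_space_def poly_at_def[abs_def])
    show "\<forall>\<xi>\<in>interior K_ref. frozen n s t (cell_map M n t c \<xi>) = poly_at k (\<lambda>\<alpha>. a c \<alpha> s) \<xi>"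
      by (simp add: frozen_eq[OF n t c] cell_eq_image[OF n t c] inv_cell_map[OF n t c])
  qed
  ultimately show "frozen n s t \<in> dg_space \<Omega> M k n t"
    by (simp add: dg_space_def)
next
  fix c t t' and \<xi> :: "real ^ 'd" assume c: "c \<in> cells M" and \<xi>: "\<xi> \<in> interior K_ref"
    and t: "t \<in> time_slab M n" and t': "t' \<in> time_slab M n"
  show "frozen n s t (cell_map M n t c \<xi>) = frozen n s t' (cell_map M n t' c \<xi>)"
    using \<xi> by (simp add: frozen_eq[OF n t c] frozen_eq[OF n t' c] cell_eq_image[OF n t c]
        cell_eq_image[OF n t' c] inv_cell_map[OF n t c] inv_cell_map[OF n t' c])
qed

text \<open>Pulled back to the reference simplex, both integrals are the Jacobian times a form in
  the coefficients with time-independent entries, so they can be differentiated in time as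
  products.\<close>

lemma
  assumes n: "n < num_steps M" and t: "t \<in> time_slab M n" and c: "c \<in> cells M"
  shows integral_u_frozen: "(LINT x:cell M n t c|lebesgue. u t x * frozen n s t x) =
      jacobian M n t c * (\<Sum>\<alpha>\<in>multi_indices k. \<Sum>\<beta>\<in>multi_indices k. a c \<alpha> t * a c \<beta> s * ref_mass \<alpha> \<beta>)"
    and integral_u_square: "(LINT x:cell M n t c|lebesgue. (u t x)\<^sup>2) =
      jacobian M n t c * (\<Sum>\<alpha>\<in>multi_indices k. \<Sum>\<beta>\<in>multi_indices k. a c \<alpha> t * a c \<beta> t * ref_mass \<alpha> \<beta>)"
proof -
  have I: "(LINT x:cell M n t c|lebesgue. ext n t c x * poly_at k b (inv (cell_map M n t c) x)) =
      jacobian M n t c * (\<Sum>\<alpha>\<in>multi_indices k. \<Sum>\<beta>\<in>multi_indices k. a c \<alpha> t * b \<beta> * ref_mass \<alpha> \<beta>)" for b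
  proof -
    have "(\<lambda>\<xi>. poly_at k (\<lambda>\<alpha>. a c \<alpha> t) \<xi> * poly_at k b \<xi>) \<in> borel_measurable borel"
      by (intro borel_measurable_continuous_onI continuous_intros continuous_on_poly_at)
    from cell_integral_ref_map[OF nondeg[OF n t c] this] show ?thesis
      using jacobian_pos[OF n t c] unfolding integral_poly_product
      by (simp add: ext_def cell_def cell_map_def jacobian_def)
  qed
  have m: "cell M n t c \<in> sets lebesgue" by (simp add: cell_def)
  have "(LINT x:cell M n t c|lebesgue. u t x * frozen n s t x) =
      (LINT x:cell M n t c|lebesgue. ext n t c x * poly_at k (\<lambda>\<alpha>. a c \<alpha> s) (inv (cell_map M n t c) x))"
    by (rule set_lebesgue_integral_cong[OF m]) (use u_eq_ext[OF n t c] frozen_eq[OF n t c] in auto)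
  then show "(LINT x:cell M n t c|lebesgue. u t x * frozen n s t x) =
      jacobian M n t c * (\<Sum>\<alpha>\<in>multi_indices k. \<Sum>\<beta>\<in>multi_indices k. a c \<alpha> t * a c \<beta> s * ref_mass \<alpha> \<beta>)"
    by (simp add: I)
  have "(LINT x:cell M n t c|lebesgue. (u t x)\<^sup>2) =
      (LINT x:cell M n t c|lebesgue. ext n t c x * poly_at k (\<lambda>\<alpha>. a c \<alpha> t) (inv (cell_map M n t c) x))"
    by (rule set_lebesgue_integral_cong[OF m]) (use u_eq_ext[OF n t c] in \<open>auto simp: ext_def power2_eq_square\<close>)
  then show "(LINT x:cell M n t c|lebesgue. (u t x)\<^sup>2) =
      jacobian M n t c * (\<Sum>\<alpha>\<in>multi_indices k. \<Sum>\<beta>\<in>multi_indices k. a c \<alpha> t * a c \<beta> t * ref_mass \<alpha> \<beta>)"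
    by (simp add: I)
qed

text \<open>At time \<open>s\<close> the bilinear form \<open>?q\<close> and the quadratic form
  \<open>?r\<close> agree, but the derivative of \<open>?r\<close> is twice that of
  \<open>?q\<close>. Expressing the latter through the right hand side \<open>?D\<close> leaves one
  surplus Jacobian term, which appears with a minus sign.\<close>

lemma energy_derivative:
  assumes n: "n < num_steps M" and s: "s \<in> time_slab M n" and c: "c \<in> cells M"
  shows "((\<lambda>t. LINT x:cell M n t c|lebesgue. (u t x)\<^sup>2) has_real_derivative
    2 * (volume_term M f n s c (u s) (frozen n s s) - boundary_term M partner shift ghat n s c (u s) (frozen n s s))
    - divergence n s c * (LINT x:cell M n s c|lebesgue. (u s x)\<^sup>2)) (at s within time_slab M n)"
proof -
  let ?I = "multi_indices k :: ('d \<Rightarrow> nat) set"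
  let ?D = "volume_term M f n s c (u s) (frozen n s s) - boundary_term M partner shift ghat n s c (u s) (frozen n s s)"
  let ?J = "\<lambda>t. jacobian M n t c"
  let ?q = "\<lambda>t. \<Sum>\<alpha>\<in>?I. \<Sum>\<beta>\<in>?I. a c \<alpha> t * a c \<beta> s * ref_mass \<alpha> \<beta>"
  let ?r = "\<lambda>t. \<Sum>\<alpha>\<in>?I. \<Sum>\<beta>\<in>?I. a c \<alpha> t * a c \<beta> t * ref_mass \<alpha> \<beta>"
  have "\<exists>d. (a c \<alpha> has_real_derivative d) (at s within time_slab M n)" if "\<alpha> \<in> ?I" for \<alpha>
    using coeff_diff[OF c that n] s by (simp add: differentiable_on_def real_differentiable_def)
  then have "\<forall>\<alpha>\<in>?I. \<exists>d. (a c \<alpha> has_real_derivative d) (at s within time_slab M n)" by blast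
  from bchoice[OF this] obtain d where
    d: "\<And>\<alpha>. \<alpha> \<in> ?I \<Longrightarrow> (a c \<alpha> has_real_derivative d \<alpha>) (at s within time_slab M n)"
    by blast
  let ?q' = "\<Sum>\<alpha>\<in>?I. \<Sum>\<beta>\<in>?I. d \<alpha> * a c \<beta> s * ref_mass \<alpha> \<beta>"
  have J: "(?J has_real_derivative ?J s * divergence n s c) (at s within time_slab M n)"
    unfolding divergence_def
    by (rule has_field_derivative_at_within, rule jacobian_derivative, rule nondeg[OF n s c])
  have q: "(?q has_real_derivative ?q') (at s within time_slab M n)"
    by (intro DERIV_sum DERIV_cmult_right d)
  have "(?r has_real_derivative (\<Sum>\<alpha>\<in>?I. \<Sum>\<beta>\<in>?I. (d \<alpha> * a c \<beta> s + d \<beta> * a c \<alpha> s) * ref_mass \<alpha> \<beta>)) (at s within time_slab M n)"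
    by (intro DERIV_sum DERIV_cmult_right DERIV_mult d)
  moreover have "(\<Sum>\<alpha>\<in>?I. \<Sum>\<beta>\<in>?I. (d \<alpha> * a c \<beta> s + d \<beta> * a c \<alpha> s) * ref_mass \<alpha> \<beta>) = 2 * ?q'"
  proof -
    \<comment> \<open>Symmetry of the mass matrix identifies the two halves of the product
      rule.\<close>
    have "(\<Sum>\<alpha>\<in>?I. \<Sum>\<beta>\<in>?I. d \<beta> * a c \<alpha> s * ref_mass \<alpha> \<beta>) = ?q'"
      by (subst sum.swap) (simp add: ref_mass_commute)
    then show ?thesis by (simp add: distrib_right sum.distrib)
  qed
  ultimately have r: "(?r has_real_derivative 2 * ?q') (at s within time_slab M n)" by simp
  have "((\<lambda>t. LINT x:cell M n t c|lebesgue. u t x * frozen n s t x) has_real_derivative ?D) (at s within time_slab M n)"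
    using sol n c s frozen_test_function[OF n, of s] unfolding ale_dg_solution_def by blast
  then have "((\<lambda>t. ?J t * ?q t) has_real_derivative ?D) (at s within time_slab M n)"
    by (rule has_field_derivative_transform_within[OF _ zero_less_one s]) (simp add: integral_u_frozen n c)
  moreover have "((\<lambda>t. ?J t * ?q t) has_real_derivative ?J s * divergence n s c * ?q s + ?q' * ?J s) (at s within time_slab M n)"
    by (rule DERIV_mult[OF J q])
  moreover have "at s within time_slab M n \<noteq> bot"
    using time_level_less[OF n] s unfolding time_slab_def
    by (simp add: trivial_limit_within islimpt_Icc)
  \<comment> \<open>Two derivatives of one function within a nondegenerate interval coincide; this
    reads the method as an equation for the coefficients.\<close>
  ultimately have D: "?D = ?J s * divergence n s c * ?q s + ?q' * ?J s"
    by (rule has_field_derivative_unique)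
  have "((\<lambda>t. ?J t * ?r t) has_real_derivative ?J s * divergence n s c * ?r s + 2 * ?q' * ?J s) (at s within time_slab M n)"
    by (rule DERIV_mult[OF J r])
  then have "((\<lambda>t. LINT x:cell M n t c|lebesgue. (u t x)\<^sup>2) has_real_derivative
      ?J s * divergence n s c * ?r s + 2 * ?q' * ?J s) (at s within time_slab M n)"
    by (rule has_field_derivative_transform_within[OF _ zero_less_one s]) (simp add: integral_u_square n c)
  moreover have "?J s * divergence n s c * ?r s + 2 * ?q' * ?J s =
      2 * ?D - divergence n s c * (LINT x:cell M n s c|lebesgue. (u s x)\<^sup>2)"
    unfolding D integral_u_square[OF n s c] by (simp add: algebra_simps)
  ultimately show ?thesis by simp
qed

text \<open>The normal component of F(u) - u^2 \<omega> / 2, which is a primitive in u of the flux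
  f(u) - u \<omega>, evaluated at the trace.\<close>

definition entropy_flux :: "nat \<Rightarrow> real \<Rightarrow> 'c \<times> 'd option \<Rightarrow> real ^ 'd \<Rightarrow> real" where
  "entropy_flux n s \<Phi> y = (F (ext n s (fst \<Phi>) y) - ((ext n s (fst \<Phi>) y)\<^sup>2 / 2) *\<^sub>R
     affine_velocity (vertices M n s (fst \<Phi>)) (vertex_velocity M n (fst \<Phi>)) y) \<bullet>
     outward_normal (vertices M n s (fst \<Phi>)) (snd \<Phi>)"

lemma continuous_on_F: "continuous_on S F"
  using F by (meson continuous_at_imp_continuous_on has_vector_derivative_continuous)

lemma volume_term_eq:
  assumes n: "n < num_steps M" and s: "s \<in> time_slab M n" and c: "c \<in> cells M"
  shows "volume_term M f n s c (u s) (frozen n s s) - divergence n s c * (LINT x:cell M n s c|lebesgue. (u s x)\<^sup>2) / 2 =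
    (\<Sum>l\<in>UNIV. LINT y:facet (vertices M n s c) l|facet_measure (vertices M n s c) l. entropy_flux n s (c, l) y)"
proof -
  let ?w = "vertices M n s c" and ?v = "vertex_velocity M n c" and ?U = "ext n s c"
  note nd = nondeg[OF n s c]
  obtain g where g: "\<And>x. GDERIV ?U x :> g x" "continuous_on UNIV g"
    using cont_grad_ext[OF n s c] unfolding cont_grad_def by blast
  have cU: "continuous_on S ?U" for S by (rule cont_grad_continuous[OF cont_grad_ext[OF n s c]])
  have m: "cell M n s c \<in> sets lebesgue" by (simp add: cell_def)
  let ?h = "\<lambda>x. (f (?U x) - ?U x *\<^sub>R affine_velocity ?w ?v x) \<bullet> g x"
  have ch: "continuous_on UNIV ?h"
    by (intro continuous_intros cU g(2) continuous_on_affine_velocity continuous_on_compose2[OF cont_f cU]) auto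
  have cs: "continuous_on UNIV (\<lambda>x. (?U x)\<^sup>2 / 2 * divergence n s c)"
    by (intro continuous_intros cU) auto
  have "volume_term M f n s c (u s) (frozen n s s) = (LINT x:cell M n s c|lebesgue. ?h x)"
    unfolding volume_term_def
  proof (rule set_lebesgue_integral_cong[OF m], intro allI impI)
    fix x assume x: "x \<in> cell M n s c"
    have "grad (frozen n s s) x = g x"
    proof (rule grad_eq[OF _ x _ g(1)])
      show "open (cell M n s c)" by (simp add: cell_def cell_of_def)
      show "frozen n s s y = ?U y" if "y \<in> cell M n s c" for y
        using frozen_eq[OF n s c that] by (simp add: ext_def)
    qed
    then show "ale_flux f (grid_velocity M n s c x) (u s x) \<bullet> grad (frozen n s s) x = ?h x"
      by (simp add: ale_flux_def u_eq_ext[OF n s c x] grid_velocity_eq[OF nd time_level_less[OF n] s])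
  qed
  also have "\<dots> = (LINT x:convex hull (range ?w)|lborel. ?h x)"
    unfolding cell_def by (rule cell_integral_eq_simplex[OF nd borel_measurable_continuous_onI[OF ch]])
  finally have 1: "volume_term M f n s c (u s) (frozen n s s) = (LINT x:convex hull (range ?w)|lborel. ?h x)" .
  have "divergence n s c * (LINT x:cell M n s c|lebesgue. (u s x)\<^sup>2) / 2 =
      (LINT x:cell M n s c|lebesgue. (u s x)\<^sup>2 / 2 * divergence n s c)"
    by simp
  also have "\<dots> = (LINT x:cell M n s c|lebesgue. (?U x)\<^sup>2 / 2 * divergence n s c)"
    by (rule set_lebesgue_integral_cong[OF m]) (use u_eq_ext[OF n s c] in auto)
  also have "\<dots> = (LINT x:convex hull (range ?w)|lborel. (?U x)\<^sup>2 / 2 * divergence n s c)"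
    unfolding cell_def by (rule cell_integral_eq_simplex[OF nd borel_measurable_continuous_onI[OF cs]])
  finally have 2: "divergence n s c * (LINT x:cell M n s c|lebesgue. (u s x)\<^sup>2) / 2 =
      (LINT x:convex hull (range ?w)|lborel. (?U x)\<^sup>2 / 2 * divergence n s c)" .
  have "volume_term M f n s c (u s) (frozen n s s) - divergence n s c * (LINT x:cell M n s c|lebesgue. (u s x)\<^sup>2) / 2 =
      (LINT x:convex hull (range ?w)|lborel. ?h x - (?U x)\<^sup>2 / 2 * divergence n s c)"
    unfolding 1 2 by (rule set_integral_diff(2)[symmetric]) (intro integrable_simplex ch cs)+
  also have "\<dots> = (\<Sum>l\<in>UNIV. LINT y:facet ?w l|facet_measure ?w l. entropy_flux n s (c, l) y)"
    using simplex_energy_identity[OF nd cont_f F g, of ?v] by (simp add: entropy_flux_def divergence_def)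
  finally show ?thesis .
qed

lemma interior_trace_u:
  assumes n: "n < num_steps M" and s: "s \<in> time_slab M n" and c: "c \<in> cells M"
    and x: "x \<in> convex hull (range (vertices M n s c))"
  shows "interior_trace M n s c (u s) x = ext n s c x"
    and "interior_trace M n s c (frozen n s s) x = ext n s c x"
proof -
  note tr = trace_from_eq[OF nondeg[OF n s c] x cont_grad_continuous[OF cont_grad_ext[OF n s c]]]
  show "interior_trace M n s c (u s) x = ext n s c x"
    unfolding interior_trace_def cell_def
    by (rule tr) (use u_eq_ext[OF n s c] in \<open>simp add: cell_def\<close>)
  show "interior_trace M n s c (frozen n s s) x = ext n s c x"
    unfolding interior_trace_def cell_def
    by (rule tr) (use frozen_eq[OF n s c] in \<open>simp add: cell_def ext_def\<close>)
qed

lemma face_integrand_eq: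
  assumes n: "n < num_steps M" and s: "s \<in> time_slab M n" and \<Phi>: "\<Phi> \<in> faces M"
    and x: "x \<in> facet (vertices M n s (fst \<Phi>)) (snd \<Phi>)"
  shows "face_integrand M partner shift ghat n s \<Phi> (u s) (frozen n s s) x =
    ghat (affine_velocity (vertices M n s (fst \<Phi>)) (vertex_velocity M n (fst \<Phi>)) x)
      (ext n s (fst \<Phi>) x) (ext n s (fst (nbr \<Phi>)) (x + offset \<Phi>))
      (outward_normal (vertices M n s (fst \<Phi>)) (snd \<Phi>)) * ext n s (fst \<Phi>) x"
proof -
  have c: "fst \<Phi> \<in> cells M" "fst (nbr \<Phi>) \<in> cells M"
    using \<Phi> nbr_faces[OF \<Phi>] by (auto simp: faces_def)
  have x1: "x \<in> convex hull (range (vertices M n s (fst \<Phi>)))"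
    using x facet_subset_simplex by blast
  have x2: "x + offset \<Phi> \<in> convex hull (range (vertices M n s (fst (nbr \<Phi>))))"
    using facet_nbr[OF n s \<Phi> x] facet_subset_simplex by blast
  have "exterior_trace M partner shift n s \<Phi> (u s) x = ext n s (fst (nbr \<Phi>)) (x + offset \<Phi>)"
    using interior_trace_u(1)[OF n s c(2) x2] by (auto simp: exterior_trace_def neighbour_eq offset_def)
  then show ?thesis
    by (simp add: face_integrand_def interior_trace_u[OF n s c(1) x1]
        grid_velocity_eq[OF nondeg[OF n s c(1)] time_level_less[OF n] s])
qed

lemma energy_dissipation:
  assumes n: "n < num_steps M" and s: "s \<in> time_slab M n"
  shows "(\<Sum>c\<in>cells M. 2 * (volume_term M f n s c (u s) (frozen n s s) -
      boundary_term M partner shift ghat n s c (u s) (frozen n s s)) -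
      divergence n s c * (LINT x:cell M n s c|lebesgue. (u s x)\<^sup>2)) \<le> 0"
proof -
  let ?w = "\<lambda>c. vertices M n s c"
  let ?h = "\<lambda>\<Phi>. face_integrand M partner shift ghat n s \<Phi> (u s) (frozen n s s)"
  let ?H = "\<lambda>\<Phi> y. entropy_flux n s \<Phi> y - ?h \<Phi> y"
  have i1: "set_integrable (facet_measure (?w c) l) (facet (?w c) l) (entropy_flux n s (c, l))" if c: "c \<in> cells M" for c l
    unfolding entropy_flux_def[abs_def] fst_conv snd_conv
    by (intro integrable_facet nondeg n s c continuous_intros continuous_on_affine_velocity
        continuous_on_compose2[OF continuous_on_F cont_grad_continuous[OF cont_grad_ext[OF n s c]]]
        cont_grad_continuous[OF cont_grad_ext[OF n s c]]) auto
  have i2: "set_integrable (facet_measure (?w c) l) (facet (?w c) l) (?h (c, l))" if "c \<in> cells M" for c l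
    using sol n that s frozen_test_function[OF n, of s] unfolding ale_dg_solution_def by blast
  have "(\<Sum>c\<in>cells M. \<Sum>l\<in>UNIV. LINT y:facet (?w c) l|facet_measure (?w c) l. ?H (c, l) y) \<le> 0"
  proof (rule face_sum_nonpos[OF n s])
    show "set_integrable (facet_measure (?w c) l) (facet (?w c) l) (?H (c, l))" if "c \<in> cells M" for c l
      by (rule set_integral_diff(1)[OF i1[OF that] i2[OF that]])
    fix \<Phi> x assume \<Phi>: "\<Phi> \<in> faces M" and x: "x \<in> facet (?w (fst \<Phi>)) (snd \<Phi>)"
    let ?\<nu> = "outward_normal (?w (fst \<Phi>)) (snd \<Phi>)"
    let ?\<omega> = "affine_velocity (?w (fst \<Phi>)) (vertex_velocity M n (fst \<Phi>)) x"
    let ?a = "ext n s (fst \<Phi>) x" and ?b = "ext n s (fst (nbr \<Phi>)) (x + offset \<Phi>)"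
    have \<nu>: "norm ?\<nu> = 1"
      using \<Phi> by (intro norm_outward_normal nondeg n s) (auto simp: faces_def)
    note x' = facet_nbr[OF n s \<Phi> x] and \<Phi>' = nbr_faces[OF \<Phi>]
    \<comment> \<open>The neighbour sees the traces exchanged and the normal reversed; (P4)
      expresses its numerical flux by that of the present face.\<close>
    have P4: "ghat ?\<omega> ?a ?b ?\<nu> = - ghat ?\<omega> ?b ?a (- ?\<nu>)"
      using flux \<nu> unfolding numerical_flux_def by blast
    have "?H \<Phi> x + ?H (nbr \<Phi>) (x + offset \<Phi>) =
        (F ?a - (?a\<^sup>2 / 2) *\<^sub>R ?\<omega>) \<bullet> ?\<nu> - (F ?b - (?b\<^sup>2 / 2) *\<^sub>R ?\<omega>) \<bullet> ?\<nu> - ghat ?\<omega> ?a ?b ?\<nu> * (?a - ?b)"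
      unfolding face_integrand_eq[OF n s \<Phi> x] face_integrand_eq[OF n s \<Phi>' x'] entropy_flux_def
        affine_velocity_nbr[OF n s \<Phi> x] outward_normal_nbr[OF n s \<Phi>] nbr_nbr[OF \<Phi>] offset_nbr[OF \<Phi>]
      by (simp add: P4 algebra_simps)
    also have "\<dots> \<le> 0"
      by (rule flux_dissipation[OF flux F \<nu>])
    finally show "?H \<Phi> x + ?H (nbr \<Phi>) (x + offset \<Phi>) \<le> 0" .
  qed
  moreover have "2 * (volume_term M f n s c (u s) (frozen n s s) -
      boundary_term M partner shift ghat n s c (u s) (frozen n s s)) -
      divergence n s c * (LINT x:cell M n s c|lebesgue. (u s x)\<^sup>2) =
      2 * (\<Sum>l\<in>UNIV. LINT y:facet (?w c) l|facet_measure (?w c) l. ?H (c, l) y)" if c: "c \<in> cells M" for c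
  proof -
    have "(\<Sum>l\<in>UNIV. LINT y:facet (?w c) l|facet_measure (?w c) l. ?H (c, l) y) =
        (\<Sum>l\<in>UNIV. LINT y:facet (?w c) l|facet_measure (?w c) l. entropy_flux n s (c, l) y) -
        boundary_term M partner shift ghat n s c (u s) (frozen n s s)"
      unfolding boundary_term_def sum_subtractf[symmetric]
      by (rule sum.cong[OF refl]) (rule set_integral_diff(2)[OF i1[OF c] i2[OF c]])
    then show ?thesis using volume_term_eq[OF n s c] by simp
  qed
  ultimately show ?thesis
    by (simp add: sum_distrib_left[symmetric])
qed

section \<open>Decay of the energy in time\<close>

definition energy :: "nat \<Rightarrow> real \<Rightarrow> real" where
  "energy n t = (\<Sum>c\<in>cells M. LINT x:cell M n t c|lebesgue. (u t x)\<^sup>2)"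

text \<open>Restricted to one slab because at its ends only one-sided derivatives are available;
  continuity up to the ends bridges the gap.\<close>

lemma energy_antimono:
  assumes n: "n < num_steps M" and t: "t \<in> time_slab M n"
  shows "energy n t \<le> energy n (time_level M n)"
proof (cases "time_level M n < t")
  case True
  have D: "\<exists>d. (energy n has_real_derivative d) (at s within time_slab M n) \<and> d \<le> 0"
    if s: "s \<in> time_slab M n" for s
  proof -
    have "(energy n has_real_derivative (\<Sum>c\<in>cells M. 2 * (volume_term M f n s c (u s) (frozen n s s) -
        boundary_term M partner shift ghat n s c (u s) (frozen n s s)) -
        divergence n s c * (LINT x:cell M n s c|lebesgue. (u s x)\<^sup>2))) (at s within time_slab M n)"
      unfolding energy_def[abs_def] by (intro DERIV_sum energy_derivative n s)
    then show ?thesis using energy_dissipation[OF n s] by blast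
  qed
  have sub: "{time_level M n..t} \<subseteq> time_slab M n"
    using t by (auto simp: time_slab_def)
  show ?thesis
  proof (rule DERIV_nonpos_imp_decreasing_open[OF less_imp_le[OF True]])
    fix s assume s: "time_level M n < s" "s < t"
    then have "s \<in> time_slab M n" using sub by auto
    moreover have "at s within time_slab M n = at s"
      using s t unfolding time_slab_def by (intro at_within_Icc_at) auto
    ultimately show "\<exists>y. DERIV (energy n) s :> y \<and> y \<le> 0" using D by metis
  next
    have "continuous_on (time_slab M n) (energy n)"
      using D by (meson DERIV_continuous continuous_on_eq_continuous_within)
    then show "continuous_on {time_level M n..t} (energy n)"
      by (rule continuous_on_subset[OF _ sub])
  qed
next
  case False
  then have "t = time_level M n" using t by (simp add: time_slab_def)
  then show ?thesis by simp
qed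

text \<open>The slabs on both sides of a time level describe the same cells there, although their
  grid velocities may differ.\<close>

lemma energy_next:
  assumes "Suc n < num_steps M"
  shows "energy n (time_level M (Suc n)) = energy (Suc n) (time_level M (Suc n))"
  using assms by (simp add: energy_def cell_def vertices_next_level vertices_level)

lemma energy_le_initial:
  assumes "n < num_steps M" "t \<in> time_slab M n"
  shows "energy n t \<le> energy 0 0"
proof -
  have "energy n (time_level M n) \<le> energy 0 0"
    using assms(1)
  proof (induction n)
    case 0
    then show ?case using moving by (simp add: moving_mesh_def)
  next
    case (Suc n)
    then have "energy (Suc n) (time_level M (Suc n)) \<le> energy n (time_level M n)"
      using energy_antimono[of n "time_level M (Suc n)"] level_in_slab(2)[of n] energy_next[of n] by simp
    with Suc show ?case by simp
  qed
  then show ?thesis using energy_antimono[OF assms] by simp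
qed

section \<open>Energy and norm on the domain\<close>

lemma integrable_u_square_cell:
  assumes n: "n < num_steps M" and t: "t \<in> time_slab M n" and c: "c \<in> cells M"
  shows "set_integrable lebesgue (cell M n t c) (\<lambda>x. (u t x)\<^sup>2)"
proof -
  have "set_integrable lebesgue (cell M n t c) (\<lambda>x. (ext n t c x)\<^sup>2)"
    unfolding cell_def
    by (intro integrable_cell n t c continuous_intros cont_grad_continuous cont_grad_ext)
  moreover have "(\<lambda>x. indicator (cell M n t c) x *\<^sub>R (ext n t c x)\<^sup>2) = (\<lambda>x. indicator (cell M n t c) x *\<^sub>R (u t x)\<^sup>2)"
    using u_eq_ext[OF n t c] by (auto simp: indicator_def)
  ultimately show ?thesis by (simp add: set_integrable_def)
qed

lemma integrable_u_square:
  assumes n: "n < num_steps M" and t: "t \<in> time_slab M n"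
  shows "set_integrable lebesgue \<Omega> (\<lambda>x. (u t x)\<^sup>2)"
proof -
  have "u t \<in> dg_space \<Omega> M k n t"
    using sol n t by (simp add: ale_dg_solution_def)
  then show ?thesis by (simp add: dg_space_def L2_functions_def)
qed

lemma energy_eq_integral:
  assumes n: "n < num_steps M" and t: "t \<in> time_slab M n"
  shows "energy n t = (\<integral>x. (\<Sum>c\<in>cells M. indicator (cell M n t c) x *\<^sub>R (u t x)\<^sup>2) \<partial>lebesgue)"
  unfolding energy_def set_lebesgue_integral_def
  by (rule Bochner_Integration.integral_sum[symmetric])
    (use integrable_u_square_cell[OF n t] in \<open>simp add: set_integrable_def\<close>)

text \<open>The closed simplices cover the domain and their frontiers are null, so almost every
  point of the domain lies in some open cell.\<close>

lemma norm_le_energy: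
  assumes n: "n < num_steps M" and t: "t \<in> time_slab M n"
  shows "(LINT x:\<Omega>|lebesgue. (u t x)\<^sup>2) \<le> energy n t"
  unfolding energy_eq_integral[OF n t] set_lebesgue_integral_def
proof (rule integral_mono_AE)
  show "integrable lebesgue (\<lambda>x. indicator \<Omega> x *\<^sub>R (u t x)\<^sup>2)"
    using integrable_u_square[OF n t] by (simp add: set_integrable_def)
  show "integrable lebesgue (\<lambda>x. \<Sum>c\<in>cells M. indicator (cell M n t c) x *\<^sub>R (u t x)\<^sup>2)"
    using integrable_u_square_cell[OF n t] by (intro Bochner_Integration.integrable_sum) (simp add: set_integrable_def)
  let ?S = "\<lambda>c. convex hull (range (vertices M n t c))"
  have "AE x in lebesgue. \<forall>c\<in>cells M. x \<notin> frontier (?S c)"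
    by (intro AE_finite_allI finite_cells AE_not_in)
      (simp add: negligible_convex_frontier flip: negligible_iff_null_sets)
  then show "AE x in lebesgue. indicator \<Omega> x *\<^sub>R (u t x)\<^sup>2 \<le> (\<Sum>c\<in>cells M. indicator (cell M n t c) x *\<^sub>R (u t x)\<^sup>2)"
  proof eventually_elim
    fix x assume fr: "\<forall>c\<in>cells M. x \<notin> frontier (?S c)"
    show "indicator \<Omega> x *\<^sub>R (u t x)\<^sup>2 \<le> (\<Sum>c\<in>cells M. indicator (cell M n t c) x *\<^sub>R (u t x)\<^sup>2)"
    proof (cases "x \<in> \<Omega>")
      case True
      then obtain c where c: "c \<in> cells M" "x \<in> ?S c"
        using closure_subset[of \<Omega>] unfolding closure_domain_slab[OF n t] by blast
      then have "x \<in> cell M n t c"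
        using fr closure_subset by (auto simp: cell_def cell_of_def frontier_def)
      then have "(u t x)\<^sup>2 = indicator (cell M n t c) x *\<^sub>R (u t x)\<^sup>2" by simp
      also have "\<dots> \<le> (\<Sum>c\<in>cells M. indicator (cell M n t c) x *\<^sub>R (u t x)\<^sup>2)"
        by (rule member_le_sum) (use c finite_cells in auto)
      finally show ?thesis using True by simp
    qed (simp add: sum_nonneg)
  qed
qed

text \<open>The reverse bound: no point is counted twice because the cells are disjoint, and none
  lies outside the domain.\<close>

lemma energy_le_norm:
  assumes n: "n < num_steps M" and t: "t \<in> time_slab M n"
  shows "energy n t \<le> (LINT x:\<Omega>|lebesgue. (u t x)\<^sup>2)"
  unfolding energy_eq_integral[OF n t] set_lebesgue_integral_def
proof (rule integral_mono)
  show "integrable lebesgue (\<lambda>x. indicator \<Omega> x *\<^sub>R (u t x)\<^sup>2)"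
    using integrable_u_square[OF n t] by (simp add: set_integrable_def)
  show "integrable lebesgue (\<lambda>x. \<Sum>c\<in>cells M. indicator (cell M n t c) x *\<^sub>R (u t x)\<^sup>2)"
    using integrable_u_square_cell[OF n t] by (intro Bochner_Integration.integrable_sum) (simp add: set_integrable_def)
  fix x
  show "(\<Sum>c\<in>cells M. indicator (cell M n t c) x *\<^sub>R (u t x)\<^sup>2) \<le> indicator \<Omega> x *\<^sub>R (u t x)\<^sup>2"
  proof (cases "\<exists>c\<in>cells M. x \<in> cell M n t c")
    case True
    then obtain c where c: "c \<in> cells M" "x \<in> cell M n t c" by blast
    have "cell M n t c \<subseteq> interior (closure \<Omega>)"
      using c(1) unfolding cell_def cell_of_def closure_domain_slab[OF n t] by (intro interior_mono) auto
    \<comment> \<open>An open convex set is the interior of its closure, so an open cell contained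
      in the closure lies in the domain.\<close>
    also have "\<dots> = \<Omega>"
      using convex_interior_closure[OF convex_\<Omega>] open_\<Omega> by (simp add: interior_open)
    finally have "x \<in> \<Omega>" using c by blast
    moreover have "(\<Sum>c\<in>cells M. indicator (cell M n t c) x *\<^sub>R (u t x)\<^sup>2) =
        (\<Sum>c\<in>{c}. indicator (cell M n t c) x *\<^sub>R (u t x)\<^sup>2)"
      by (rule sum.mono_neutral_right)
        (use c cells_disjoint[OF n t c(1)] finite_cells in \<open>auto simp: indicator_def\<close>)
    ultimately show ?thesis using c by simp
  next
    case False
    then have "(\<Sum>c\<in>cells M. indicator (cell M n t c) x *\<^sub>R (u t x)\<^sup>2) = 0"
      by (intro sum.neutral) auto
    then show ?thesis by simp
  qed
qed

lemma slab_cover: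
  assumes "t \<in> {0..final_time M}"
  shows "\<exists>n<num_steps M. t \<in> time_slab M n"
proof (rule ccontr)
  assume no: "\<not> ?thesis"
  \<comment> \<open>A time lying in no slab would exceed each level in turn, hence equal the final
    one, which belongs to the last slab.\<close>
  have "time_level M n \<le> t" if "n \<le> num_steps M" for n
    using that
  proof (induction n)
    case 0
    then show ?case using assms moving by (simp add: moving_mesh_def)
  next
    case (Suc n)
    then have "n < num_steps M" "time_level M n \<le> t" by auto
    moreover have "t \<notin> time_slab M n" using no \<open>n < num_steps M\<close> by blast
    ultimately show ?case by (simp add: time_slab_def)
  qed
  then have "time_level M (num_steps M) = t"
    using assms by (auto simp: final_time_def intro: antisym)
  moreover have "0 < num_steps M"
    using moving by (simp add: moving_mesh_def)
  then have "num_steps M - 1 < num_steps M" "Suc (num_steps M - 1) = num_steps M" by auto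
  ultimately have "num_steps M - 1 < num_steps M \<and> t \<in> time_slab M (num_steps M - 1)"
    using level_in_slab(2)[of "num_steps M - 1"] by metis
  then show False using no by blast
qed

lemma L2_stable:
  assumes "t \<in> {0..final_time M}"
  shows "L2_norm_on \<Omega> (u t) \<le> L2_norm_on \<Omega> (u 0)"
proof -
  obtain n where n: "n < num_steps M" "t \<in> time_slab M n"
    using slab_cover[OF assms] by blast
  have 0: "0 < num_steps M" "0 \<in> time_slab M 0"
    using moving level_in_slab(1)[of 0] by (auto simp: moving_mesh_def)
  have "(LINT x:\<Omega>|lebesgue. (u t x)\<^sup>2) \<le> energy n t" by (rule norm_le_energy[OF n])
  also have "\<dots> \<le> energy 0 0" by (rule energy_le_initial[OF n])
  also have "\<dots> \<le> (LINT x:\<Omega>|lebesgue. (u 0 x)\<^sup>2)" by (rule energy_le_norm[OF 0])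
  finally show ?thesis by (simp add: L2_norm_on_def)
qed

end

theorem proposition3p1:
  fixes \<Omega> :: "(real ^ 'd) set"
    and M :: "('d::finite, 'c, 'v) mesh"
    and partner :: "'c \<times> 'd option \<Rightarrow> 'c \<times> 'd option"
    and shift :: "'c \<times> 'd option \<Rightarrow> real ^ 'd"
    and \<kappa> \<tau> :: real
    and k :: nat
    and f :: "real \<Rightarrow> real ^ 'd"
    and ghat :: "real ^ 'd \<Rightarrow> real \<Rightarrow> real \<Rightarrow> real ^ 'd \<Rightarrow> real"
    and u :: "real \<Rightarrow> real ^ 'd \<Rightarrow> real"
    and t :: real
  assumes "open \<Omega>" and "convex \<Omega>" and "\<Omega> \<noteq> {}" and "polyhedron (closure \<Omega>)"
    and "moving_mesh \<Omega> M"
    and "shape_regular \<kappa> \<tau> M"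
    and "continuous_on UNIV f"
    and "numerical_flux f ghat"
    and "periodic_identification M partner shift"
    and "ale_dg_solution \<Omega> M partner shift k f ghat u"
    and "t \<in> {0..final_time M}"
  shows "L2_norm_on \<Omega> (u t) \<le> L2_norm_on \<Omega> (u 0)"
proof -
  \<comment> \<open>A primitive on the whole line comes from the continuity of \<open>f\<close>
    alone, taken on the interval with infinite end points.\<close>
  have "\<exists>F. \<forall>y::real. - \<infinity> < ereal y \<longrightarrow> ereal y < \<infinity> \<longrightarrow> (F has_vector_derivative f y) (at y)"
    using assms(7) by (intro einterval_antiderivative) (auto simp: continuous_on_eq_continuous_at)
  then obtain F where F: "\<And>y. (F has_vector_derivative f y) (at y)"
    by auto
  have "regular_coefficients M k u"
    using assms(10) by (simp add: ale_dg_solution_def)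
  then obtain a where a: "\<forall>c\<in>cells M. (\<forall>\<alpha>\<in>multi_indices k. continuous_on {0..final_time M} (a c \<alpha>) \<and>
           (\<forall>n<num_steps M. a c \<alpha> differentiable_on time_slab M n)) \<and>
        (\<forall>n<num_steps M. \<forall>t\<in>time_slab M n. \<forall>\<xi>\<in>interior K_ref.
           u t (cell_map M n t c \<xi>) = (\<Sum>\<alpha>\<in>multi_indices k. a c \<alpha> t * monomial_at \<alpha> \<xi>))"
    unfolding regular_coefficients_def by (rule bchoice[THEN exE])
  interpret ale_dg \<Omega> M partner shift k f ghat u F a
  proof (intro ale_dg.intro ale_dg_axioms.intro periodic_mesh.intro)
    show "a c \<alpha> differentiable_on time_slab M n"
      if "c \<in> cells M" "\<alpha> \<in> multi_indices k" "n < num_steps M" for c \<alpha> n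
      using a that by blast
    show "u t (cell_map M n t c \<xi>) = poly_at k (\<lambda>\<alpha>. a c \<alpha> t) \<xi>"
      if "c \<in> cells M" "n < num_steps M" "t \<in> time_slab M n" "\<xi> \<in> interior K_ref" for c n t \<xi>
      unfolding poly_at_def using a that by blast
  qed (rule assms F)+
  show ?thesis by (rule L2_stable) fact
qed

end
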